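(* Let $k\ge2$ and let $P:\mathrm{Sym}([k])\to\{0,1\}$ be a non-trivial ordering predicate with coordinate degree $d$. Let $p=p(n)>0$ (a probability), $\varepsilon=\varepsilon(n)>0$, $D=D(n)\in\mathbb N$, and $\overline m=p\binom nk$. Suppose $$\varepsilon\in\left(0,\frac1{2^{2k+1}(2k)!}\right],\qquad D\le\frac nk .$$ Assume the Generalized Low Degree Conjecture (as stated in the context). If $$\overline m=o\!\left(\frac n{\varepsilon^2}\left(\frac nD\right)^{\frac d2-1}\right)\quad\text{and}\quad \overline m\,\varepsilon^2=\omega(1),$$ then no algorithm running in time $\exp(O(D/\mathrm{poly}\log(n)))$ achieves $\varepsilon$-refutation of a $p$-random $k$-OCSP instance with predicate $P$ on $n$ variables.
   Context: Orderings. $[n]=\{1,\dots,n\}$. For a finite set $S$, $\mathrm{Sym}(S)$ is the set of orderings of $S$: tuples $\mu=(\mu_1,\dots,\mu_{|S|})$ listing every element of $S$ exactly once; $\mu$ is identified with the bijection $i\mapsto\mu_i$ from $[|S|]$ to $S$. For $\pi\in\mathrm{Sym}([n])$ and $S\subseteq[n]$, $\pi[S]\in\mathrm{Sym}(S)$ is the induced ordering (delete from $\pi$ the entries not in $S$). For $\nu\in\mathrm{Sym}(S)$ with $|S|=k$ and $\tau\in \mathrm{Sym}(S)$, $\nu^{-1}(\tau)=(\nu^{-1}(\tau_1),\dots,\nu^{-1}(\tau_k))\in\mathrm{Sym}([k])$. Ordering CSPs. An ordering predicate is a map $P:\mathrm{Sym}([k])\to\{0,1\}$; $\mathrm{avg}(P)=|P^{-1}(1)|/k!$;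 $P$ is non-trivial if $0<\mathrm{avg}(P)<1$. A $k$-OCSP instance with predicate $P$ on $n$ variables is a list $\mathcal I=\{(S_i,P\circ\nu_i^{-1})\}_{i=1}^m$ with $S_i\in\binom{[n]}{k}$, $\nu_i\in\mathrm{Sym}(S_i)$. For $\pi\in\mathrm{Sym}([n])$, $\mathrm{val}(\mathcal I;\pi)=\frac1m\sum_{i=1}^m P(\nu_i^{-1}(\pi[S_i]))$ and $\mathrm{val}(\mathcal I)=\max_{\pi}\mathrm{val}(\mathcal I;\pi)$. A $p$-random $k$-OCSP instance with predicate $P$: include each $S\in\binom{[n]}k$ independently with probability $p$; for each included $S$ draw $\nu\in\mathrm{Sym}(S)$ uniformly (independently) and add the clause $(S,P\circ\nu^{-1})$. Coordinate degree. For $x\in[0,1]^k$, $\mathrm{ord}(x)\in\mathrm{Sym}([k])$ lists the indices in increasing order of $x_i$ (fixed tie-breaking rule). For $f\in L^2([0,1]^k)$ and $S\subseteq[k]$ set $f_S(x_S)=\sum_{T\subseteq S}(-1)^{|S|-|T|}\,\mathbb E_{x\sim\mathrm{Unif}([0,1]^k)}[f(x)\mid x_T]$ (Efron–Stein components), $f^{=j}=\sum_{|S|=j}f_S$, and $D(f)=\max\{j: f^{=j}\neq 0\}$. The coordinate degree of $P$ is $D(P):=D(f)$ for $f(x)=P(\mathrm{ord}(x))$. Refutation. An algorithm achieves $\varepsilon$-refutation of a random $k$-OCSP instance $\mathcal I$ with predicate $P$ if with probability $1-o(1)$ over $\mathcal I$ it returns a certificate that $\mathrm{val}(\mathcal I)\le\mathrm{avg}(P)+\varepsilon$;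 the algorithm must never err: on every input it either certifies this bound (and then the bound is true) or declares failure. Detection and advantage. Let $\mathbb P_n,\mathbb Q_n$ be distributions on a product space $\Omega^N$, $N=N(n)$. A test $g:\Omega^N\to\{0,1\}$ achieves strong detection if $\mathbb P(g=0)+\mathbb Q(g=1)=o(1)$. A function $\Omega^N\to\mathbb R$ has coordinate degree at most $D$ if it is a linear combination of functions each depending on at most $D$ coordinates; $V_D$ is the space of these, and $\mathrm{Adv}_{\le D}(\mathbb P,\mathbb Q)=\max\{\mathbb E_{\mathbb P}[g]: g\in V_D,\ \mathbb E_{\mathbb Q}[g^2]\le1\}$. Generalized Low Degree Conjecture. Let $N(n)$ be polynomially bounded, with $\mathbb Q_n$ a product distribution. For "sufficiently nice" sequences $\mathbb P,\mathbb Q$: (i) if $\mathrm{Adv}_{\le D}(\mathbb P,\mathbb Q)=O(1)$ for some $D\ge(\log n)^{1+c}$ with a constant $c>0$, then no polynomial-time algorithm achieves strong detection between $\mathbb P$ and $\mathbb Q$; (ii) if $\mathrm{Adv}_{\le D}(\mathbb P,\mathbb Q)=O(1)$, then no algorithm running in time $\exp(O(D/\mathrm{poly}\log(n)))$ achieves strong detection between $\mathbb P$ and $\mathbb Q$. The class of "sufficiently nice" pairs is not made precise; the conjecture is understood to cover the following pair. $\mathbb Q_n$ is the law of the $p$-random $k$-OCSP with predicate $P$, viewed as a product distribution with one coordinate per $S\in\binom{[n]}k$, with values in $\mathrm{Sym}(S)\cup\{\perp\}$ (the value $\nu$ encodes the clause $(S,P\circ\nu^{-1})$; $\perp$ means that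 $S$ is not included). $\mathbb P_n=\mathbb P_n(\varepsilon)$: draw $x\sim\mathrm{Unif}([0,1]^n)$; include each $S\in\binom{[n]}k$ independently with probability $p$; for each included $S$ draw independently $\nu\in\mathrm{Sym}(S)$ with probability $\frac1{k!}\left(1+2\varepsilon\frac{f^{=d}(x_\nu)}{\|f^{=d}\|_2^2}\right)$, where $f(y)=P(\mathrm{ord}(y))$, $x_\nu=(x_{\nu_1},\dots,x_{\nu_k})$, $\|f^{=d}\|_2^2=\mathbb E_{y\sim\mathrm{Unif}([0,1]^k)}[f^{=d}(y)^2]$, and add the clause $(S,P\circ\nu^{-1})$. The poly-logarithmic factor in the running time in the theorem is the same as the one in the conjecture. *)

theory Defs
  imports "HOL-Probability.Probability" "HOL-Probability.Product_PMF"
    "HOL-Combinatorics.Multiset_Permutations" "HOL-Library.Landau_Symbols"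
begin

text \<open>An ordering of a finite set S is a list in \<^term>\<open>permutations_of_set S\<close>. Positions and
  elements are numbered from 1, whereas list indexing starts at 0.\<close>

definition ordering_inv :: "nat list \<Rightarrow> nat \<Rightarrow> nat" where
  "ordering_inv \<nu> = inv_into {1..length \<nu>} (\<lambda>i. \<nu> ! (i - 1))"

definition induced_ordering :: "nat list \<Rightarrow> nat set \<Rightarrow> nat list" where
  "induced_ordering \<pi> S = filter (\<lambda>i. i \<in> S) \<pi>"

text \<open>A predicate on the orderings of {1..k} is a map on lists of which only the values on
  \<^term>\<open>permutations_of_set {1..k}\<close> are ever used.\<close>

definition avg :: "nat \<Rightarrow> (nat list \<Rightarrow> bool) \<Rightarrow> real" where
  "avg k P = real (card {\<tau> \<in> permutations_of_set {1..k}. P \<tau>}) / fact k"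

definition nontrivial :: "nat \<Rightarrow> (nat list \<Rightarrow> bool) \<Rightarrow> bool" where
  "nontrivial k P \<longleftrightarrow> 0 < avg k P \<and> avg k P < 1"

definition scopes :: "nat \<Rightarrow> nat \<Rightarrow> nat set set" where
  "scopes k n = {S. S \<subseteq> {1..n} \<and> card S = k}"

text \<open>A clause, with scope S and constraint P composed with the inverse of \<nu>, is stored as the
  ordering \<nu> alone; its scope is \<^term>\<open>set \<nu>\<close>.\<close>

definition ocsp_instances :: "nat \<Rightarrow> nat \<Rightarrow> nat list list set" where
  "ocsp_instances k n = lists (\<Union>S\<in>scopes k n. permutations_of_set S)"

text \<open>The value of the empty instance is 0 by the convention on division by zero.\<close>

definition val_at :: "(nat list \<Rightarrow> bool) \<Rightarrow> nat list list \<Rightarrow> nat list \<Rightarrow> real" where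
  "val_at P I \<pi> =
     (\<Sum>\<nu>\<leftarrow>I. of_bool (P (map (ordering_inv \<nu>) (induced_ordering \<pi> (set \<nu>))))) / real (length I)"

definition val :: "nat \<Rightarrow> (nat list \<Rightarrow> bool) \<Rightarrow> nat list list \<Rightarrow> real" where
  "val n P I = Max (val_at P I ` permutations_of_set {1..n})"

definition unit_cube :: "nat \<Rightarrow> (nat \<Rightarrow> real) measure" where
  "unit_cube n = (\<Pi>\<^sub>M i\<in>{1..n}. uniform_measure lborel {0..1})"

text \<open>\<^const>\<open>sort_key\<close> is stable, so ties are broken in favour of the smaller index.\<close>

definition ord_of :: "nat \<Rightarrow> (nat \<Rightarrow> real) \<Rightarrow> nat list" where
  "ord_of k x = sort_key x [1..<Suc k]"

text \<open>The everywhere defined version of the conditional expectation of f given the coordinates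
  in T: these are kept and the remaining ones are integrated out.\<close>

definition cond_mean ::
    "nat \<Rightarrow> ((nat \<Rightarrow> real) \<Rightarrow> real) \<Rightarrow> nat set \<Rightarrow> (nat \<Rightarrow> real) \<Rightarrow> real" where
  "cond_mean k f T x =
     (\<integral>y. f (\<lambda>i\<in>{1..k}. if i \<in> T then x i else y i) \<partial>unit_cube k)"

definition efron_stein ::
    "nat \<Rightarrow> ((nat \<Rightarrow> real) \<Rightarrow> real) \<Rightarrow> nat set \<Rightarrow> (nat \<Rightarrow> real) \<Rightarrow> real" where
  "efron_stein k f S x = (\<Sum>T\<in>Pow S. (- 1) ^ (card S - card T) * cond_mean k f T x)"

definition degree_part ::
    "nat \<Rightarrow> ((nat \<Rightarrow> real) \<Rightarrow> real) \<Rightarrow> nat \<Rightarrow> (nat \<Rightarrow> real) \<Rightarrow> real" where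
  "degree_part k f j x = (\<Sum>S\<in>scopes j k. efron_stein k f S x)"

text \<open>Being nonzero is meant in the sense of \<open>L\<^sup>2\<close>, that is, not almost everywhere zero.\<close>

definition coordinate_degree :: "nat \<Rightarrow> ((nat \<Rightarrow> real) \<Rightarrow> real) \<Rightarrow> nat" where
  "coordinate_degree k f = Max {j \<in> {0..k}. \<not> (AE x in unit_cube k. degree_part k f j x = 0)}"

definition predicate_fun :: "nat \<Rightarrow> (nat list \<Rightarrow> bool) \<Rightarrow> (nat \<Rightarrow> real) \<Rightarrow> real" where
  "predicate_fun k P x = of_bool (P (ord_of k x))"

definition predicate_degree :: "nat \<Rightarrow> (nat list \<Rightarrow> bool) \<Rightarrow> nat" where
  "predicate_degree k P = coordinate_degree k (predicate_fun k P)"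

definition top_part :: "nat \<Rightarrow> (nat list \<Rightarrow> bool) \<Rightarrow> (nat \<Rightarrow> real) \<Rightarrow> real" where
  "top_part k P = degree_part k (predicate_fun k P) (predicate_degree k P)"

definition top_norm_sq :: "nat \<Rightarrow> (nat list \<Rightarrow> bool) \<Rightarrow> real" where
  "top_norm_sq k P = (\<integral>y. (top_part k P y)\<^sup>2 \<partial>unit_cube k)"

text \<open>Deterministic Turing machines with finitely many two-way infinite tapes. States and
  symbols are initial segments of the naturals; symbol 0 is the blank, and input words are over
  {1, 2, 3}. A machine answers by entering its accepting or its rejecting state.\<close>

record tm =
  tm_tapes :: nat
  tm_states :: nat
  tm_symbols :: nat
  tm_start :: nat
  tm_accept :: nat
  tm_reject :: nat
  tm_delta :: "nat \<Rightarrow> nat list \<Rightarrow> nat \<times> (nat \<times> int) list"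

definition turing_machine :: "tm \<Rightarrow> bool" where
  "turing_machine M \<longleftrightarrow>
     1 \<le> tm_tapes M \<and> {0, 1, 2, 3} \<subseteq> {..<tm_symbols M} \<and>
     {tm_start M, tm_accept M, tm_reject M} \<subseteq> {..<tm_states M} \<and> tm_accept M \<noteq> tm_reject M \<and>
     (\<forall>q < tm_states M. \<forall>as. length as = tm_tapes M \<and> set as \<subseteq> {..<tm_symbols M} \<longrightarrow>
        (case tm_delta M q as of (q', acts) \<Rightarrow>
           q' < tm_states M \<and> length acts = tm_tapes M \<and>
           set acts \<subseteq> {..<tm_symbols M} \<times> {- 1, 0, 1}))"

text \<open>A configuration consists of the state and, for each tape, its contents and head
  position. Halting configurations are fixed points of the step function.\<close>

type_synonym tm_config = "nat \<times> ((int \<Rightarrow> nat) \<times> int) list"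

definition tm_step :: "tm \<Rightarrow> tm_config \<Rightarrow> tm_config" where
  "tm_step M = (\<lambda>(q, ts).
     if q = tm_accept M \<or> q = tm_reject M then (q, ts)
     else (case tm_delta M q (map (\<lambda>(t, h). t h) ts) of (q', acts) \<Rightarrow>
       (q', map2 (\<lambda>(t, h) (a, mv). (t(h := a), h + mv)) ts acts)))"

definition tm_init :: "tm \<Rightarrow> nat list \<Rightarrow> tm_config" where
  "tm_init M w =
     (tm_start M,
      (\<lambda>i. if 0 \<le> i \<and> nat i < length w then w ! nat i else 0, 0)
        # replicate (tm_tapes M - 1) (\<lambda>_. 0, 0))"

definition tm_state_after :: "tm \<Rightarrow> nat list \<Rightarrow> nat \<Rightarrow> nat" where
  "tm_state_after M w t = fst ((tm_step M ^^ t) (tm_init M w))"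

definition tm_accepts :: "tm \<Rightarrow> nat list \<Rightarrow> bool" where
  "tm_accepts M w \<longleftrightarrow> (\<exists>t. tm_state_after M w t = tm_accept M)"

definition tm_halts_within :: "tm \<Rightarrow> nat list \<Rightarrow> real \<Rightarrow> bool" where
  "tm_halts_within M w T \<longleftrightarrow>
     (\<exists>t. real t \<le> T \<and> tm_state_after M w t \<in> {tm_accept M, tm_reject M})"

definition tm_halts :: "tm \<Rightarrow> nat list \<Rightarrow> bool" where
  "tm_halts M w \<longleftrightarrow> (\<exists>T. tm_halts_within M w T)"

definition runs_in_time :: "tm \<Rightarrow> (nat \<Rightarrow> nat list set) \<Rightarrow> (nat \<Rightarrow> real) \<Rightarrow> bool" where
  "runs_in_time M inputs T \<longleftrightarrow>
     (\<forall>n. \<forall>w\<in>inputs n. tm_halts M w) \<and>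
     (\<forall>\<^sub>F n in sequentially. \<forall>w\<in>inputs n. tm_halts_within M w (T n))"

text \<open>Binary digits, least significant first, written with the symbols 1 (zero) and 2 (one).\<close>

fun binary :: "nat \<Rightarrow> nat list" where
  "binary v = (if v = 0 then [] else (1 + v mod 2) # binary (v div 2))"

declare binary.simps [simp del]

text \<open>The input word: the number of variables followed by the entries of all clauses, each
  number terminated by the symbol 3. Clauses need no delimiter, as all have the same length k.\<close>

definition encode_instance :: "nat \<Rightarrow> nat list list \<Rightarrow> nat list" where
  "encode_instance n I = concat (map (\<lambda>v. binary v @ [3]) (n # concat I))"

text \<open>A sequence of pairs of distributions on the product, over the coordinates, of the given
  alphabets, together with the format in which a sample is handed to an algorithm.\<close>

record ('i, 'v) detection_problem =
  coords :: "nat \<Rightarrow> 'i set"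
  alphabet :: "nat \<Rightarrow> 'i \<Rightarrow> 'v set"
  planted :: "nat \<Rightarrow> ('i \<Rightarrow> 'v) pmf"
  null :: "nat \<Rightarrow> ('i \<Rightarrow> 'v) pmf"
  sample_word :: "nat \<Rightarrow> ('i \<Rightarrow> 'v) \<Rightarrow> nat list"

definition sample_space :: "('i, 'v) detection_problem \<Rightarrow> nat \<Rightarrow> ('i \<Rightarrow> 'v) set" where
  "sample_space X n = PiE (coords X n) (alphabet X n)"

definition polynomially_many_coords :: "('i, 'v) detection_problem \<Rightarrow> bool" where
  "polynomially_many_coords X \<longleftrightarrow>
     (\<forall>n. finite (coords X n)) \<and>
     (\<exists>c::nat. (\<lambda>n. real (card (coords X n))) \<in> O(\<lambda>n. real n ^ c))"

definition supported_on_product :: "('i, 'v) detection_problem \<Rightarrow> bool" where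
  "supported_on_product X \<longleftrightarrow>
     (\<forall>n. set_pmf (planted X n) \<subseteq> sample_space X n \<and> set_pmf (null X n) \<subseteq> sample_space X n)"

definition product_null :: "('i, 'v) detection_problem \<Rightarrow> bool" where
  "product_null X \<longleftrightarrow> (\<forall>n. \<exists>q. null X n = Pi_pmf (coords X n) undefined q)"

definition strong_detection ::
    "('i, 'v) detection_problem \<Rightarrow> (nat \<Rightarrow> ('i \<Rightarrow> 'v) \<Rightarrow> bool) \<Rightarrow> bool" where
  "strong_detection X g \<longleftrightarrow>
     (\<lambda>n. measure_pmf.prob (planted X n) {\<omega>. \<not> g n \<omega>} + measure_pmf.prob (null X n) {\<omega>. g n \<omega>})
       \<longlonglongrightarrow> 0"

definition strongly_detectable_in_time ::
    "('i, 'v) detection_problem \<Rightarrow> (nat \<Rightarrow> real) \<Rightarrow> bool" where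
  "strongly_detectable_in_time X T \<longleftrightarrow>
     (\<exists>M. turing_machine M \<and>
          runs_in_time M (\<lambda>n. sample_word X n ` sample_space X n) T \<and>
          strong_detection X (\<lambda>n \<omega>. tm_accepts M (sample_word X n \<omega>)))"

definition depends_on :: "'i set \<Rightarrow> (('i \<Rightarrow> 'v) \<Rightarrow> real) \<Rightarrow> bool" where
  "depends_on J h \<longleftrightarrow> (\<forall>\<omega> \<omega>'. (\<forall>i\<in>J. \<omega> i = \<omega>' i) \<longrightarrow> h \<omega> = h \<omega>')"

definition low_coordinate_degree :: "'i set \<Rightarrow> nat \<Rightarrow> (('i \<Rightarrow> 'v) \<Rightarrow> real) set" where
  "low_coordinate_degree I D =
     {g. \<exists>F c. finite F \<and> (\<forall>h\<in>F. \<exists>J\<subseteq>I. finite J \<and> card J \<le> D \<and> depends_on J h) \<and>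
               g = (\<lambda>\<omega>. \<Sum>h\<in>F. c h * h \<omega>)}"

text \<open>The advantage is extended-real valued, since over infinite alphabets the supremum need not
  be finite. The integrability conditions hold automatically over finite alphabets.\<close>

definition advantage :: "('i, 'v) detection_problem \<Rightarrow> nat \<Rightarrow> nat \<Rightarrow> ereal" where
  "advantage X n D =
     (SUP g \<in> {g \<in> low_coordinate_degree (coords X n) D.
                 integrable (measure_pmf (planted X n)) g \<and>
                 integrable (measure_pmf (null X n)) (\<lambda>\<omega>. (g \<omega>)\<^sup>2) \<and>
                 measure_pmf.expectation (null X n) (\<lambda>\<omega>. (g \<omega>)\<^sup>2) \<le> 1}.
        ereal (measure_pmf.expectation (planted X n) g))"

definition bounded_advantage :: "('i, 'v) detection_problem \<Rightarrow> (nat \<Rightarrow> nat) \<Rightarrow> bool" where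
  "bounded_advantage X D \<longleftrightarrow> (\<exists>C::real. \<forall>\<^sub>F n in sequentially. advantage X n (D n) \<le> ereal C)"

definition polylogarithmic :: "(nat \<Rightarrow> real) \<Rightarrow> bool" where
  "polylogarithmic L \<longleftrightarrow>
     (\<forall>\<^sub>F n in sequentially. 1 \<le> L n) \<and> (\<exists>c::nat. L \<in> O(\<lambda>n. ln (real n) ^ c))"

text \<open>The conjecture leaves open which problems are sufficiently nice, and which
  polylogarithmic factor divides D in the exponent of the running time. Both are parameters
  here: the class \<open>nice\<close> and the function L.\<close>

definition low_degree_conjecture ::
    "(('i, 'v) detection_problem \<Rightarrow> bool) \<Rightarrow> (nat \<Rightarrow> real) \<Rightarrow> bool" where
  "low_degree_conjecture nice L \<longleftrightarrow>
     (\<forall>X D. nice X \<and> polynomially_many_coords X \<and> supported_on_product X \<and> product_null X \<and>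
            bounded_advantage X D \<longrightarrow>
        ((\<exists>c>0. \<forall>\<^sub>F n in sequentially. ln (real n) powr (1 + c) \<le> real (D n)) \<longrightarrow>
           \<not> (\<exists>c::nat. strongly_detectable_in_time X (\<lambda>n. real n ^ c))) \<and>
        \<not> (\<exists>C. strongly_detectable_in_time X (\<lambda>n. exp (C * real (D n) / L n))))"

text \<open>A sample assigns to each scope S either \<^const>\<open>None\<close> (S is not included) or the
  ordering of S that stands for the clause on S.\<close>

definition null_ocsp :: "nat \<Rightarrow> real \<Rightarrow> nat \<Rightarrow> (nat set \<Rightarrow> nat list option) pmf" where
  "null_ocsp k p n = Pi_pmf (scopes k n) undefined (\<lambda>S.
     bind_pmf (bernoulli_pmf p) (\<lambda>b.
       if b then map_pmf Some (pmf_of_set (permutations_of_set S)) else return_pmf None))"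

text \<open>The instance represented by a sample: its clauses in lexicographic order of their scopes,
  which \<^const>\<open>List.subseqs\<close> enumerates as increasing lists.\<close>

definition ocsp_of_sample ::
    "nat \<Rightarrow> nat \<Rightarrow> (nat set \<Rightarrow> nat list option) \<Rightarrow> nat list list" where
  "ocsp_of_sample k n \<omega> =
     List.map_filter (\<lambda>xs. \<omega> (set xs)) (filter (\<lambda>xs. length xs = k) (List.subseqs [1..<Suc n]))"

definition random_ocsp :: "nat \<Rightarrow> real \<Rightarrow> nat \<Rightarrow> nat list list pmf" where
  "random_ocsp k p n = map_pmf (ocsp_of_sample k n) (null_ocsp k p n)"

text \<open>The conditional probability, given x, that the coordinate of a scope takes a given value.\<close>

definition planted_weight ::
    "nat \<Rightarrow> (nat list \<Rightarrow> bool) \<Rightarrow> real \<Rightarrow> real \<Rightarrow> (nat \<Rightarrow> real) \<Rightarrow> nat list option \<Rightarrow> real" where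
  "planted_weight k P p \<epsilon> x v = (case v of
       None \<Rightarrow> 1 - p
     | Some \<nu> \<Rightarrow> p * (1 / fact k *
         (1 + 2 * \<epsilon> * (top_part k P (\<lambda>i\<in>{1..k}. x (\<nu> ! (i - 1))) / top_norm_sq k P))))"

definition ocsp_alphabet :: "nat set \<Rightarrow> nat list option set" where
  "ocsp_alphabet S = insert None (Some ` permutations_of_set S)"

text \<open>The coordinates being independent given x, the mass of a sample is the mean over x of the
  product of the conditional probabilities. (These form a probability distribution only for
  almost every x, because of ties; hence no kernel into \<open>pmf\<close> is used.)\<close>

definition planted_ocsp ::
    "nat \<Rightarrow> (nat list \<Rightarrow> bool) \<Rightarrow> real \<Rightarrow> real \<Rightarrow> nat \<Rightarrow> (nat set \<Rightarrow> nat list option) pmf" where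
  "planted_ocsp k P p \<epsilon> n = embed_pmf (\<lambda>\<omega>.
     if \<omega> \<in> PiE (scopes k n) ocsp_alphabet
     then \<integral>x. (\<Prod>S\<in>scopes k n. planted_weight k P p \<epsilon> x (\<omega> S)) \<partial>unit_cube n
     else 0)"

definition ocsp_detection ::
    "nat \<Rightarrow> (nat list \<Rightarrow> bool) \<Rightarrow> (nat \<Rightarrow> real) \<Rightarrow> (nat \<Rightarrow> real) \<Rightarrow>
      (nat set, nat list option) detection_problem" where
  "ocsp_detection k P p \<epsilon> =
     \<lparr>coords = scopes k,
      alphabet = (\<lambda>n. ocsp_alphabet),
      planted = (\<lambda>n. planted_ocsp k P (p n) (\<epsilon> n) n),
      null = (\<lambda>n. null_ocsp k (p n) n),
      sample_word = (\<lambda>n \<omega>. encode_instance n (ocsp_of_sample k n \<omega>))\<rparr>"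

text \<open>Accepting means certifying the bound, rejecting means declaring failure. Soundness is
  required on every instance.\<close>

definition achieves_refutation ::
    "tm \<Rightarrow> nat \<Rightarrow> (nat list \<Rightarrow> bool) \<Rightarrow> (nat \<Rightarrow> real) \<Rightarrow> (nat \<Rightarrow> real) \<Rightarrow> bool" where
  "achieves_refutation M k P p \<epsilon> \<longleftrightarrow>
     turing_machine M \<and>
     (\<forall>n. \<forall>I\<in>ocsp_instances k n.
        tm_halts M (encode_instance n I) \<and>
        (tm_accepts M (encode_instance n I) \<longrightarrow> val n P I \<le> avg k P + \<epsilon> n)) \<and>
     (\<lambda>n. measure_pmf.prob (random_ocsp k (p n) n) {I. tm_accepts M (encode_instance n I)})
        \<longlonglongrightarrow> 1"

text \<open>Running times are measured in n, so they refer to instances in which every scope occurs at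
  most once, as in the random model; otherwise the number of clauses would be unbounded.\<close>

definition ocsp_inputs :: "nat \<Rightarrow> nat \<Rightarrow> nat list set" where
  "ocsp_inputs k n = encode_instance n ` {I \<in> ocsp_instances k n. distinct (map set I)}"

end

theory Submission
  imports Defs
begin

text \<open>A refutation algorithm with its two answers exchanged detects the planted distribution: on a
  random instance it certifies the bound, whereas the value of a planted instance exceeds the bound
  with high probability (Chebyshev's inequality at the ordering given by x, where the tilt makes the
  expected value avg(P) + 2\<epsilon>). The conjecture forbids this once the advantage is bounded.

  Expanding the product of the factors 1 + (2 \<epsilon> / N) \<phi>, where \<phi> is the tilt of a clause by the top
  degree part and N its squared norm, splits the likelihood ratio into orthogonal terms R(A), one for
  each set A of scopes, and only those with |A| \<le> D see a test of coordinate degree D. As the top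
  part is a sum of functions of d variables each of which has mean zero in every one of them, R(A)
  vanishes unless the d-subsets chosen from the clauses of A can cover every point at least twice, so
  that A is concentrated on at most d|A|/2 variables. Counting these A gives a geometric series.

  That the planted weights are nonnegative rests on N \<ge> 1/(2k)!: N is a signed sum of means of
  products of two 0/1-valued functions of the order type of 2k independent uniform variables, hence an
  integer multiple of 1/(2k)!. The count needs d \<ge> 2, which holds as an additive function of the
  coordinates that depends on their order alone is constant.\<close>

section \<open>The unit cube\<close>

text \<open>Keeps the simplifier from turning {1..n} into {Suc 0..n}.\<close>

declare One_nat_def [simp del]

text \<open>The threshold comes out of one count. A set of a scopes contributes at most (C
  \<epsilon>^2 p)^a and lives on at most s = d a / 2 core variables. There are about (n/s)^s choices
  of the core and (s^d n^(k-d))^a / a! ways of attaching the scopes, so up to constants level a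
  amounts to (\<epsilon>^2 p n^(k-1) (a/n)^(d/2-1))^a. As d \<ge> 2 the base is largest at a = D,
  where the first growth hypothesis makes it tend to zero. The tilt 2 \<epsilon> leaves a margin
  \<epsilon> above the certified bound. Two fluctuations compete with it: the choice of clauses
  given x, of relative variance about 1 / (p (n choose k) \<epsilon>^2), which the second growth
  hypothesis controls, and that of x itself, of relative variance O(1/n) for every \<epsilon>. A
  recurring obstacle is ties. The tilt is guaranteed to average to zero over the orderings of a
  scope only where the coordinates are distinct, so pointwise identities carry
  \<open>inj_on x {1..n}\<close> and are integrated almost everywhere; conversely, a function of the
  order type that vanishes almost surely vanishes at every such point.\<close>

lemma prob_space_uniform: "prob_space (uniform_measure lborel {0..1::real})"
  by (rule prob_space_uniform_measure) auto

lemma prob_space_unit_cube: "prob_space (unit_cube n)"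
  unfolding unit_cube_def by (intro prob_space_PiM prob_space_uniform)

lemma space_unit_cube: "space (unit_cube n) = PiE {1..n} (\<lambda>_. UNIV)"
  by (simp add: unit_cube_def space_PiM)

lemma sets_unit_cube [measurable_cong]: "sets (unit_cube n) = sets (\<Pi>\<^sub>M i\<in>{1..n}. borel)"
  unfolding unit_cube_def by (intro sets_PiM_cong) auto

lemma extensional_unit_cube: "x \<in> space (unit_cube n) \<Longrightarrow> (\<lambda>i\<in>{1..n}. x i) = x"
  by (auto simp: space_unit_cube PiE_def extensional_restrict)

lemma restrict_in_unit_cube: "(\<lambda>i\<in>{1..n}. g i) \<in> space (unit_cube n)"
  by (simp add: space_unit_cube)

text \<open>The integrands are bounded pieces combined by sums and products, so one class closed
  under these and under \<open>cond_mean\<close> settles integrability throughout. The bound is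
  required at every point, not almost everywhere, because integrands are evaluated at substituted
  points.\<close>

definition bounded_fun :: "nat \<Rightarrow> ((nat \<Rightarrow> real) \<Rightarrow> real) \<Rightarrow> bool" where
  "bounded_fun n f \<longleftrightarrow> f \<in> borel_measurable (unit_cube n) \<and> (\<exists>B. \<forall>x. \<bar>f x\<bar> \<le> B)"

lemma bounded_funI: "f \<in> borel_measurable (unit_cube n) \<Longrightarrow> (\<And>x. \<bar>f x\<bar> \<le> B) \<Longrightarrow> bounded_fun n f"
  unfolding bounded_fun_def by blast

lemma bounded_fun_measurable [dest, measurable_dest]: "bounded_fun n f \<Longrightarrow> f \<in> borel_measurable (unit_cube n)"
  unfolding bounded_fun_def by blast

lemma bounded_fun_const [intro, simp]: "bounded_fun n (\<lambda>_. c)"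
  by (rule bounded_funI[of _ _ "\<bar>c\<bar>"]) auto

lemma bounded_fun_add [intro]:
  assumes "bounded_fun n f" "bounded_fun n g" shows "bounded_fun n (\<lambda>x. f x + g x)"
proof -
  obtain B C where "\<forall>x. \<bar>f x\<bar> \<le> B" "\<forall>x. \<bar>g x\<bar> \<le> C" using assms unfolding bounded_fun_def by blast
  then have "\<bar>f x + g x\<bar> \<le> B + C" for x
    by (meson abs_triangle_ineq add_mono order_trans)
  moreover have "(\<lambda>x. f x + g x) \<in> borel_measurable (unit_cube n)"
    using assms by (intro borel_measurable_add) auto
  ultimately show ?thesis by (rule bounded_funI[rotated])
qed

lemma bounded_fun_mult [intro]:
  assumes "bounded_fun n f" "bounded_fun n g" shows "bounded_fun n (\<lambda>x. f x * g x)"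
proof -
  obtain B C where BC: "\<forall>x. \<bar>f x\<bar> \<le> B" "\<forall>x. \<bar>g x\<bar> \<le> C" using assms unfolding bounded_fun_def by blast
  have "\<bar>f x * g x\<bar> \<le> B * C" for x
    unfolding abs_mult using BC by (intro mult_mono) (auto intro: order_trans[OF abs_ge_zero])
  moreover have "(\<lambda>x. f x * g x) \<in> borel_measurable (unit_cube n)"
    using assms by (intro borel_measurable_times) auto
  ultimately show ?thesis by (rule bounded_funI[rotated])
qed

lemma bounded_fun_diff [intro]:
  assumes "bounded_fun n f" "bounded_fun n g" shows "bounded_fun n (\<lambda>x. f x - g x)"
  using bounded_fun_add[OF assms(1) bounded_fun_mult[OF bounded_fun_const[of n "-1"] assms(2)]] by simp

lemma bounded_fun_sum [intro]:
  assumes "\<And>i. i \<in> I \<Longrightarrow> bounded_fun n (f i)" shows "bounded_fun n (\<lambda>x. \<Sum>i\<in>I. f i x)"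
  using assms by (induction I rule: infinite_finite_induct) auto

lemma bounded_fun_prod [intro]:
  assumes "\<And>i. i \<in> I \<Longrightarrow> bounded_fun n (f i)" shows "bounded_fun n (\<lambda>x. \<Prod>i\<in>I. f i x)"
  using assms by (induction I rule: infinite_finite_induct) auto

lemma bounded_fun_power [intro]: "bounded_fun n f \<Longrightarrow> bounded_fun n (\<lambda>x. f x ^ m)"
  by (induction m) auto

lemma bounded_fun_integrable [intro]:
  assumes "bounded_fun n f" shows "integrable (unit_cube n) f"
proof -
  interpret prob_space "unit_cube n" by (rule prob_space_unit_cube)
  obtain B where "\<forall>x. \<bar>f x\<bar> \<le> B" using assms unfolding bounded_fun_def by blast
  then show ?thesis using assms
    by (intro integrable_const_bound[of _ B]) auto
qed

section \<open>Selecting coordinates along an injection\<close>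

lemma measurable_unit_cube_component:
  "i \<in> {1..n} \<Longrightarrow> (\<lambda>x. x i) \<in> borel_measurable (unit_cube n)"
  unfolding measurable_cong_sets[OF sets_unit_cube refl] by (rule measurable_component_singleton)

lemma measurable_reindex:
  assumes "h ` {1..k} \<subseteq> {1..n}"
  shows "(\<lambda>x. \<lambda>i\<in>{1..k}. x (h i)) \<in> measurable (unit_cube n) (unit_cube k)"
  unfolding measurable_cong_sets[OF refl sets_unit_cube]
proof (intro measurable_restrict measurable_unit_cube_component)
  show "h i \<in> {1..n}" if "i \<in> {1..k}" for i using assms that by blast
qed

text \<open>Lets integrals over the variables of a clause, or over one of two copies inside the
  2k-cube, be computed in the k-cube.\<close>

lemma distr_reindex:
  assumes "inj_on h {1..k}" "h ` {1..k} \<subseteq> {1..n}"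
  shows "distr (unit_cube n) (unit_cube k) (\<lambda>x. \<lambda>i\<in>{1..k}. x (h i)) = unit_cube k"
  using distr_PiM_reindex[of "{1..n}" "\<lambda>_. uniform_measure lborel {0..1::real}" h "{1..k}"] assms
  by (auto simp: unit_cube_def prob_space_uniform)

lemma integral_reindex:
  assumes "inj_on h {1..k}" "h ` {1..k} \<subseteq> {1..n}" "bounded_fun k g"
  shows "(\<integral>x. g (\<lambda>i\<in>{1..k}. x (h i)) \<partial>unit_cube n) = (\<integral>x. g x \<partial>unit_cube k)"
  using assms measurable_reindex[OF assms(2)]
  by (subst distr_reindex[OF assms(1,2), symmetric], subst integral_distr) auto

lemma bounded_fun_reindex:
  assumes "h ` {1..k} \<subseteq> {1..n}" "bounded_fun k g"
  shows "bounded_fun n (\<lambda>x. g (\<lambda>i\<in>{1..k}. x (h i)))"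
proof -
  obtain B where "\<forall>x. \<bar>g x\<bar> \<le> B" using assms unfolding bounded_fun_def by blast
  then show ?thesis using assms measurable_compose[OF measurable_reindex[OF assms(1)], of g borel]
    by (intro bounded_funI[of _ _ B]) auto
qed

lemma AE_reindex:
  assumes "inj_on h {1..k}" "h ` {1..k} \<subseteq> {1..n}" "AE x in unit_cube k. Q x"
  shows "AE x in unit_cube n. Q (\<lambda>i\<in>{1..k}. x (h i))"
  using AE_distrD[OF measurable_reindex[OF assms(2)], of Q] assms(3)
  unfolding distr_reindex[OF assms(1,2)] by simp

section \<open>Resampling and conditional means\<close>

definition resample :: "nat \<Rightarrow> nat set \<Rightarrow> (nat \<Rightarrow> real) \<Rightarrow> (nat \<Rightarrow> real) \<Rightarrow> nat \<Rightarrow> real" where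
  "resample n T x y = (\<lambda>i\<in>{1..n}. if i \<in> T then x i else y i)"

lemma resample_in_unit_cube [simp]: "resample n T x y \<in> space (unit_cube n)"
  unfolding resample_def by (rule restrict_in_unit_cube)

lemma measurable_resample_pair:
  "(\<lambda>z. resample n T (fst z) (snd z)) \<in> measurable (unit_cube n \<Otimes>\<^sub>M unit_cube n) (unit_cube n)"
  unfolding measurable_cong_sets[OF refl sets_unit_cube] resample_def
proof (intro measurable_restrict)
  fix i assume i: "i \<in> {1..n}"
  note [measurable] = measurable_unit_cube_component[OF i]
  show "(\<lambda>z. if i \<in> T then fst z i else snd z i) \<in> borel_measurable (unit_cube n \<Otimes>\<^sub>M unit_cube n)"
    by (cases "i \<in> T") simp_all
qed

text \<open>A product measure is determined by its values on boxes, and the preimage of a box is the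
  product of a box in the kept coordinates of x and one in the other coordinates of y; the free
  sides contribute factors one.\<close>

lemma distr_resample:
  "distr (unit_cube n \<Otimes>\<^sub>M unit_cube n) (unit_cube n) (\<lambda>z. resample n T (fst z) (snd z)) = unit_cube n"
  (is "?D = _")
proof -
  let ?M = "uniform_measure lborel {0..1::real}"
  let ?U = "unit_cube n"
  interpret prob_space ?M by (rule prob_space_uniform)
  interpret product_prob_space "\<lambda>_::nat. ?M" by unfold_locales
  interpret U: prob_space ?U by (rule prob_space_unit_cube)
  interpret UU: pair_prob_space ?U ?U ..
  have box: "emeasure ?U (PiE {1..n} A) = (\<Prod>i\<in>{1..n}. emeasure ?M (A i))"
    if "\<And>i. i \<in> {1..n} \<Longrightarrow> A i \<in> sets borel" for A
    unfolding unit_cube_def using that by (intro emeasure_PiM) auto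
  have "?D = (\<Pi>\<^sub>M i\<in>{1..n}. ?M)"
  proof (rule PiM_eqI)
    show "sets ?D = sets (\<Pi>\<^sub>M i\<in>{1..n}. ?M)" by (simp add: unit_cube_def)
  next
    fix A assume A: "\<And>i. i \<in> {1..n} \<Longrightarrow> A i \<in> sets ?M"
    define A1 where "A1 i = (if i \<in> T then A i else UNIV)" for i
    define A2 where "A2 i = (if i \<in> T then UNIV else A i)" for i
    have A12: "PiE {1..n} A1 \<in> sets ?U" "PiE {1..n} A2 \<in> sets ?U"
      unfolding unit_cube_def using A by (auto intro!: sets_PiM_I_finite simp: A1_def A2_def)
    have "emeasure ?D (PiE {1..n} A) =
        emeasure (?U \<Otimes>\<^sub>M ?U) ((\<lambda>z. resample n T (fst z) (snd z)) -` PiE {1..n} A \<inter> space (?U \<Otimes>\<^sub>M ?U))"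
      using A by (intro emeasure_distr measurable_resample_pair) (auto simp: unit_cube_def)
    also have "(\<lambda>z. resample n T (fst z) (snd z)) -` PiE {1..n} A \<inter> space (?U \<Otimes>\<^sub>M ?U)
        = PiE {1..n} A1 \<times> PiE {1..n} A2"
    proof -
      have "resample n T a b \<in> PiE {1..n} A \<longleftrightarrow>
          (\<forall>i\<in>{1..n}. a i \<in> A1 i) \<and> (\<forall>i\<in>{1..n}. b i \<in> A2 i)" for a b
        unfolding PiE_iff ball_conj_distrib[symmetric]
        by (intro conj_cong[of _ _ _ True, simplified] ball_cong refl)
           (auto simp: resample_def A1_def A2_def)
      then show ?thesis
        by (auto simp: space_pair_measure space_unit_cube PiE_iff)
    qed
    also have "emeasure (?U \<Otimes>\<^sub>M ?U) \<dots> = emeasure ?U (PiE {1..n} A1) * emeasure ?U (PiE {1..n} A2)"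
      by (rule U.emeasure_pair_measure_Times) (use A12 in auto)
    also have "\<dots> = (\<Prod>i\<in>{1..n}. emeasure ?M (A1 i) * emeasure ?M (A2 i))"
      using A by (subst (1 2) box) (auto simp: A1_def A2_def prod.distrib)
    also have "\<dots> = (\<Prod>i\<in>{1..n}. emeasure ?M (A i))"
      using emeasure_space_1 by (intro prod.cong) (auto simp: A1_def A2_def)
    finally show "emeasure ?D (PiE {1..n} A) = (\<Prod>i\<in>{1..n}. emeasure ?M (A i))" .
  qed simp
  then show ?thesis by (simp add: unit_cube_def)
qed

text \<open>Fubini's theorem for the pair (x, y). The tower property, the mean of a conditional mean
  and the factorisation over disjoint sets of coordinates all go through this identity.\<close>

lemma integral_resample:
  assumes "bounded_fun n g"
  shows "(\<integral>x. (\<integral>y. g (resample n T x y) \<partial>unit_cube n) \<partial>unit_cube n) = (\<integral>x. g x \<partial>unit_cube n)"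
proof -
  let ?U = "unit_cube n"
  interpret U: prob_space ?U by (rule prob_space_unit_cube)
  interpret UU: pair_prob_space ?U ?U ..
  obtain B where "\<forall>x. \<bar>g x\<bar> \<le> B" using assms unfolding bounded_fun_def by blast
  moreover have "(\<lambda>z. g (resample n T (fst z) (snd z))) \<in> borel_measurable (?U \<Otimes>\<^sub>M ?U)"
    using measurable_compose[OF measurable_resample_pair] assms by blast
  ultimately have "integrable (?U \<Otimes>\<^sub>M ?U) (\<lambda>z. g (resample n T (fst z) (snd z)))"
    by (intro UU.integrable_const_bound[of _ B]) auto
  then have "(\<integral>x. (\<integral>y. g (resample n T x y) \<partial>?U) \<partial>?U) = (\<integral>z. g (resample n T (fst z) (snd z)) \<partial>(?U \<Otimes>\<^sub>M ?U))"
    using UU.integral_fst'[of "\<lambda>z. g (resample n T (fst z) (snd z))"] by simp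
  also have "\<dots> = (\<integral>x. g x \<partial>distr (?U \<Otimes>\<^sub>M ?U) ?U (\<lambda>z. resample n T (fst z) (snd z)))"
    using assms measurable_resample_pair by (intro integral_distr[symmetric]) auto
  finally show ?thesis unfolding distr_resample .
qed

lemma cond_mean_resample: "cond_mean n f T x = (\<integral>y. f (resample n T x y) \<partial>unit_cube n)"
  unfolding cond_mean_def resample_def ..

lemma measurable_resample:
  "x \<in> space (unit_cube n) \<Longrightarrow> resample n T x \<in> measurable (unit_cube n) (unit_cube n)"
  using measurable_Pair2[OF measurable_resample_pair[of n T], of x] by simp

lemma resample_extensional: "resample n T x y = resample n T (\<lambda>i\<in>{1..n}. x i) y"
  by (auto simp: resample_def)

lemma bounded_fun_resample:
  assumes "bounded_fun n f" shows "bounded_fun n (\<lambda>y. f (resample n T x y))"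
proof -
  obtain B where "\<forall>x. \<bar>f x\<bar> \<le> B" using assms unfolding bounded_fun_def by blast
  \<comment> \<open>The point \<open>x\<close> is arbitrary, whereas sections are known to be
    measurable only at points of the space; restricting \<open>x\<close> changes nothing, since
    \<open>resample\<close> reads only the coordinates in {1..n}.\<close>
  moreover have "(\<lambda>y. f (resample n T (\<lambda>i\<in>{1..n}. x i) y)) \<in> borel_measurable (unit_cube n)"
    using measurable_compose[OF measurable_resample[OF restrict_in_unit_cube]] assms by blast
  ultimately show ?thesis
    by (subst resample_extensional) (auto intro: bounded_funI[of _ _ B])
qed

lemma cond_mean_abs_le:
  assumes "bounded_fun n f" "\<And>x. \<bar>f x\<bar> \<le> B" shows "\<bar>cond_mean n f T x\<bar> \<le> B"
proof -
  interpret prob_space "unit_cube n" by (rule prob_space_unit_cube)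
  have i: "integrable (unit_cube n) (\<lambda>y. f (resample n T x y))"
    using bounded_fun_resample[OF assms(1)] by blast
  have "cond_mean n f T x \<le> B" "- B \<le> cond_mean n f T x" unfolding cond_mean_resample
    using i assms(2) by (auto intro!: integral_le_const integral_ge_const AE_I2 simp: abs_le_iff minus_le_iff)
  then show ?thesis by auto
qed

lemma bounded_fun_cond_mean [intro]:
  assumes "bounded_fun n f" shows "bounded_fun n (cond_mean n f T)"
proof -
  interpret U: prob_space "unit_cube n" by (rule prob_space_unit_cube)
  obtain B where B: "\<forall>x. \<bar>f x\<bar> \<le> B" using assms unfolding bounded_fun_def by blast
  have "case_prod (\<lambda>x y. f (resample n T x y)) \<in> borel_measurable (unit_cube n \<Otimes>\<^sub>M unit_cube n)"
    unfolding case_prod_beta' using measurable_compose[OF measurable_resample_pair] assms by blast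
  then have "(\<lambda>x. cond_mean n f T x) \<in> borel_measurable (unit_cube n)"
    unfolding cond_mean_resample by (rule U.borel_measurable_lebesgue_integral)
  then show ?thesis using cond_mean_abs_le[OF assms] B by (intro bounded_funI[of _ _ B]) auto
qed

lemma cond_mean_cong:
  assumes "\<And>i. i \<in> {1..n} \<inter> T \<Longrightarrow> x i = x' i" shows "cond_mean n f T x = cond_mean n f T x'"
proof -
  have "resample n T x y = resample n T x' y" for y using assms by (auto simp: resample_def)
  then show ?thesis by (simp add: cond_mean_resample)
qed

lemma cond_mean_full: "cond_mean n f {1..n} x = f (\<lambda>i\<in>{1..n}. x i)"
proof -
  interpret prob_space "unit_cube n" by (rule prob_space_unit_cube)
  have "resample n {1..n} x y = (\<lambda>i\<in>{1..n}. x i)" for y by (auto simp: resample_def)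
  then show ?thesis by (simp add: cond_mean_resample prob_space)
qed

text \<open>Resampling outside T and then outside S keeps the coordinates in S \<inter> T, and the
  fresh ones come from \<open>resample n S y z\<close>, which is again uniform when y and z
  are.\<close>

lemma cond_mean_cond_mean:
  assumes "bounded_fun n f"
  shows "cond_mean n (cond_mean n f S) T x = cond_mean n f (S \<inter> T) x"
proof -
  have "resample n S (resample n T x y) z = resample n (S \<inter> T) x (resample n S y z)" for y z
    by (auto simp: resample_def)
  then show ?thesis
    using integral_resample[OF bounded_fun_resample[OF assms, of "S \<inter> T" x], of S]
    by (simp add: cond_mean_resample)
qed

lemma integral_cond_mean:
  "bounded_fun n f \<Longrightarrow> (\<integral>x. cond_mean n f T x \<partial>unit_cube n) = (\<integral>x. f x \<partial>unit_cube n)"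
  unfolding cond_mean_resample by (rule integral_resample)

lemma cond_mean_sum:
  assumes "\<And>i. i \<in> I \<Longrightarrow> bounded_fun n (f i)"
  shows "cond_mean n (\<lambda>x. \<Sum>i\<in>I. c i * f i x) T x = (\<Sum>i\<in>I. c i * cond_mean n (f i) T x)"
  unfolding cond_mean_resample
  by (subst Bochner_Integration.integral_sum) (auto intro!: bounded_fun_integrable bounded_fun_mult bounded_fun_resample assms)

text \<open>Averaging over coordinate i alone, \<open>h\<close> is a constant factor and
  \<open>g\<close> averages to zero. Both the orthogonality of Efron-Stein components and the
  vanishing of terms with a variable covered only once rest on this.\<close>

lemma integral_mult_eq_0:
  assumes "bounded_fun n g" "bounded_fun n h"
    and g: "\<And>x. cond_mean n g ({1..n} - {i}) x = 0"
    and h: "depends_on ({1..n} - {i}) h"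
  shows "(\<integral>x. g x * h x \<partial>unit_cube n) = 0"
proof -
  have "cond_mean n (\<lambda>x. g x * h x) ({1..n} - {i}) x = 0" for x
  proof -
    have "h (resample n ({1..n} - {i}) x y) = h x" for y
      using h unfolding depends_on_def by (rule allE[of _ "resample n ({1..n} - {i}) x y"]) (auto simp: resample_def)
    then show ?thesis using g[of x] by (simp add: cond_mean_resample)
  qed
  then show ?thesis
    using integral_cond_mean[of n "\<lambda>x. g x * h x" "{1..n} - {i}"] assms by auto
qed

text \<open>After resampling outside S the factor \<open>g\<close> sees only x and \<open>h\<close>
  only y, so the double integral splits.\<close>

lemma integral_mult_indep:
  assumes "bounded_fun n g" "bounded_fun n h" "S \<subseteq> {1..n}" "T \<subseteq> {1..n}"
    and "depends_on S g" "depends_on T h" "S \<inter> T = {}"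
  shows "(\<integral>x. g x * h x \<partial>unit_cube n) = (\<integral>x. g x \<partial>unit_cube n) * (\<integral>x. h x \<partial>unit_cube n)"
proof -
  have gS: "g (resample n S x y) = g x" for x y
    using assms(3) by (intro assms(5)[unfolded depends_on_def, rule_format]) (auto simp: resample_def)
  have hT: "h (resample n S x y) = h y" for x y
    using assms(4,7) by (intro assms(6)[unfolded depends_on_def, rule_format]) (auto simp: resample_def)
  show ?thesis
    using integral_resample[OF bounded_fun_mult[OF assms(1,2)], of S] by (simp add: gS hT)
qed

section \<open>Ties have probability zero\<close>

lemma AE_unit_cube_neq_const:
  assumes "i \<in> {1..n}" shows "AE x in unit_cube n. x i \<noteq> c"
proof -
  have "AE t in uniform_measure lborel {0..1::real}. t \<noteq> c"
    using AE_lborel_singleton[of c] by (intro AE_uniform_measureI) auto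
  then show ?thesis
    unfolding unit_cube_def by (rule AE_PiM_component[OF prob_space_uniform assms])
qed

lemma AE_unit_cube_neq:
  assumes "i \<in> {1..n}" "j \<in> {1..n}" "i \<noteq> j"
  shows "AE x in unit_cube n. x i \<noteq> x j"
proof -
  note [measurable] = measurable_unit_cube_component[OF assms(1)] measurable_unit_cube_component[OF assms(2)]
  define g :: "(nat \<Rightarrow> real) \<Rightarrow> real" where "g x = (if x i = x j then 1 else 0)" for x
  have g: "bounded_fun n g" unfolding g_def
    by (rule bounded_funI[of _ _ 1]) auto
  have "cond_mean n g ({1..n} - {i}) x = 0" for x
  proof -
    \<comment> \<open>With all coordinates but i frozen, a tie means that the fresh value hits the
      single number \<open>x j\<close>.\<close>
    have "AE y in unit_cube n. y i \<noteq> x j" using assms(1) by (rule AE_unit_cube_neq_const)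
    then have "AE y in unit_cube n. g (resample n ({1..n} - {i}) x y) = 0"
      by eventually_elim (use assms in \<open>auto simp: g_def resample_def\<close>)
    then show ?thesis unfolding cond_mean_resample
      by (rule integral_eq_zero_AE)
  qed
  then have "(\<integral>x. g x \<partial>unit_cube n) = 0"
    using integral_cond_mean[OF g, of "{1..n} - {i}"] by simp
  moreover have "AE x in unit_cube n. 0 \<le> g x" by (simp add: g_def)
  ultimately have "AE x in unit_cube n. g x = 0"
    using integral_nonneg_eq_0_iff_AE[OF bounded_fun_integrable[OF g]] by blast
  then show ?thesis by eventually_elim (auto simp: g_def)
qed

lemma AE_unit_cube_inj: "AE x in unit_cube n. inj_on x {1..n}"
proof -
  have "AE x in unit_cube n. \<forall>z\<in>{(i, j) \<in> {1..n} \<times> {1..n}. i \<noteq> j}. x (fst z) \<noteq> x (snd z)"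
  proof (rule AE_finite_allI)
    show "finite {(i, j) \<in> {1..n} \<times> {1..n}. i \<noteq> j}"
      by (rule finite_subset[of _ "{1..n} \<times> {1..n}"]) auto
  qed (auto intro!: AE_unit_cube_neq)
  then show ?thesis by eventually_elim (unfold inj_on_def, fastforce)
qed

section \<open>Efron--Stein decomposition\<close>

text \<open>The Moebius transform on subsets, stated for an arbitrary set function so that the
  properties of \<open>efron_stein\<close> become finite combinatorics.\<close>

definition alternating_sum :: "('a set \<Rightarrow> real) \<Rightarrow> 'a set \<Rightarrow> real" where
  "alternating_sum F S = (\<Sum>T\<in>Pow S. (- 1) ^ (card S - card T) * F T)"

lemma alternating_sum_insert:
  assumes "finite S" "a \<notin> S"
  shows "alternating_sum F (insert a S) = alternating_sum (\<lambda>T. F (insert a T)) S - alternating_sum F S"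
proof -
  have inj: "inj_on (insert a) (Pow S)"
    using assms(2) by (auto simp: inj_on_def)
  have disj: "Pow S \<inter> insert a ` Pow S = {}"
    using assms(2) by auto
  have T: "finite T" "a \<notin> T" "card T \<le> card S" if "T \<in> Pow S" for T
    using that assms by (auto intro: finite_subset card_mono)
  have "alternating_sum F (insert a S) =
      (\<Sum>T\<in>Pow S. (- 1) ^ (card (insert a S) - card T) * F T) +
      (\<Sum>T\<in>Pow S. (- 1) ^ (card (insert a S) - card (insert a T)) * F (insert a T))"
    unfolding alternating_sum_def Pow_insert
    using assms disj inj by (subst sum.union_disjoint) (auto simp: sum.reindex)
  also have "(\<Sum>T\<in>Pow S. (- 1) ^ (card (insert a S) - card T) * F T) =
      (\<Sum>T\<in>Pow S. - ((- 1) ^ (card S - card T) * F T))"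
    using assms T by (intro sum.cong) (auto simp: Suc_diff_le)
  also have "(\<Sum>T\<in>Pow S. (- 1) ^ (card (insert a S) - card (insert a T)) * F (insert a T)) =
      (\<Sum>T\<in>Pow S. (- 1) ^ (card S - card T) * F (insert a T))"
    using assms T by (intro sum.cong) auto
  finally show ?thesis by (simp add: alternating_sum_def sum_negf)
qed

text \<open>The subsets with and without \<open>a\<close> pair up with opposite signs.\<close>

lemma alternating_sum_eq_0:
  assumes "finite S" "a \<in> S" "\<And>T. T \<subseteq> S \<Longrightarrow> F (insert a T) = F T"
  shows "alternating_sum F S = 0"
proof -
  obtain S' where S': "S = insert a S'" "a \<notin> S'" using assms(2) by (meson mk_disjoint_insert)
  have "alternating_sum (\<lambda>T. F (insert a T)) S' = alternating_sum F S'"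
    unfolding alternating_sum_def using assms(3) S' by (intro sum.cong) auto
  then show ?thesis using alternating_sum_insert[of S' a F] S' assms(1) by simp
qed

text \<open>Moebius inversion. Adding the transforms at S and at \<open>insert a S\<close> cancels
  that of F at S and leaves the transform of T \<mapsto> F (insert a T), to which the induction
  hypothesis applies.\<close>

lemma sum_alternating_sum: "finite K \<Longrightarrow> (\<Sum>S\<in>Pow K. alternating_sum F S) = F K"
proof (induction K arbitrary: F rule: finite_induct)
  case empty
  then show ?case by (simp add: alternating_sum_def)
next
  case (insert a K)
  have inj: "inj_on (insert a) (Pow K)" using insert.hyps by (auto simp: inj_on_def)
  have fin: "finite S" if "S \<in> Pow K" for S using that insert.hyps by (auto intro: finite_subset)
  have "(\<Sum>S\<in>Pow (insert a K). alternating_sum F S) =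
      (\<Sum>S\<in>Pow K. alternating_sum F S) + (\<Sum>S\<in>Pow K. alternating_sum F (insert a S))"
    unfolding Pow_insert using insert.hyps inj
    by (subst sum.union_disjoint) (auto simp: sum.reindex)
  also have "\<dots> = (\<Sum>S\<in>Pow K. alternating_sum F S + alternating_sum F (insert a S))"
    by (simp add: sum.distrib)
  also have "\<dots> = (\<Sum>S\<in>Pow K. alternating_sum (\<lambda>T. F (insert a T)) S)"
    using insert.hyps fin by (intro sum.cong refl, subst alternating_sum_insert) auto
  also have "\<dots> = F (insert a K)" by (rule insert.IH)
  finally show ?case .
qed

lemma alternating_sum_abs_le:
  assumes "finite S" "\<And>T. T \<subseteq> S \<Longrightarrow> \<bar>F T\<bar> \<le> B"
  shows "\<bar>alternating_sum F S\<bar> \<le> 2 ^ card S * B"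
proof -
  have "\<bar>alternating_sum F S\<bar> \<le> (\<Sum>T\<in>Pow S. \<bar>(- 1) ^ (card S - card T) * F T\<bar>)"
    unfolding alternating_sum_def by (rule sum_abs)
  also have "\<dots> \<le> (\<Sum>T\<in>Pow S. B)"
    using assms(2) by (intro sum_mono) (auto simp: abs_mult power_abs)
  also have "\<dots> = 2 ^ card S * B" using assms(1) by (simp add: card_Pow)
  finally show ?thesis .
qed

lemma efron_stein_alternating_sum: "efron_stein k f S x = alternating_sum (\<lambda>T. cond_mean k f T x) S"
  by (simp add: efron_stein_def alternating_sum_def)

lemma scopes_iff: "S \<in> scopes j k \<longleftrightarrow> S \<subseteq> {1..k} \<and> card S = j"
  by (simp add: scopes_def)

lemma finite_scopes [simp, intro]: "finite (scopes j k)"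
  by (rule finite_subset[of _ "Pow {1..k}"]) (auto simp: scopes_def)

lemma finite_scope: "S \<in> scopes j k \<Longrightarrow> finite S"
  by (auto simp: scopes_iff intro: finite_subset[of _ "{1..k}"])

lemma card_scopes: "card (scopes j k) = k choose j"
  unfolding scopes_def by (subst n_subsets) auto

lemma depends_on_mono: "depends_on J h \<Longrightarrow> J \<subseteq> J' \<Longrightarrow> depends_on J' h"
  unfolding depends_on_def by blast

lemma bounded_fun_efron_stein [intro]:
  "bounded_fun k f \<Longrightarrow> bounded_fun k (efron_stein k f S)"
  unfolding efron_stein_def [abs_def] by (intro bounded_fun_sum bounded_fun_mult) auto

lemma bounded_fun_degree_part [intro]:
  "bounded_fun k f \<Longrightarrow> bounded_fun k (degree_part k f j)"
  unfolding degree_part_def [abs_def] by (intro bounded_fun_sum) auto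

lemma depends_on_efron_stein: "depends_on S (efron_stein k f S)"
  unfolding depends_on_def efron_stein_def
  by (intro allI impI sum.cong refl arg_cong2[of _ _ _ _ "(*)"] cond_mean_cong) auto

text \<open>Averaging out i replaces every conditioning set T by T - {i}, so the terms for T and
  \<open>insert i T\<close> cancel.\<close>

lemma cond_mean_efron_stein:
  assumes "bounded_fun k f" "S \<subseteq> {1..k}" "i \<in> S"
  shows "cond_mean k (efron_stein k f S) ({1..k} - {i}) x = 0"
proof -
  have S: "finite S" using assms(2) by (rule finite_subset) simp
  have "cond_mean k (efron_stein k f S) ({1..k} - {i}) x =
      (\<Sum>T\<in>Pow S. (- 1) ^ (card S - card T) * cond_mean k (cond_mean k f T) ({1..k} - {i}) x)"
    unfolding efron_stein_def [abs_def] using assms(1) by (intro cond_mean_sum) auto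
  also have "\<dots> = alternating_sum (\<lambda>T. cond_mean k f (T \<inter> ({1..k} - {i})) x) S"
    using assms(1) by (simp add: alternating_sum_def cond_mean_cond_mean)
  also have "\<dots> = 0"
    using S assms(3) by (rule alternating_sum_eq_0) (simp add: Int_insert_left)
  finally show ?thesis .
qed

lemma sum_efron_stein: "(\<Sum>S\<in>Pow {1..k}. efron_stein k f S x) = f (\<lambda>i\<in>{1..k}. x i)"
  unfolding efron_stein_alternating_sum by (subst sum_alternating_sum) (auto simp: cond_mean_full)

lemma sum_degree_part: "(\<Sum>j\<in>{0..k}. degree_part k f j x) = f (\<lambda>i\<in>{1..k}. x i)"
proof -
  have *: "{S \<in> Pow {1..k}. card S = j} = scopes j k" for j by (auto simp: scopes_def)
  have "(\<Sum>S\<in>Pow {1..k}. efron_stein k f S x) =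
      (\<Sum>j\<in>{0..k}. \<Sum>S\<in>{S\<in>Pow {1..k}. card S = j}. efron_stein k f S x)"
  proof (rule sum.group[symmetric])
    show "card ` Pow {1..k} \<subseteq> {0..k}" using card_mono[of "{1..k}"] by fastforce
  qed auto
  then show ?thesis unfolding * degree_part_def sum_efron_stein by simp
qed

text \<open>Take a point i in one set but not in the other: averaging over i kills the component
  that uses it and leaves the other one fixed.\<close>

lemma efron_stein_orthogonal:
  assumes "bounded_fun k f" "S \<subseteq> {1..k}" "T \<subseteq> {1..k}" "S \<noteq> T"
  shows "(\<integral>x. efron_stein k f S x * efron_stein k f T x \<partial>unit_cube k) = 0"
proof -
  have *: "(\<integral>x. efron_stein k f S x * efron_stein k f T x \<partial>unit_cube k) = 0"
    if "S \<subseteq> {1..k}" "T \<subseteq> {1..k}" "i \<in> S" "i \<notin> T" for S T i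
  proof (rule integral_mult_eq_0[of _ _ _ i])
    show "depends_on ({1..k} - {i}) (efron_stein k f T)"
      using that by (intro depends_on_mono[OF depends_on_efron_stein]) auto
  qed (use assms(1) that cond_mean_efron_stein in \<open>auto\<close>)
  from assms(4) consider i where "i \<in> S" "i \<notin> T" | i where "i \<in> T" "i \<notin> S" by blast
  then show ?thesis
    using *[OF assms(2,3)] *[OF assms(3,2)] by cases (auto simp: mult.commute)
qed

text \<open>By orthogonality only the components of size j survive in the expansion of
  \<open>f\<close>. For the top part this identifies the correlation of the predicate with its tilt
  as the squared norm by which the planted weights divide.\<close>

lemma integral_mult_degree_part:
  assumes f: "bounded_fun k f"
  shows "(\<integral>x. f x * degree_part k f j x \<partial>unit_cube k) = (\<integral>x. (degree_part k f j x)\<^sup>2 \<partial>unit_cube k)"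
proof -
  let ?U = "unit_cube k" and ?e = "efron_stein k f"
  have int: "integrable ?U (\<lambda>x. ?e S x * ?e T x)" for S T using f by auto
  have orth: "(\<Sum>T\<in>scopes j k. \<integral>x. ?e S x * ?e T x \<partial>?U) =
      (if S \<in> scopes j k then (\<integral>x. (?e S x)\<^sup>2 \<partial>?U) else 0)" if "S \<subseteq> {1..k}" for S
  proof -
    have "(\<Sum>T\<in>scopes j k. \<integral>x. ?e S x * ?e T x \<partial>?U) =
        (\<Sum>T\<in>scopes j k. if S = T then (\<integral>x. (?e S x)\<^sup>2 \<partial>?U) else 0)"
      using that efron_stein_orthogonal[OF f that]
      by (intro sum.cong) (auto simp: scopes_iff power2_eq_square)
    then show ?thesis by (simp add: sum.delta)
  qed
  have 1: "(\<integral>x. f x * degree_part k f j x \<partial>?U) = (\<Sum>S\<in>scopes j k. \<integral>x. (?e S x)\<^sup>2 \<partial>?U)"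
  proof -
    have "(\<integral>x. f x * degree_part k f j x \<partial>?U) =
        (\<integral>x. (\<Sum>S\<in>Pow {1..k}. \<Sum>T\<in>scopes j k. ?e S x * ?e T x) \<partial>?U)"
      by (intro Bochner_Integration.integral_cong)
         (simp_all add: degree_part_def sum_product[symmetric] sum_efron_stein extensional_unit_cube)
    also have "\<dots> = (\<Sum>S\<in>Pow {1..k}. \<Sum>T\<in>scopes j k. \<integral>x. ?e S x * ?e T x \<partial>?U)"
      using int by simp
    also have "\<dots> = (\<Sum>S\<in>Pow {1..k}. if S \<in> scopes j k then (\<integral>x. (?e S x)\<^sup>2 \<partial>?U) else 0)"
      using orth by (intro sum.cong) auto
    also have "\<dots> = (\<Sum>S\<in>scopes j k. \<integral>x. (?e S x)\<^sup>2 \<partial>?U)"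
    proof (rule sum.mono_neutral_cong_right)
      show "scopes j k \<subseteq> Pow {1..k}" unfolding scopes_def by blast
    qed auto
    finally show ?thesis .
  qed
  have "(\<integral>x. (degree_part k f j x)\<^sup>2 \<partial>?U) =
      (\<integral>x. (\<Sum>S\<in>scopes j k. \<Sum>T\<in>scopes j k. ?e S x * ?e T x) \<partial>?U)"
    by (simp add: degree_part_def power2_eq_square sum_product)
  also have "\<dots> = (\<Sum>S\<in>scopes j k. \<Sum>T\<in>scopes j k. \<integral>x. ?e S x * ?e T x \<partial>?U)"
    using int by simp
  also have "\<dots> = (\<Sum>S\<in>scopes j k. \<integral>x. (?e S x)\<^sup>2 \<partial>?U)"
    using orth by (intro sum.cong) (auto simp: scopes_iff)
  finally show ?thesis using 1 by simp
qed

text \<open>There are at most 2^k components, each an alternating sum of at most 2^k conditional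
  means.\<close>

lemma degree_part_abs_le:
  assumes "bounded_fun k f" "\<And>x. \<bar>f x\<bar> \<le> 1"
  shows "\<bar>degree_part k f j x\<bar> \<le> 4 ^ k"
proof -
  have "\<bar>degree_part k f j x\<bar> \<le> (\<Sum>S\<in>scopes j k. \<bar>efron_stein k f S x\<bar>)"
    unfolding degree_part_def by (rule sum_abs)
  also have "\<dots> \<le> (\<Sum>S\<in>scopes j k. 2 ^ k)"
  proof (intro sum_mono)
    fix S assume S: "S \<in> scopes j k"
    then have "card S \<le> k" using card_mono[of "{1..k}" S] by (auto simp: scopes_iff)
    moreover have "\<bar>efron_stein k f S x\<bar> \<le> 2 ^ card S * 1"
      unfolding efron_stein_alternating_sum
      using finite_scope[OF S] cond_mean_abs_le[OF assms] by (intro alternating_sum_abs_le)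
    moreover have "(2::real) ^ card S \<le> 2 ^ k" using \<open>card S \<le> k\<close> by simp
    ultimately show "\<bar>efron_stein k f S x\<bar> \<le> 2 ^ k" by linarith
  qed
  also have "\<dots> = real (k choose j) * 2 ^ k" by (simp add: card_scopes)
  also have "real (k choose j) \<le> 2 ^ k"
    using binomial_le_pow2[of k j] by (metis of_nat_le_iff of_nat_numeral of_nat_power)
  finally show ?thesis by (simp add: power_mult_distrib[symmetric])
qed

section \<open>Symmetry under permuting coordinates, and linearity\<close>

lemma cond_mean_reindex:
  assumes "inj_on h {1..k}" "h ` {1..k} \<subseteq> {1..n}" "bounded_fun k g"
  shows "cond_mean n (\<lambda>x. g (\<lambda>i\<in>{1..k}. x (h i))) T x =
    cond_mean k g {i\<in>{1..k}. h i \<in> T} (\<lambda>i\<in>{1..k}. x (h i))"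
proof -
  have "h i \<in> {1..n}" if "i \<in> {1..k}" for i using assms(2) that by blast
  then have "(\<lambda>i\<in>{1..k}. resample n T x y (h i)) =
      resample k {i\<in>{1..k}. h i \<in> T} (\<lambda>i\<in>{1..k}. x (h i)) (\<lambda>i\<in>{1..k}. y (h i))" for y
    by (auto simp: resample_def fun_eq_iff)
  then show ?thesis
    unfolding cond_mean_resample
    using integral_reindex[OF assms(1,2) bounded_fun_resample[OF assms(3), of "{i\<in>{1..k}. h i \<in> T}" "\<lambda>i\<in>{1..k}. x (h i)"]] by simp
qed

text \<open>A permutation of the coordinates carries the components of size j to one
  another.\<close>

lemma degree_part_reindex:
  assumes s: "s permutes {1..k}" and f: "bounded_fun k f"
  shows "degree_part k f j (\<lambda>i\<in>{1..k}. x (s i)) = degree_part k (\<lambda>z. f (\<lambda>i\<in>{1..k}. z (s i))) j x"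
proof -
  have inj: "inj_on s A" for A using s by (meson inj_on_subset permutes_inj subset_UNIV)
  have im: "s ` A \<subseteq> {1..k}" if "A \<subseteq> {1..k}" for A
    using image_mono[OF that, of s] permutes_image[OF s] by simp
  have cm: "cond_mean k (\<lambda>z. f (\<lambda>i\<in>{1..k}. z (s i))) (s ` T) x = cond_mean k f T (\<lambda>i\<in>{1..k}. x (s i))"
    if "T \<subseteq> {1..k}" for T
  proof -
    have "{i \<in> {1..k}. s i \<in> s ` T} = T" using that permutes_inj[OF s] by (auto simp: inj_def)
    then show ?thesis using cond_mean_reindex[OF inj im[OF order_refl] f, of "s ` T" x] by simp
  qed
  have es: "efron_stein k (\<lambda>z. f (\<lambda>i\<in>{1..k}. z (s i))) (s ` S) x = efron_stein k f S (\<lambda>i\<in>{1..k}. x (s i))"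
    if "S \<subseteq> {1..k}" for S
  proof -
    have "bij_betw ((`) s) (Pow S) (Pow (s ` S))"
      using bij_betw_Pow[of s S "s ` S"] inj by (auto simp: bij_betw_def)
    then show ?thesis unfolding efron_stein_def
      using that inj cm by (subst sum.reindex_bij_betw[symmetric]) (auto intro!: sum.cong simp: card_image)
  qed
  have "bij_betw ((`) s) (scopes j k) (scopes j k)"
  proof (rule bij_betw_byWitness[of _ "(`) (inv s)"])
    show "\<forall>a\<in>scopes j k. inv s ` s ` a = a" using permutes_inj[OF s] by (auto simp: image_comp)
    show "\<forall>a\<in>scopes j k. s ` inv s ` a = a" using permutes_surj[OF s] by (auto simp: image_image surj_f_inv_f)
    show "(`) s ` scopes j k \<subseteq> scopes j k" using im inj by (auto simp: scopes_iff card_image)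
    have "inv s permutes {1..k}" using s by (rule permutes_inv)
    then have "inv s ` A \<subseteq> {1..k}" "card (inv s ` A) = card A" if "A \<subseteq> {1..k}" for A
      using image_mono[OF that, of "inv s"] permutes_image[OF \<open>inv s permutes {1..k}\<close>]
      by (simp_all add: card_image inj_on_subset[OF permutes_inj[OF \<open>inv s permutes {1..k}\<close>]])
    then show "(`) (inv s) ` scopes j k \<subseteq> scopes j k" by (auto simp: scopes_iff)
  qed
  then show ?thesis unfolding degree_part_def
    using es by (subst (2) sum.reindex_bij_betw[symmetric]) (auto intro!: sum.cong simp: scopes_iff)
qed

lemma degree_part_sum:
  assumes "\<And>i. i \<in> I \<Longrightarrow> bounded_fun k (f i)"
  shows "degree_part k (\<lambda>z. \<Sum>i\<in>I. f i z) j x = (\<Sum>i\<in>I. degree_part k (f i) j x)"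
proof -
  have "cond_mean k (\<lambda>z. \<Sum>i\<in>I. f i z) T x = (\<Sum>i\<in>I. cond_mean k (f i) T x)" for T
    using cond_mean_sum[of I k f "\<lambda>_. 1" T x] assms by simp
  then show ?thesis
    unfolding degree_part_def efron_stein_def
    by (simp add: sum_distrib_left sum.swap[of _ _ I])
qed

section \<open>Functions of the order type\<close>

text \<open>Comparisons with \<le> record ties as well, so the notion makes sense at every point and
  is stable under substituting coordinates. At points without ties the value depends only on the
  sorting permutation.\<close>

definition order_fun :: "nat \<Rightarrow> ((nat \<Rightarrow> real) \<Rightarrow> 'a) \<Rightarrow> bool" where
  "order_fun n f \<longleftrightarrow>
     (\<forall>x y. (\<forall>i\<in>{1..n}. \<forall>j\<in>{1..n}. x i \<le> x j \<longleftrightarrow> y i \<le> y j) \<longrightarrow> f x = f y)"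

lemma order_funD:
  assumes "order_fun n f" "\<And>i j. i \<in> {1..n} \<Longrightarrow> j \<in> {1..n} \<Longrightarrow> x i \<le> x j \<longleftrightarrow> y i \<le> y j"
  shows "f x = f y"
  using assms unfolding order_fun_def by blast

lemma inj_on_sorting_permutation:
  fixes x :: "nat \<Rightarrow> real"
  assumes "inj_on x {1..n}"
  obtains s where "s permutes {1..n}"
    "\<And>i j. i \<in> {1..n} \<Longrightarrow> j \<in> {1..n} \<Longrightarrow> x (s i) \<le> x (s j) \<longleftrightarrow> i \<le> j"
proof -
  define l where "l = sort_key x [1..<Suc n]"
  have l: "length l = n" "set l = {1..n}" "distinct l" "sorted (map x l)"
    by (auto simp: l_def)
  define s where "s i = (if i \<in> {1..n} then l ! (i - 1) else i)" for i
  have bij: "bij_betw (\<lambda>i. l ! (i - 1)) {1..n} {1..n}"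
  proof -
    have "bij_betw (\<lambda>i. i - 1) {1..n} {..<n}"
      by (rule bij_betw_byWitness[of _ "\<lambda>i. i + 1"]) auto
    moreover have "bij_betw ((!) l) {..<n} {1..n}" using bij_betw_nth[of l "{..<n}" "{1..n}"] l by auto
    ultimately show ?thesis by (auto dest: bij_betw_trans simp: o_def)
  qed
  have "s permutes {1..n}"
  proof (rule bij_imp_permutes)
    show "bij_betw s {1..n} {1..n}" using bij by (rule bij_betw_cong[THEN iffD1, rotated]) (auto simp: s_def)
  qed (auto simp: s_def)
  moreover have "x (s i) \<le> x (s j) \<longleftrightarrow> i \<le> j" if "i \<in> {1..n}" "j \<in> {1..n}" for i j
  proof -
    have mono: "x (s i) \<le> x (s j)" if "i \<le> j" "i \<in> {1..n}" "j \<in> {1..n}" for i j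
      using sorted_nth_mono[OF l(4), of "i - 1" "j - 1"] that l(1) by (simp add: s_def)
    have "x (s i) \<noteq> x (s j)" if "i \<noteq> j"
      using that \<open>i \<in> {1..n}\<close> \<open>j \<in> {1..n}\<close> \<open>s permutes {1..n}\<close> assms
      by (metis inj_onD permutes_in_image permutes_inj_on)
    then show ?thesis using mono[of i j] mono[of j i] that by fastforce
  qed
  ultimately show ?thesis using that by blast
qed

text \<open>If r sorts x, then x composed with r has the order type of the identity, and replacing s
  by r \<circ> s merely permutes the summands.\<close>

lemma sum_permutations_order_fun:
  fixes x y :: "nat \<Rightarrow> real" and f :: "(nat \<Rightarrow> real) \<Rightarrow> real"
  assumes f: "order_fun n f" and "inj_on x {1..n}" "inj_on y {1..n}"
  shows "(\<Sum>s | s permutes {1..n}. f (\<lambda>i\<in>{1..n}. x (s i))) = (\<Sum>s | s permutes {1..n}. f (\<lambda>i\<in>{1..n}. y (s i)))"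
proof -
  have *: "(\<Sum>s | s permutes {1..n}. f (\<lambda>i\<in>{1..n}. x (s i))) = (\<Sum>s | s permutes {1..n}. f (\<lambda>i. real (s i)))"
    if x: "inj_on x {1..n}" for x
  proof -
    obtain r where r: "r permutes {1..n}"
      "\<And>i j. i \<in> {1..n} \<Longrightarrow> j \<in> {1..n} \<Longrightarrow> x (r i) \<le> x (r j) \<longleftrightarrow> i \<le> j"
      using inj_on_sorting_permutation[OF x] by blast
    have "(\<Sum>s | s permutes {1..n}. f (\<lambda>i\<in>{1..n}. x (s i))) =
        (\<Sum>s | s permutes {1..n}. f (\<lambda>i\<in>{1..n}. x ((r \<circ> s) i)))"
      by (rule setum_permutations_compose_left[OF r(1)])
    also have "\<dots> = (\<Sum>s | s permutes {1..n}. f (\<lambda>i. real (s i)))"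
    proof (intro sum.cong refl order_funD[OF f])
      fix s i j assume "s \<in> {s. s permutes {1..n}}" and ij: "i \<in> {1..n}" "j \<in> {1..n}"
      then have "s i \<in> {1..n}" "s j \<in> {1..n}" by (auto simp only: permutes_in_image mem_Collect_eq)
      then show "((\<lambda>i\<in>{1..n}. x ((r \<circ> s) i)) i \<le> (\<lambda>i\<in>{1..n}. x ((r \<circ> s) i)) j) = (real (s i) \<le> real (s j))"
        using ij r(2) by simp
    qed
    finally show ?thesis .
  qed
  show ?thesis using *[OF assms(2)] *[OF assms(3)] by simp
qed

text \<open>Each rearranged integrand has the same integral, while the sum over all rearrangements
  is almost surely constant. Integrals thus become averages over n! values, from which the
  integrality behind the lower bound on the squared norm is read off.\<close>

lemma integral_order_fun:
  assumes f: "order_fun n f" "bounded_fun n f" and x: "inj_on x {1..n}"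
  shows "(\<integral>y. f y \<partial>unit_cube n) = (\<Sum>s | s permutes {1..n}. f (\<lambda>i\<in>{1..n}. x (s i))) / fact n"
proof -
  interpret prob_space "unit_cube n" by (rule prob_space_unit_cube)
  have perm: "inj_on s {1..n}" "s ` {1..n} \<subseteq> {1..n}" if "s permutes {1..n}" for s
    using that by (auto simp: permutes_image permutes_inj_on simp del: atLeastAtMost_iff)
  have "(\<integral>y. (\<Sum>s | s permutes {1..n}. f (\<lambda>i\<in>{1..n}. y (s i))) \<partial>unit_cube n) =
      (\<Sum>s | s permutes {1..n}. \<integral>y. f (\<lambda>i\<in>{1..n}. y (s i)) \<partial>unit_cube n)"
    using perm f(2) by (intro Bochner_Integration.integral_sum bounded_fun_integrable bounded_fun_reindex) auto
  also have "\<dots> = (\<Sum>s | s permutes {1..n}. \<integral>y. f y \<partial>unit_cube n)"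
    using perm f(2) by (intro sum.cong refl integral_reindex) auto
  also have "\<dots> = fact n * (\<integral>y. f y \<partial>unit_cube n)" by (simp add: card_permutations)
  finally have "fact n * (\<integral>y. f y \<partial>unit_cube n) =
      (\<integral>y. (\<Sum>s | s permutes {1..n}. f (\<lambda>i\<in>{1..n}. y (s i))) \<partial>unit_cube n)" by simp
  also have "\<dots> = (\<integral>y. (\<Sum>s | s permutes {1..n}. f (\<lambda>i\<in>{1..n}. x (s i))) \<partial>unit_cube n)"
  proof (rule integral_cong_AE)
    show "(\<lambda>y. \<Sum>s | s permutes {1..n}. f (\<lambda>i\<in>{1..n}. y (s i))) \<in> borel_measurable (unit_cube n)"
      using perm f(2) by (intro borel_measurable_sum bounded_fun_measurable bounded_fun_reindex) auto
    show "AE y in unit_cube n. (\<Sum>s | s permutes {1..n}. f (\<lambda>i\<in>{1..n}. y (s i))) =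
        (\<Sum>s | s permutes {1..n}. f (\<lambda>i\<in>{1..n}. x (s i)))"
      using AE_unit_cube_inj[of n]
      by eventually_elim (rule sum_permutations_order_fun[OF f(1) _ x])
  qed simp
  finally show ?thesis by (simp add: prob_space field_simps)
qed

text \<open>The squared values over all rearrangements of x average to zero, so each is zero, and x
  itself is one of the rearrangements.\<close>

lemma order_fun_AE_zero:
  assumes f: "order_fun n f" "bounded_fun n f" and ae: "AE x in unit_cube n. f x = 0" and x: "inj_on x {1..n}"
  shows "f x = 0"
proof -
  have f2: "order_fun n (\<lambda>x. (f x)\<^sup>2)" using f(1) unfolding order_fun_def by metis
  have "(\<integral>y. (f y)\<^sup>2 \<partial>unit_cube n) = 0"
    using ae by (intro integral_eq_zero_AE) simp
  then have "(\<Sum>s | s permutes {1..n}. (f (\<lambda>i\<in>{1..n}. x (s i)))\<^sup>2) = 0"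
    using integral_order_fun[OF f2 _ x] f(2) by auto
  then have "\<forall>s\<in>{s. s permutes {1..n}}. (f (\<lambda>i\<in>{1..n}. x (s i)))\<^sup>2 = 0"
    by (subst (asm) sum_nonneg_eq_0_iff) (auto intro: finite_permutations)
  then have "(f (\<lambda>i\<in>{1..n}. x (id i)))\<^sup>2 = 0" using permutes_id[of "{1..n}"] by blast
  then have "f (\<lambda>i\<in>{1..n}. x (id i)) = 0" by simp
  then show ?thesis using order_funD[OF f(1), of x "\<lambda>i\<in>{1..n}. x (id i)"] by simp
qed

section \<open>Sorting depends on the order type and is measurable\<close>

lemma insort_key_cong:
  assumes "\<And>b. b \<in> set l \<Longrightarrow> (x a \<le> x b) = (y a \<le> y b)"
  shows "insort_key x a l = insort_key y a l"
  using assms by (induction l) auto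

lemma sort_key_cong:
  fixes x y :: "'a \<Rightarrow> 'b :: linorder"
  assumes "\<And>a b. a \<in> set l \<Longrightarrow> b \<in> set l \<Longrightarrow> (x a \<le> x b) = (y a \<le> y b)"
  shows "sort_key x l = sort_key y l"
  using assms
proof (induction l)
  case (Cons a l)
  have "insort_key x a (sort_key x l) = insort_key y a (sort_key x l)"
    by (rule insort_key_cong) (use Cons.prems in simp)
  then show ?case using Cons by (simp add: sort_key_def)
qed simp

lemma order_fun_predicate_fun: "order_fun k (predicate_fun k P)"
  unfolding order_fun_def predicate_fun_def ord_of_def
  by (intro allI impI arg_cong[of _ _ "\<lambda>l. of_bool (P l)"] sort_key_cong) auto

lemma measurable_insort_key:
  fixes l :: "nat list"
  assumes "a \<in> {1..k}" "set l \<subseteq> {1..k}"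
  shows "(\<lambda>x. insort_key x a l) \<in> measurable (unit_cube k) (count_space UNIV)"
  using assms(2)
proof (induction l)
  case (Cons b l)
  then have b: "b \<in> {1..k}" and IH [measurable]: "(\<lambda>x. insort_key x a l) \<in> measurable (unit_cube k) (count_space UNIV)"
    by auto
  note [measurable] = measurable_unit_cube_component[OF assms(1)] measurable_unit_cube_component[OF b]
  have [measurable]: "(#) b \<in> measurable (count_space UNIV) (count_space UNIV)" by simp
  show ?case by simp
qed simp

lemma measurable_sort_key:
  fixes l :: "nat list"
  assumes "set l \<subseteq> {1..k}"
  shows "(\<lambda>x. sort_key x l) \<in> measurable (unit_cube k) (count_space UNIV)"
  using assms
proof (induction l)
  case (Cons a l)
  then have IH: "(\<lambda>x. sort_key x l) \<in> measurable (unit_cube k) (count_space UNIV)" and a: "a \<in> {1..k}" by auto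
  \<comment> \<open>Composition through a countable type ranges over every list \<open>m\<close>,
    including lists with entries outside {1..k}, which \<open>measurable_insort_key\<close> does not
    cover; these get a dummy value and never occur.\<close>
  define g where "g m x = (if set m \<subseteq> {1..k} then insort_key x a m else [])" for m :: "nat list" and x :: "nat \<Rightarrow> real"
  have "(\<lambda>x. g (sort_key x l) x) \<in> measurable (unit_cube k) (count_space UNIV)"
  proof (rule measurable_compose_countable[OF _ IH])
    fix m show "(\<lambda>x. g m x) \<in> measurable (unit_cube k) (count_space UNIV)"
      using measurable_insort_key[OF a, of m] by (cases "set m \<subseteq> {1..k}") (auto simp: g_def)
  qed
  then show ?case using Cons.prems by (simp add: g_def sort_key_def[symmetric] sort_key_simps)
qed simp

lemma bounded_fun_predicate_fun [intro, simp]: "bounded_fun k (predicate_fun k P)"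
proof -
  have "ord_of k \<in> measurable (unit_cube k) (count_space UNIV)"
    unfolding ord_of_def [abs_def] by (rule measurable_sort_key) auto
  from measurable_compose[OF this, of "\<lambda>l. of_bool (P l)" borel]
  show ?thesis by (intro bounded_funI[of _ _ 1]) (auto simp: predicate_fun_def [abs_def])
qed

section \<open>The top degree part of an ordering predicate\<close>

lemma ord_of_eqI:
  assumes "inj_on x {1..k}" "set l = {1..k}" "distinct l" "sorted (map x l)"
  shows "ord_of k x = l"
proof -
  let ?o = "ord_of k x"
  have o: "set ?o = {1..k}" "distinct ?o" "sorted (map x ?o)"
    by (auto simp: ord_of_def)
  have "map x ?o = map x l"
    using assms o by (intro sorted_distinct_set_unique) (auto simp: distinct_map)
  then show ?thesis
    using assms(1,2) o(1) by (intro map_inj_on[of x]) auto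
qed

lemma permutations_of_set_length:
  assumes "\<nu> \<in> permutations_of_set S" shows "length \<nu> = card S"
  using assms by (metis distinct_card permutations_of_setD)

text \<open>Two independent copies of a k-point sit in the 2k-cube, at positions i and k + i; the
  coordinates in C are read from the second copy. It serves both the mixed differences and the
  integrals that make up \<open>top_norm_sq\<close>.\<close>

definition lift_pos :: "nat \<Rightarrow> nat set \<Rightarrow> nat \<Rightarrow> nat" where
  "lift_pos k C i = (if i \<in> C then k + i else i)"

lemma lift_pos: "inj_on (lift_pos k C) {1..k}" "lift_pos k C ` {1..k} \<subseteq> {1..2 * k}"
  by (auto simp: lift_pos_def inj_on_def)

lemma order_fun_reindex:
  assumes "order_fun k f" "h ` {1..k} \<subseteq> {1..n}"
  shows "order_fun n (\<lambda>z. f (\<lambda>i\<in>{1..k}. z (h i)))"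
  unfolding order_fun_def
proof (intro allI impI order_funD[OF assms(1)])
  fix x y :: "nat \<Rightarrow> real" and i j
  assume *: "\<forall>i\<in>{1..n}. \<forall>j\<in>{1..n}. x i \<le> x j \<longleftrightarrow> y i \<le> y j" and ij: "i \<in> {1..k}" "j \<in> {1..k}"
  then have "h i \<in> {1..n}" "h j \<in> {1..n}" using assms(2) by blast+
  then show "((\<lambda>i\<in>{1..k}. x (h i)) i \<le> (\<lambda>i\<in>{1..k}. x (h i)) j) = ((\<lambda>i\<in>{1..k}. y (h i)) i \<le> (\<lambda>i\<in>{1..k}. y (h i)) j)"
    using * ij by simp
qed

lemma order_fun_binop:
  assumes "order_fun n f" "order_fun n g" shows "order_fun n (\<lambda>z. h (f z) (g z))"
  unfolding order_fun_def
proof (intro allI impI)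
  fix x y :: "nat \<Rightarrow> real"
  assume "\<forall>i\<in>{1..n}. \<forall>j\<in>{1..n}. x i \<le> x j \<longleftrightarrow> y i \<le> y j"
  then have "f x = f y" "g x = g y" using assms unfolding order_fun_def by blast+
  then show "h (f x) (g x) = h (f y) (g y)" by simp
qed

lemma exists_strict_upper_bound:
  fixes x :: "nat \<Rightarrow> real"
  shows "\<exists>B. s < B \<and> (\<forall>i\<in>{1..k}. x i < B)"
proof -
  have "finite (insert s (x ` {1..k}))" by simp
  then have "\<forall>y\<in>insert s (x ` {1..k}). y < Max (insert s (x ` {1..k})) + 1"
    by (metis Max_ge less_add_one order_le_less_trans)
  then show ?thesis by (intro exI[of _ "Max (insert s (x ` {1..k})) + 1"]) auto
qed

text \<open>A mixed difference in the coordinates a and b that vanishes makes the effect of changing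
  coordinate a independent of the other coordinates. Once these are all larger than the old and
  the new value of coordinate a, the change does not affect the order.\<close>

lemma order_fun_constant:
  fixes f :: "(nat \<Rightarrow> real) \<Rightarrow> real"
  assumes f: "order_fun k f"
    and mixed: "\<And>x a b s t. inj_on x {1..k} \<Longrightarrow> a \<in> {1..k} \<Longrightarrow> b \<in> {1..k} \<Longrightarrow> a \<noteq> b \<Longrightarrow>
      s \<notin> x ` {1..k} \<Longrightarrow> t \<notin> x ` {1..k} \<Longrightarrow> s \<noteq> t \<Longrightarrow>
      f x - f (x(a := s)) - f (x(b := t)) + f (x(a := s, b := t)) = 0"
    and x: "inj_on x {1..k}" "inj_on y {1..k}"
  shows "f x = f y"
proof -
  \<comment> \<open>Moves the coordinates in C beyond B; adding the index keeps the new values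
    distinct and in index order.\<close>
  define far where "far B C x i = (if i \<in> C then B + real i else x i)" for B C and x :: "nat \<Rightarrow> real" and i
  have far_inj: "inj_on (far B C x) {1..k}" if "inj_on x {1..k}" "\<forall>i\<in>{1..k}. x i < B" for B C x
    using that unfolding inj_on_def far_def by (smt (verit) of_nat_0_le_iff of_nat_eq_iff)
  have far_insert: "far B (insert b C) x = (far B C x)(b := B + real b)" for B b C x
    by (auto simp: far_def)
  have far_notin: "B + real b \<notin> far B C x ` {1..k}" if "\<forall>i\<in>{1..k}. x i < B" "b \<notin> C" for B b C x
    using that unfolding far_def by (smt (verit) imageE of_nat_0_le_iff of_nat_eq_iff)
  have single: "f (x(a := s)) = f x" if x: "inj_on x {1..k}" and a: "a \<in> {1..k}" and s: "s \<notin> x ` {1..k}" for x a s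
  proof -
    obtain B where B: "s < B" "\<forall>i\<in>{1..k}. x i < B" using exists_strict_upper_bound by blast
    \<comment> \<open>Moving one more coordinate b away is a mixed difference in a and b, hence does
      not alter the effect of changing a.\<close>
    have "f (far B C x) - f ((far B C x)(a := s)) = f x - f (x(a := s))" if "finite C" "C \<subseteq> {1..k} - {a}" for C
      using that
    proof (induction C rule: finite_induct)
      case empty
      have "far B {} x = x" by (auto simp: far_def)
      then show ?case by simp
    next
      case (insert b C)
      have "s \<notin> far B C x ` {1..k}"
        using s B by (auto simp: far_def)
      then have "f (far B C x) - f ((far B C x)(a := s)) - f ((far B C x)(b := B + real b))
          + f ((far B C x)(a := s, b := B + real b)) = 0"
        using insert.prems insert.hyps a B by (intro mixed far_inj x far_notin) auto
      moreover have "(far B C x)(a := s, b := B + real b) = (far B (insert b C) x)(a := s)"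
        using insert.prems by (auto simp: far_insert)
      moreover have "f (far B C x) - f ((far B C x)(a := s)) = f x - f (x(a := s))"
        using insert by blast
      ultimately show ?case unfolding far_insert by (smt (verit))
    qed
    from this[of "{1..k} - {a}"] have "f (far B ({1..k} - {a}) x) - f ((far B ({1..k} - {a}) x)(a := s)) = f x - f (x(a := s))"
      by simp
    moreover have "f (far B ({1..k} - {a}) x) = f ((far B ({1..k} - {a}) x)(a := s))"
    proof (rule order_funD[OF f])
      fix i j assume "i \<in> {1..k}" "j \<in> {1..k}"
      then show "(far B ({1..k} - {a}) x i \<le> far B ({1..k} - {a}) x j) =
          (((far B ({1..k} - {a}) x)(a := s)) i \<le> ((far B ({1..k} - {a}) x)(a := s)) j)"
        using B a by (auto simp: far_def intro: less_imp_le add_strict_increasing2 dest: order_less_le_trans)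
          (smt (verit) atLeastAtMost_iff of_nat_0_le_iff)+
    qed
    ultimately show ?thesis by simp
  qed
  \<comment> \<open>Changing one coordinate at a time carries x to values that increase with the
    index, the order type of the identity.\<close>
  have const: "f x = f (\<lambda>i. real i)" if x: "inj_on x {1..k}" for x
  proof -
    obtain B where B: "\<forall>i\<in>{1..k}. x i < B" using exists_strict_upper_bound by blast
    have "f (far B C x) = f x" if "finite C" "C \<subseteq> {1..k}" for C
      using that
    proof (induction C rule: finite_induct)
      case empty
      have "far B {} x = x" by (auto simp: far_def)
      then show ?case by simp
    next
      case (insert b C)
      have "f ((far B C x)(b := B + real b)) = f (far B C x)"
        using insert B x by (intro single far_inj far_notin) auto
      moreover have "f (far B C x) = f x" using insert by blast
      ultimately show ?case unfolding far_insert by (rule trans)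
    qed
    then have "f (far B {1..k} x) = f x" by simp
    moreover have "f (far B {1..k} x) = f (\<lambda>i. real i)"
      by (rule order_funD[OF f]) (auto simp: far_def)
    ultimately show ?thesis by simp
  qed
  show ?thesis using const[OF x(1)] const[OF x(2)] by simp
qed

locale ordering_predicate =
  fixes k :: nat and P :: "nat list \<Rightarrow> bool"
  assumes k_ge_2: "2 \<le> k" and nontrivial_P: "nontrivial k P"
begin

abbreviation "f \<equiv> predicate_fun k P"
abbreviation "d \<equiv> predicate_degree k P"
abbreviation "t \<equiv> top_part k P"
abbreviation "N \<equiv> top_norm_sq k P"

lemma f_abs_le: "\<bar>f x\<bar> \<le> 1"
  by (simp add: predicate_fun_def)

lemma bounded_fun_t [intro, simp]: "bounded_fun k t"
  unfolding top_part_def by (intro bounded_fun_degree_part) simp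

lemma t_abs_le: "\<bar>t x\<bar> \<le> 4 ^ k"
  unfolding top_part_def by (rule degree_part_abs_le) (simp_all add: f_abs_le)

lemma f_attains:
  assumes "\<tau> \<in> permutations_of_set {1..k}"
  obtains x where "inj_on x {1..k}" "f x = of_bool (P \<tau>)"
proof -
  \<comment> \<open>The position of i in \<open>\<tau>\<close>, so that sorting by x returns
    \<open>\<tau>\<close>.\<close>
  define x where "x i = real (inv_into {..<k} ((!) \<tau>) i)" for i
  have \<tau>: "set \<tau> = {1..k}" "distinct \<tau>" "length \<tau> = k"
    using assms permutations_of_set_length[OF assms] by (auto dest: permutations_of_setD)
  have inj: "inj_on ((!) \<tau>) {..<k}" using \<tau> by (intro inj_on_nth) auto
  have im: "(!) \<tau> ` {..<k} = {1..k}" using \<tau> by (auto simp: set_conv_nth)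
  have "inj_on (inv_into {..<k} ((!) \<tau>)) {1..k}" by (intro inj_on_inv_into) (simp add: im)
  then have "inj_on x {1..k}" by (intro inj_onI) (simp add: x_def inj_on_eq_iff)
  moreover have "map x \<tau> = map real [0..<k]"
    using \<tau> inj by (intro nth_equalityI) (auto simp: x_def inv_into_f_f)
  then have "ord_of k x = \<tau>"
    using \<tau> calculation by (intro ord_of_eqI) (auto simp: sorted_map)
  ultimately show ?thesis using that by (simp add: predicate_fun_def)
qed

lemma f_not_constant:
  obtains x y where "inj_on x {1..k}" "inj_on y {1..k}" "f x \<noteq> f y"
proof -
  let ?A = "permutations_of_set {1..k}"
  have avg: "0 < real (card {\<tau> \<in> ?A. P \<tau>}) / fact k" "real (card {\<tau> \<in> ?A. P \<tau>}) / fact k < 1"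
    using nontrivial_P unfolding nontrivial_def avg_def by blast+
  from avg(2) have "real (card {\<tau> \<in> ?A. P \<tau>}) < real (fact k)" by (simp add: divide_less_eq)
  then have card: "0 < card {\<tau> \<in> ?A. P \<tau>}" "card {\<tau> \<in> ?A. P \<tau>} < card ?A"
    using avg(1) unfolding of_nat_less_iff by (auto simp: zero_less_divide_iff)
  from card(1) obtain \<tau> where "\<tau> \<in> ?A" "P \<tau>" by (auto simp: card_gt_0_iff)
  moreover from card(2) obtain \<tau>' where "\<tau>' \<in> ?A" "\<not> P \<tau>'"
    by (metis (no_types, lifting) Collect_mem_eq Collect_cong less_irrefl)
  ultimately show ?thesis using f_attains that by (metis of_bool_eq(1) of_bool_eq(2) zero_neq_one)
qed

text \<open>Otherwise \<open>f\<close> agrees almost surely with a constant plus functions of single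
  coordinates. A mixed difference uses two values of a coordinate, so it is studied as a function of
  the order type on the 2k-cube: there it vanishes almost surely, hence at every point without ties,
  which is what \<open>order_fun_constant\<close> asks for.\<close>

lemma exists_degree_part: "\<exists>j\<in>{2..k}. \<not> (AE x in unit_cube k. degree_part k f j x = 0)"
proof (rule ccontr)
  assume "\<not> ?thesis"
  then have ae: "AE x in unit_cube k. \<forall>j\<in>{2..k}. degree_part k f j x = 0"
    by (intro AE_finite_allI) auto
  define r where "r x = degree_part k f 0 x + degree_part k f 1 x" for x
  have f_r: "AE x in unit_cube k. f x = r x"
    using ae AE_space
  proof eventually_elim
    case (elim x)
    have "{0..k} = {0, 1} \<union> {2..k}" using k_ge_2 by auto
    then have "(\<Sum>j\<in>{0..k}. degree_part k f j x) = r x"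
      using elim by (simp add: sum.union_disjoint r_def)
    then show ?case using elim sum_degree_part[of k f x] by (simp add: extensional_unit_cube)
  qed
  define half where "half z C = (\<lambda>i\<in>{1..k}. z (lift_pos k C i))" for z :: "nat \<Rightarrow> real" and C
  have mixed: "f (half z {}) - f (half z {a}) - f (half z {b}) + f (half z {a, b}) = 0"
    if z: "inj_on z {1..2 * k}" and ab: "a \<noteq> b" for z a b
  proof (rule order_fun_AE_zero[OF _ _ _ z])
    have r: "r (half z {}) - r (half z {a}) - r (half z {b}) + r (half z {a, b}) = 0" for z
    proof -
      have es: "efron_stein k f S (half z {}) - efron_stein k f S (half z {a}) - efron_stein k f S (half z {b})
          + efron_stein k f S (half z {a, b}) = 0" if "S \<in> scopes j k" "j \<le> 1" for j S
      proof -
        \<comment> \<open>A component on at most one coordinate ignores a or b, so the four terms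
          cancel in pairs.\<close>
        have "a \<notin> S \<or> b \<notin> S"
          using that ab card_le_Suc0_iff_eq[OF finite_scope[OF that(1)]] by (auto simp: scopes_iff One_nat_def)
        then have "(\<forall>i\<in>S. half z {} i = half z {a} i) \<and> (\<forall>i\<in>S. half z {b} i = half z {a, b} i) \<or>
            (\<forall>i\<in>S. half z {} i = half z {b} i) \<and> (\<forall>i\<in>S. half z {a} i = half z {a, b} i)"
          by (auto simp: half_def lift_pos_def)
        then show ?thesis
          using depends_on_efron_stein[of S k f] unfolding depends_on_def by (smt (verit))
      qed
      have "degree_part k f j (half z {}) - degree_part k f j (half z {a}) - degree_part k f j (half z {b})
          + degree_part k f j (half z {a, b}) = 0" if "j \<le> 1" for j
        unfolding degree_part_def sum_subtractf[symmetric] sum.distrib[symmetric]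
        using es that by (intro sum.neutral) blast
      from this[of 0] this[of 1] show ?thesis by (simp add: r_def)
    qed
    have half_ae: "AE z in unit_cube (2 * k). f (half z C) = r (half z C)" for C
      unfolding half_def by (rule AE_reindex[OF lift_pos f_r])
    show "AE z in unit_cube (2 * k). f (half z {}) - f (half z {a}) - f (half z {b}) + f (half z {a, b}) = 0"
      using half_ae[of "{}"] half_ae[of "{a}"] half_ae[of "{b}"] half_ae[of "{a, b}"]
      by eventually_elim (simp add: r)
    have o: "order_fun (2 * k) (\<lambda>z. f (half z C))" for C
      unfolding half_def by (rule order_fun_reindex[OF order_fun_predicate_fun lift_pos(2)])
    show "order_fun (2 * k) (\<lambda>z. f (half z {}) - f (half z {a}) - f (half z {b}) + f (half z {a, b}))"
      by (rule order_fun_binop[OF order_fun_binop[OF order_fun_binop[OF o o, where h = "(-)"] o, where h = "(-)"] o,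
            where h = "(+)"])
    have "bounded_fun (2 * k) (\<lambda>z. f (half z C))" for C
      unfolding half_def by (rule bounded_fun_reindex[OF lift_pos(2)]) simp
    then show "bounded_fun (2 * k) (\<lambda>z. f (half z {}) - f (half z {a}) - f (half z {b}) + f (half z {a, b}))"
      by (intro bounded_fun_add bounded_fun_diff)
  qed
  obtain x y where xy: "inj_on x {1..k}" "inj_on y {1..k}" "f x \<noteq> f y" by (rule f_not_constant)
  have "f x = f y"
  proof (rule order_fun_constant[OF order_fun_predicate_fun _ xy(1,2)])
    fix x :: "nat \<Rightarrow> real" and a b :: nat and s u :: real
    assume x: "inj_on x {1..k}" and a: "a \<in> {1..k}" "b \<in> {1..k}" "a \<noteq> b"
      and s: "s \<notin> x ` {1..k}" "u \<notin> x ` {1..k}" "s \<noteq> u"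
    obtain B where B: "s < B" "\<forall>i\<in>{1..k}. x i < B" using exists_strict_upper_bound by blast
    obtain B' where B': "u < B'" "\<forall>i\<in>{1..k}. x i < B'" using exists_strict_upper_bound by blast
    \<comment> \<open>The second copy carries the new values s and u in the places of a and b. Its
      other coordinates are not read; they are placed high and distinct so that z has no
      ties.\<close>
    define z where "z i = (if i \<le> k then x i else if i = k + a then s else if i = k + b then u else max B B' + real i)" for i
    have half: "f (half z C) = f y" if "\<And>i. i \<in> {1..k} \<Longrightarrow> half z C i = y i" for C y
      by (rule order_funD[OF order_fun_predicate_fun]) (simp add: that)
    have "inj_on z {1..2 * k}"
    proof (rule inj_onI)
      fix i j assume ij: "i \<in> {1..2 * k}" "j \<in> {1..2 * k}" "z i = z j"
      have far: "s < max B B' + real m" "u < max B B' + real m" for m using B B' by auto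
      have far': "x l < max B B' + real m" if "l \<in> {1..k}" for l m using B B' that by fastforce
      have s': "x l \<noteq> s" "x l \<noteq> u" if "l \<in> {1..k}" for l using s that by auto
      consider "i \<le> k" "j \<le> k" | "i \<le> k" "\<not> j \<le> k" | "\<not> i \<le> k" "j \<le> k" | "\<not> i \<le> k" "\<not> j \<le> k" by blast
      then show "i = j"
      proof cases
        case 1
        then have "x i = x j" using ij by (simp add: z_def)
        then show ?thesis using inj_onD[OF x] ij 1 by simp
      next
        case 2 then show ?thesis using ij far'[of i j] s'[of i] by (auto simp: z_def split: if_splits)
      next
        case 3 then show ?thesis using ij far'[of j i] s'[of j] by (auto simp: z_def split: if_splits)
      next
        case 4 then show ?thesis using ij far[of i] far[of j] s(3) by (auto simp: z_def split: if_splits)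
      qed
    qed
    then have "f (half z {}) - f (half z {a}) - f (half z {b}) + f (half z {a, b}) = 0"
      using a(3) by (rule mixed)
    moreover have "f (half z {}) = f x" "f (half z {a}) = f (x(a := s))" "f (half z {b}) = f (x(b := u))"
      "f (half z {a, b}) = f (x(a := s, b := u))"
      using a by - (rule half, simp add: half_def lift_pos_def z_def)+
    ultimately show "f x - f (x(a := s)) - f (x(b := u)) + f (x(a := s, b := u)) = 0" by simp
  qed
  then show False using xy(3) by simp
qed

lemma d_bounds: "2 \<le> d" "d \<le> k" and t_not_AE_0: "\<not> (AE x in unit_cube k. t x = 0)"
proof -
  let ?J = "{j \<in> {0..k}. \<not> (AE x in unit_cube k. degree_part k f j x = 0)}"
  obtain j where j: "j \<in> ?J" "2 \<le> j" using exists_degree_part by auto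
  have d: "d = Max ?J" by (simp add: predicate_degree_def coordinate_degree_def)
  have "d \<in> ?J" unfolding d using j by (intro Max_in) auto
  then show "d \<le> k" "\<not> (AE x in unit_cube k. t x = 0)" by (auto simp: top_part_def)
  have "j \<le> d" unfolding d using j by (intro Max_ge) auto
  then show "2 \<le> d" using j by simp
qed

lemma integral_f_t: "(\<integral>x. f x * t x \<partial>unit_cube k) = N"
  unfolding top_norm_sq_def top_part_def by (rule integral_mult_degree_part) simp

lemma N_pos: "0 < N"
proof -
  have "N \<noteq> 0"
  proof
    assume "N = 0"
    then have "AE x in unit_cube k. (t x)\<^sup>2 = 0"
      unfolding top_norm_sq_def
      by (subst (asm) integral_nonneg_eq_0_iff_AE) auto
    then show False using t_not_AE_0 by simp
  qed
  moreover have "0 \<le> N" unfolding top_norm_sq_def by simp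
  ultimately show ?thesis by simp
qed

text \<open>The conditional mean averages over a second copy that shares the coordinates in T with
  the first, so the integral becomes the mean of a product of two 0/1 values read off from 2k
  independent variables.\<close>

lemma integral_f_cond_mean:
  assumes "T \<subseteq> {1..k}"
  shows "(\<integral>x. f x * cond_mean k f T x \<partial>unit_cube k) =
    (\<integral>z. f (\<lambda>i\<in>{1..k}. z (lift_pos k {} i)) * f (\<lambda>i\<in>{1..k}. z (lift_pos k ({1..k} - T) i)) \<partial>unit_cube (2 * k))"
    (is "_ = (\<integral>z. ?F z \<partial>_)")
proof -
  have F: "bounded_fun (2 * k) ?F"
    using lift_pos(2) by (intro bounded_fun_mult bounded_fun_reindex) auto
  have "cond_mean (2 * k) ?F {1..k} z = (\<lambda>x. f x * cond_mean k f T x) (\<lambda>i\<in>{1..k}. z (lift_pos k {} i))" for z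
  proof -
    define x where "x = (\<lambda>i\<in>{1..k}. z (lift_pos k {} i))"
    have 1: "(\<lambda>i\<in>{1..k}. resample (2 * k) {1..k} z w (lift_pos k {} i)) = x" for w
      by (auto simp: resample_def lift_pos_def x_def fun_eq_iff)
    have 2: "(\<lambda>i\<in>{1..k}. resample (2 * k) {1..k} z w (lift_pos k ({1..k} - T) i)) =
        resample k T x (\<lambda>i\<in>{1..k}. w (k + i))" for w
      by (auto simp: resample_def lift_pos_def x_def fun_eq_iff)
    have "(\<integral>w. f (resample k T x (\<lambda>i\<in>{1..k}. w (k + i))) \<partial>unit_cube (2 * k)) = cond_mean k f T x"
      unfolding cond_mean_resample
      by (rule integral_reindex) (auto intro: bounded_fun_resample)
    then show ?thesis unfolding cond_mean_resample[of "2 * k"] 1 2 by (simp add: x_def)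
  qed
  then have "(\<integral>z. ?F z \<partial>unit_cube (2 * k)) =
      (\<integral>z. (\<lambda>x. f x * cond_mean k f T x) (\<lambda>i\<in>{1..k}. z (lift_pos k {} i)) \<partial>unit_cube (2 * k))"
    using integral_cond_mean[OF F, of "{1..k}"] by simp
  also have "\<dots> = (\<integral>x. f x * cond_mean k f T x \<partial>unit_cube k)"
    by (rule integral_reindex[OF lift_pos]) auto
  finally show ?thesis by simp
qed

lemma N_integer_multiple: "fact (2 * k) * N \<in> \<int>"
proof -
  have *: "fact (2 * k) * (\<integral>x. f x * cond_mean k f T x \<partial>unit_cube k) \<in> \<int>" if "T \<subseteq> {1..k}" for T
  proof -
    let ?F = "\<lambda>z. f (\<lambda>i\<in>{1..k}. z (lift_pos k {} i)) * f (\<lambda>i\<in>{1..k}. z (lift_pos k ({1..k} - T) i))"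
    have o: "order_fun (2 * k) (\<lambda>z. f (\<lambda>i\<in>{1..k}. z (lift_pos k C i)))" for C
      by (rule order_fun_reindex[OF order_fun_predicate_fun lift_pos(2)])
    have "order_fun (2 * k) ?F"
      by (rule order_fun_binop[OF o o, where h = "(*)"])
    moreover have "bounded_fun (2 * k) ?F"
      using lift_pos(2) by (intro bounded_fun_mult bounded_fun_reindex) auto
    \<comment> \<open>Any point without ties may serve as reference; the embedding
      \<open>real\<close> is one, and at its rearrangements the integrand takes integer
      values.\<close>
    ultimately have "fact (2 * k) * (\<integral>z. ?F z \<partial>unit_cube (2 * k)) =
        (\<Sum>s | s permutes {1..2 * k}. ?F (\<lambda>i\<in>{1..2 * k}. real (s i)))"
      by (subst integral_order_fun[of _ _ real]) auto
    also have "\<dots> \<in> \<int>" by (intro Ints_sum) (simp add: predicate_fun_def)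
    finally show ?thesis by (simp add: integral_f_cond_mean[OF that])
  qed
  have "N = (\<integral>x. (\<Sum>S\<in>scopes d k. \<Sum>T\<in>Pow S. (- 1) ^ (card S - card T) * (f x * cond_mean k f T x)) \<partial>unit_cube k)"
    unfolding integral_f_t[symmetric] top_part_def degree_part_def efron_stein_def
    by (simp add: sum_distrib_left mult_ac)
  also have "\<dots> = (\<Sum>S\<in>scopes d k. \<Sum>T\<in>Pow S. (- 1) ^ (card S - card T) * (\<integral>x. f x * cond_mean k f T x \<partial>unit_cube k))"
    by (subst Bochner_Integration.integral_sum Bochner_Integration.integral_mult_right_zero
          | auto intro!: bounded_fun_integrable bounded_fun_sum bounded_fun_mult sum.cong)+
  finally have "fact (2 * k) * N = (\<Sum>S\<in>scopes d k. \<Sum>T\<in>Pow S.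
      (- 1) ^ (card S - card T) * (fact (2 * k) * (\<integral>x. f x * cond_mean k f T x \<partial>unit_cube k)))"
    by (simp add: sum_distrib_left mult_ac)
  also have "\<dots> \<in> \<int>"
  proof (intro Ints_sum)
    fix S T assume "S \<in> scopes d k" "T \<in> Pow S"
    then have "T \<subseteq> {1..k}" unfolding scopes_iff by blast
    then show "(- 1) ^ (card S - card T) * (fact (2 * k) * (\<integral>x. f x * cond_mean k f T x \<partial>unit_cube k)) \<in> \<int>"
      by (intro Ints_mult[OF _ *]) auto
  qed
  finally show ?thesis .
qed

lemma N_ge: "1 / fact (2 * k) \<le> N"
proof -
  obtain m :: int where m: "fact (2 * k) * N = of_int m" using N_integer_multiple by (elim Ints_cases)
  moreover have "0 < fact (2 * k) * N" using N_pos by simp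
  ultimately have "1 \<le> fact (2 * k) * N" by simp
  then show ?thesis by (simp add: field_simps)
qed

text \<open>The symmetrised predicate \<open>g\<close> is constant on points without ties, so at
  such a point all its conditional means coincide and its components of positive degree vanish;
  taking the degree part commutes with symmetrising. This is what makes the tilted weights of a
  scope sum to one at every x without ties.\<close>

lemma sum_t_permutes:
  assumes y: "inj_on y {1..k}"
  shows "(\<Sum>s | s permutes {1..k}. t (\<lambda>i\<in>{1..k}. y (s i))) = 0"
proof -
  define g where "g z = (\<Sum>s | s permutes {1..k}. f (\<lambda>i\<in>{1..k}. z (s i)))" for z
  have perm: "s ` {1..k} \<subseteq> {1..k}" if "s permutes {1..k}" for s
    using that by (simp add: permutes_image)
  have g_inj: "g z = g y" if "inj_on z {1..k}" for z
    unfolding g_def by (rule sum_permutations_order_fun[OF order_fun_predicate_fun that y])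
  interpret prob_space "unit_cube k" by (rule prob_space_unit_cube)
  have cm: "cond_mean k g T y = g y" if "T \<subseteq> {1..k}" for T
  proof -
    \<comment> \<open>A resampled point mixes values of y and w, so w must also avoid the values of
      y for it to be free of ties.\<close>
    have "AE w in unit_cube k. \<forall>z\<in>{1..k} \<times> {1..k}. w (fst z) \<noteq> y (snd z)"
      by (rule AE_finite_allI) (auto intro!: AE_unit_cube_neq_const)
    then have "AE w in unit_cube k. g (resample k T y w) = g y"
      using AE_unit_cube_inj
    proof eventually_elim
      case (elim w)
      then have "w i \<noteq> y j" if "i \<in> {1..k}" "j \<in> {1..k}" for i j using that by fastforce
      then show ?case
        using elim(2) y by (intro g_inj inj_onI) (fastforce simp: resample_def inj_on_eq_iff split: if_splits)
    qed
    moreover have "bounded_fun k g"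
      unfolding g_def [abs_def] using perm by (intro bounded_fun_sum bounded_fun_reindex) auto
    ultimately have "cond_mean k g T y = (\<integral>w. g y \<partial>unit_cube k)"
      unfolding cond_mean_resample
      by (intro integral_cong_AE) (auto intro: bounded_fun_measurable bounded_fun_resample)
    then show ?thesis by (simp add: prob_space)
  qed
  have "efron_stein k g S y = 0" if S: "S \<in> scopes d k" for S
  proof -
    obtain a where a: "a \<in> S" using S d_bounds(1) by (fastforce simp: scopes_iff)
    show ?thesis unfolding efron_stein_alternating_sum
    proof (rule alternating_sum_eq_0[OF finite_scope[OF S] a])
      fix T assume "T \<subseteq> S"
      then have "T \<subseteq> {1..k}" "insert a T \<subseteq> {1..k}" using S a unfolding scopes_iff by blast+
      then show "cond_mean k g (insert a T) y = cond_mean k g T y" by (simp add: cm)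
    qed
  qed
  then have "0 = degree_part k g d y" by (simp add: degree_part_def)
  also have "\<dots> = (\<Sum>s | s permutes {1..k}. degree_part k (\<lambda>z. f (\<lambda>i\<in>{1..k}. z (s i))) d y)"
    unfolding g_def [abs_def] using perm by (intro degree_part_sum bounded_fun_reindex) auto
  also have "\<dots> = (\<Sum>s | s permutes {1..k}. t (\<lambda>i\<in>{1..k}. y (s i)))"
    unfolding top_part_def by (intro sum.cong refl degree_part_reindex[symmetric]) auto
  finally show ?thesis by simp
qed

end

section \<open>Finite product spaces and counting\<close>

lemma sum_PiE_fun_upd:
  assumes "finite I" "i \<in> I"
  shows "(\<Sum>\<sigma>\<in>PiE I B. F \<sigma>) = (\<Sum>\<sigma>\<in>PiE (I - {i}) B. \<Sum>v\<in>B i. F (\<sigma>(i := v)))"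
proof -
  let ?u = "\<lambda>(v, \<sigma>). \<sigma>(i := v)"
  have I: "PiE I B = ?u ` (B i \<times> PiE (I - {i}) B)"
    using PiE_insert_eq[of i "I - {i}" B] assms by (simp add: insert_absorb)
  have "(\<Sum>\<sigma>\<in>PiE I B. F \<sigma>) = (\<Sum>z\<in>B i \<times> PiE (I - {i}) B. F (?u z))"
    unfolding I by (subst sum.reindex[OF inj_combinator]) auto
  also have "\<dots> = (\<Sum>v\<in>B i. \<Sum>\<sigma>\<in>PiE (I - {i}) B. F (\<sigma>(i := v)))"
    by (simp add: sum.cartesian_product case_prod_beta')
  finally show ?thesis by (subst sum.swap)
qed

text \<open>The mean of a product of functions of independent coordinates factors, and those outside
  J contribute only their total mass one.\<close>

lemma sum_PiE_prod_subset:
  fixes w :: "'i \<Rightarrow> 'v \<Rightarrow> real"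
  assumes "finite I" "\<And>i. i \<in> I \<Longrightarrow> finite (B i)" "\<And>i. i \<in> I \<Longrightarrow> (\<Sum>v\<in>B i. w i v) = 1" "J \<subseteq> I"
  shows "(\<Sum>\<sigma>\<in>PiE I B. (\<Prod>i\<in>I. w i (\<sigma> i)) * (\<Prod>i\<in>J. h i (\<sigma> i))) = (\<Prod>i\<in>J. \<Sum>v\<in>B i. w i v * h i v)"
proof -
  define h' where "h' i v = (if i \<in> J then h i v else 1)" for i v
  have "(\<Prod>i\<in>J. h i (\<sigma> i)) = (\<Prod>i\<in>I. h' i (\<sigma> i))" for \<sigma>
    using assms by (intro prod.mono_neutral_cong_left) (auto simp: h'_def)
  then have "(\<Sum>\<sigma>\<in>PiE I B. (\<Prod>i\<in>I. w i (\<sigma> i)) * (\<Prod>i\<in>J. h i (\<sigma> i))) =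
      (\<Sum>\<sigma>\<in>PiE I B. \<Prod>i\<in>I. w i (\<sigma> i) * h' i (\<sigma> i))"
    by (simp add: prod.distrib)
  also have "\<dots> = (\<Prod>i\<in>I. \<Sum>v\<in>B i. w i v * h' i v)"
    using assms by (intro prod_sum_PiE[symmetric]) auto
  also have "\<dots> = (\<Prod>i\<in>J. \<Sum>v\<in>B i. w i v * h i v)"
    using assms by (intro prod.mono_neutral_cong_right) (auto simp: h'_def)
  finally show ?thesis .
qed

text \<open>Variance plus squared bias: off-diagonal products factor, and only the diagonal departs
  from the square of the mean. The centre \<open>m\<close> is free because the planted mean given x
  depends on x, while the deviation is measured from a fixed number.\<close>

lemma sum_PiE_square_deviation:
  fixes w Y :: "'i \<Rightarrow> 'v \<Rightarrow> real"
  assumes "finite I" "\<And>i. i \<in> I \<Longrightarrow> finite (B i)" "\<And>i. i \<in> I \<Longrightarrow> (\<Sum>v\<in>B i. w i v) = 1"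
  defines "y \<equiv> \<lambda>i. \<Sum>v\<in>B i. w i v * Y i v"
  shows "(\<Sum>\<sigma>\<in>PiE I B. (\<Prod>i\<in>I. w i (\<sigma> i)) * ((\<Sum>i\<in>I. Y i (\<sigma> i)) - m)\<^sup>2)
    = (\<Sum>i\<in>I. (\<Sum>v\<in>B i. w i v * (Y i v)\<^sup>2) - (y i)\<^sup>2) + ((\<Sum>i\<in>I. y i) - m)\<^sup>2"
proof -
  let ?W = "\<lambda>\<sigma>. \<Prod>i\<in>I. w i (\<sigma> i)"
  have one: "(\<Sum>\<sigma>\<in>PiE I B. ?W \<sigma>) = 1"
    using sum_PiE_prod_subset[of I B w "{}" "\<lambda>_ _. 1"] assms by simp
  have single: "(\<Sum>\<sigma>\<in>PiE I B. ?W \<sigma> * h (\<sigma> i)) = (\<Sum>v\<in>B i. w i v * h v)" if "i \<in> I" for i h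
    using sum_PiE_prod_subset[of I B w "{i}" "\<lambda>_. h"] assms that by simp
  have pair: "(\<Sum>\<sigma>\<in>PiE I B. ?W \<sigma> * (Y i (\<sigma> i) * Y j (\<sigma> j))) = y i * y j" if "i \<in> I" "j \<in> I" "i \<noteq> j" for i j
    using sum_PiE_prod_subset[of I B w "{i, j}" Y] assms that by simp
  have "(\<Sum>\<sigma>\<in>PiE I B. ?W \<sigma> * (\<Sum>i\<in>I. Y i (\<sigma> i))\<^sup>2) =
      (\<Sum>i\<in>I. \<Sum>j\<in>I. \<Sum>\<sigma>\<in>PiE I B. ?W \<sigma> * (Y i (\<sigma> i) * Y j (\<sigma> j)))"
  proof -
    have "?W \<sigma> * (\<Sum>i\<in>I. Y i (\<sigma> i))\<^sup>2 = (\<Sum>i\<in>I. \<Sum>j\<in>I. ?W \<sigma> * (Y i (\<sigma> i) * Y j (\<sigma> j)))" for \<sigma>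
      unfolding power2_eq_square sum_product by (simp only: sum_distrib_left)
    then have "(\<Sum>\<sigma>\<in>PiE I B. ?W \<sigma> * (\<Sum>i\<in>I. Y i (\<sigma> i))\<^sup>2) =
        (\<Sum>i\<in>I. \<Sum>\<sigma>\<in>PiE I B. \<Sum>j\<in>I. ?W \<sigma> * (Y i (\<sigma> i) * Y j (\<sigma> j)))"
      by (simp only: sum.swap[of _ I "PiE I B"])
    also have "\<dots> = (\<Sum>i\<in>I. \<Sum>j\<in>I. \<Sum>\<sigma>\<in>PiE I B. ?W \<sigma> * (Y i (\<sigma> i) * Y j (\<sigma> j)))"
      by (intro sum.cong refl sum.swap)
    finally show ?thesis .
  qed
  also have "\<dots> = (\<Sum>i\<in>I. \<Sum>j\<in>I. y i * y j + (if j = i then (\<Sum>v\<in>B i. w i v * (Y i v)\<^sup>2) - (y i)\<^sup>2 else 0))"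
  proof (intro sum.cong refl)
    fix i j assume ij: "i \<in> I" "j \<in> I"
    show "(\<Sum>\<sigma>\<in>PiE I B. ?W \<sigma> * (Y i (\<sigma> i) * Y j (\<sigma> j))) =
        y i * y j + (if j = i then (\<Sum>v\<in>B i. w i v * (Y i v)\<^sup>2) - (y i)\<^sup>2 else 0)"
      using pair[OF ij] single[OF ij(1), of "\<lambda>v. (Y i v)\<^sup>2"] by (auto simp: power2_eq_square)
  qed
  also have "\<dots> = (\<Sum>i\<in>I. y i)\<^sup>2 + (\<Sum>i\<in>I. (\<Sum>v\<in>B i. w i v * (Y i v)\<^sup>2) - (y i)\<^sup>2)"
    using assms(1) by (simp add: sum.distrib sum.delta power2_eq_square sum_product)
  finally have sq: "(\<Sum>\<sigma>\<in>PiE I B. ?W \<sigma> * (\<Sum>i\<in>I. Y i (\<sigma> i))\<^sup>2) =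
      (\<Sum>i\<in>I. y i)\<^sup>2 + (\<Sum>i\<in>I. (\<Sum>v\<in>B i. w i v * (Y i v)\<^sup>2) - (y i)\<^sup>2)" .
  have lin: "(\<Sum>\<sigma>\<in>PiE I B. ?W \<sigma> * (\<Sum>i\<in>I. Y i (\<sigma> i))) = (\<Sum>i\<in>I. y i)"
  proof -
    have "(\<Sum>\<sigma>\<in>PiE I B. ?W \<sigma> * (\<Sum>i\<in>I. Y i (\<sigma> i))) = (\<Sum>i\<in>I. \<Sum>\<sigma>\<in>PiE I B. ?W \<sigma> * Y i (\<sigma> i))"
      by (simp add: sum_distrib_left sum.swap[of _ I "PiE I B"])
    then show ?thesis using single by (simp add: y_def)
  qed
  have "(\<Sum>\<sigma>\<in>PiE I B. ?W \<sigma> * ((\<Sum>i\<in>I. Y i (\<sigma> i)) - m)\<^sup>2) =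
      (\<Sum>\<sigma>\<in>PiE I B. ?W \<sigma> * (\<Sum>i\<in>I. Y i (\<sigma> i))\<^sup>2)
        - 2 * m * (\<Sum>\<sigma>\<in>PiE I B. ?W \<sigma> * (\<Sum>i\<in>I. Y i (\<sigma> i))) + m\<^sup>2 * (\<Sum>\<sigma>\<in>PiE I B. ?W \<sigma>)"
  proof -
    have "w * (z - m)\<^sup>2 = w * z\<^sup>2 - 2 * m * (w * z) + m\<^sup>2 * w" for w z :: real
      by (simp add: power2_diff algebra_simps)
    then show ?thesis by (simp only: sum.distrib sum_subtractf sum_distrib_left[symmetric])
  qed
  then show ?thesis unfolding sq lin one by (simp add: power2_diff)
qed

section \<open>Counting sets of scopes concentrated on few variables\<close>

lemma power_div_fact_le_exp: "real a ^ a / fact a \<le> exp (real a)"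
proof -
  have s: "(\<lambda>n. real a ^ n /\<^sub>R fact n) sums exp (real a)" by (rule exp_converges)
  have "(\<Sum>n\<in>{a}. real a ^ n /\<^sub>R fact n) \<le> (\<Sum>n. real a ^ n /\<^sub>R fact n)"
    using s by (intro sum_le_suminf) (auto simp: sums_iff)
  then show ?thesis using s by (simp add: sums_iff divide_inverse_commute)
qed

text \<open>Weight every V by y^(card V) with y = s/n \<le> 1. A counted set weighs at least y^s,
  and all sets together weigh (1 + y)^n \<le> exp s.\<close>

lemma card_small_subsets_le:
  fixes s :: real
  assumes "0 < s" "s \<le> real n"
  shows "real (card {V. V \<subseteq> {1..n} \<and> real (card V) \<le> s}) \<le> (real n / s) powr s * exp s"
proof -
  define y where "y = s / real n"
  have n: "0 < real n" using assms by simp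
  have y: "0 < y" "y \<le> 1" using assms n by (auto simp: y_def)
  have ys: "(real n / s) powr s * y powr s = 1"
    using assms n by (simp add: y_def powr_mult[symmetric])
  have "real (card {V. V \<subseteq> {1..n} \<and> real (card V) \<le> s}) = (\<Sum>V | V \<subseteq> {1..n} \<and> real (card V) \<le> s. 1)" by simp
  also have "\<dots> \<le> (\<Sum>V | V \<subseteq> {1..n} \<and> real (card V) \<le> s. (real n / s) powr s * y ^ card V)"
  proof (intro sum_mono)
    fix V assume "V \<in> {V. V \<subseteq> {1..n} \<and> real (card V) \<le> s}"
    then have "y powr s \<le> y powr real (card V)" using y by (intro powr_mono') auto
    then have "(real n / s) powr s * y powr s \<le> (real n / s) powr s * y ^ card V"
      using y by (intro mult_left_mono) (auto simp: powr_realpow)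
    then show "1 \<le> (real n / s) powr s * y ^ card V" using ys by simp
  qed
  also have "\<dots> \<le> (\<Sum>V\<in>Pow {1..n}. (real n / s) powr s * y ^ card V)"
    using y by (intro sum_mono2) auto
  also have "\<dots> = (real n / s) powr s * (1 + y) ^ n"
    using prod_add[of "{1..n}" "\<lambda>_. y" "\<lambda>_. 1"] by (simp add: sum_distrib_left[symmetric] add.commute)
  also have "(1 + y) ^ n \<le> exp y ^ n" using y by (intro power_mono) (auto simp: exp_ge_add_one_self)
  also have "exp y ^ n = exp s" using n by (simp add: exp_of_nat_mult[symmetric] y_def)
  finally show ?thesis using assms by simp
qed

text \<open>Choose d points of the scope inside V and the other k - d anywhere.\<close>

lemma card_scopes_meeting_le:
  assumes V: "V \<subseteq> {1..n}" and d: "d \<le> k"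
  shows "card {S \<in> scopes k n. d \<le> card (S \<inter> V)} \<le> card V ^ d * n ^ (k - d)"
proof -
  let ?W = "{W. W \<subseteq> V \<and> card W = d}" and ?R = "scopes (k - d) n"
  have fV: "finite V" using V by (rule finite_subset) simp
  have "{S \<in> scopes k n. d \<le> card (S \<inter> V)} \<subseteq> (\<lambda>(W, R). W \<union> R) ` (?W \<times> ?R)"
  proof
    fix S assume S: "S \<in> {S \<in> scopes k n. d \<le> card (S \<inter> V)}"
    then have "d \<le> card (S \<inter> V)" by simp
    then obtain W where W: "W \<subseteq> S \<inter> V" "card W = d" by (rule obtain_subset_with_card_n)
    have fS: "finite S" using S finite_scope by auto
    have "W \<subseteq> S" using W by blast
    then have "card (S - W) = k - d" using S W fS by (subst card_Diff_subset) (auto simp: scopes_iff intro: finite_subset)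
    then have "S - W \<in> ?R" using S unfolding scopes_iff mem_Collect_eq by blast
    moreover have "W \<union> (S - W) = S" using \<open>W \<subseteq> S\<close> by blast
    ultimately show "S \<in> (\<lambda>(W, R). W \<union> R) ` (?W \<times> ?R)" using W by (intro image_eqI[of _ _ "(W, S - W)"]) auto
  qed
  moreover have "finite (?W \<times> ?R)" using fV by auto
  ultimately have "card {S \<in> scopes k n. d \<le> card (S \<inter> V)} \<le> card (?W \<times> ?R)" by (rule surj_card_le[rotated])
  also have "\<dots> = (card V choose d) * (n choose (k - d))"
    using n_subsets[OF fV] by (simp add: card_cartesian_product card_scopes)
  also have "\<dots> \<le> card V ^ d * n ^ (k - d)"
  proof (intro mult_mono)
    show "m choose r \<le> m ^ r" for m r :: nat
      by (cases "r \<le> m") (simp_all add: binomial_le_pow binomial_eq_0)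
    then show "n choose (k - d) \<le> n ^ (k - d)" .
  qed auto
  finally show ?thesis .
qed

text \<open>The shape left by a double cover: the core V has at most half as many points as there
  are incidences, d for each scope. Doubling \<open>card V\<close> avoids division on the
  naturals.\<close>

definition concentrated :: "nat \<Rightarrow> nat \<Rightarrow> nat set set \<Rightarrow> bool" where
  "concentrated n d A \<longleftrightarrow> (\<exists>V\<subseteq>{1..n}. 2 * card V \<le> d * card A \<and> (\<forall>S\<in>A. d \<le> card (S \<inter> V)))"

text \<open>Sum over the cores V with at most s = d a / 2 points. Each scope then has at most s^d
  n^(k-d) choices, and picking a of them without order gains 1/a! \<le> (e/a)^a. All factors are
  a-th powers.\<close>

lemma card_concentrated_le:
  assumes d: "2 \<le> d" "d \<le> k" and a: "1 \<le> a" "a \<le> D" "k * D \<le> n"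
  shows "real (card {A. A \<subseteq> scopes k n \<and> card A = a \<and> concentrated n d A}) \<le>
    (exp (real d / 2 + 1) * (real d / 2) powr (real d / 2) * real n ^ k / real n *
       (real D / real n) powr (real d / 2 - 1)) ^ a"
proof -
  define s where "s = real d * real a / 2"
  let ?VV = "{V. V \<subseteq> {1..n} \<and> real (card V) \<le> s}"
  let ?H = "\<lambda>V. {S \<in> scopes k n. d \<le> card (S \<inter> V)}"
  \<comment> \<open>The bound on D ensures s \<le> n, as the count of the cores requires.\<close>
  have "d * a \<le> k * D" using d a by (intro mult_mono) auto
  then have "d * a \<le> n" using a by simp
  then have "real d * real a \<le> real n" by (metis of_nat_le_iff of_nat_mult)
  then have s: "0 < s" "s \<le> real n" using d a by (auto simp: s_def)
  then have n: "0 < real n" by simp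
  have fin: "finite ?VV" by (rule finite_subset[of _ "Pow {1..n}"]) auto
  have "{A. A \<subseteq> scopes k n \<and> card A = a \<and> concentrated n d A} \<subseteq>
      (\<Union>V\<in>?VV. {A. A \<subseteq> ?H V \<and> card A = a})"
  proof (clarify)
    fix A assume A: "A \<subseteq> scopes k n" "a = card A" "concentrated n d A"
    then obtain V where V: "V \<subseteq> {1..n}" "2 * card V \<le> d * card A" "\<forall>S\<in>A. d \<le> card (S \<inter> V)"
      by (auto simp: concentrated_def)
    have "real (2 * card V) \<le> real (d * card A)" using V(2) by (simp only: of_nat_le_iff)
    then have "V \<in> ?VV" using V(1) A(2) by (simp add: s_def)
    then show "A \<in> (\<Union>V\<in>?VV. {A'. A' \<subseteq> ?H V \<and> card A' = card A})" using A V(3) by (intro UN_I[of V]) auto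
  qed
  then have "card {A. A \<subseteq> scopes k n \<and> card A = a \<and> concentrated n d A} \<le>
      card (\<Union>V\<in>?VV. {A. A \<subseteq> ?H V \<and> card A = a})"
    by (rule card_mono[rotated]) (use fin in \<open>auto intro: finite_subset[of _ "Pow (scopes k n)"]\<close>)
  also have "\<dots> \<le> (\<Sum>V\<in>?VV. card {A. A \<subseteq> ?H V \<and> card A = a})" using fin by (rule card_UN_le)
  finally have "real (card {A. A \<subseteq> scopes k n \<and> card A = a \<and> concentrated n d A}) \<le>
      (\<Sum>V\<in>?VV. real (card {A. A \<subseteq> ?H V \<and> card A = a}))" by (simp flip: of_nat_sum)
  also have "\<dots> \<le> (\<Sum>V\<in>?VV. (s ^ d * real n ^ (k - d)) ^ a / fact a)"
  proof (intro sum_mono)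
    fix V assume V: "V \<in> ?VV"
    have "card {A. A \<subseteq> ?H V \<and> card A = a} = card (?H V) choose a" by (rule n_subsets) auto
    then have "card {A. A \<subseteq> ?H V \<and> card A = a} * fact a \<le> card (?H V) ^ a"
      using binomial_fact_pow[of "card (?H V)" a] by simp
    then have "real (card {A. A \<subseteq> ?H V \<and> card A = a} * fact a) \<le> real (card (?H V) ^ a)"
      by (simp only: of_nat_le_iff)
    then have "real (card {A. A \<subseteq> ?H V \<and> card A = a}) * fact a \<le> real (card (?H V)) ^ a"
      by (simp only: of_nat_mult of_nat_power of_nat_fact)
    also have "\<dots> \<le> (s ^ d * real n ^ (k - d)) ^ a"
    proof (intro power_mono)
      have "real (card (?H V)) \<le> real (card V ^ d * n ^ (k - d))"
        using card_scopes_meeting_le[of V n d k] V d by (simp only: of_nat_le_iff mem_Collect_eq)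
      also have "\<dots> = real (card V) ^ d * real n ^ (k - d)" by simp
      also have "\<dots> \<le> s ^ d * real n ^ (k - d)" using V by (intro mult_right_mono power_mono) auto
      finally show "real (card (?H V)) \<le> s ^ d * real n ^ (k - d)" .
    qed simp
    finally show "real (card {A. A \<subseteq> ?H V \<and> card A = a}) \<le> (s ^ d * real n ^ (k - d)) ^ a / fact a"
      by (simp add: field_simps)
  qed
  also have "\<dots> = real (card ?VV) * ((s ^ d * real n ^ (k - d)) ^ a / fact a)" by simp
  also have "\<dots> \<le> ((real n / s) powr s * exp s) * ((s ^ d * real n ^ (k - d)) ^ a * (exp (real a) / real a ^ a))"
  proof (intro mult_mono card_small_subsets_le s)
    have "1 / fact a \<le> exp (real a) / real a ^ a"
      using power_div_fact_le_exp[of a] a by (simp add: field_simps)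
    then have "(s ^ d * real n ^ (k - d)) ^ a * (1 / fact a) \<le> (s ^ d * real n ^ (k - d)) ^ a * (exp (real a) / real a ^ a)"
      using s by (intro mult_left_mono) auto
    then show "(s ^ d * real n ^ (k - d)) ^ a / fact a \<le> (s ^ d * real n ^ (k - d)) ^ a * (exp (real a) / real a ^ a)" by simp
  qed (use s in auto)
  also have "\<dots> = ((real n / s) powr (real d / 2) * exp (real d / 2) * (s ^ d * real n ^ (k - d)) * (exp 1 / real a)) ^ a"
  proof -
    have "(real n / s) powr s = ((real n / s) powr (real d / 2)) ^ a"
    proof -
      have "((real n / s) powr (real d / 2)) ^ a = ((real n / s) powr (real d / 2)) powr real a"
        using s n by (intro powr_realpow[symmetric]) auto
      also have "\<dots> = (real n / s) powr s" unfolding powr_powr by (simp add: s_def)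
      finally show ?thesis by simp
    qed
    moreover have "exp s = exp (real d / 2) ^ a" by (simp add: exp_of_nat_mult[symmetric] s_def mult.commute)
    moreover have "exp (real a) = exp 1 ^ a" by (simp add: exp_of_nat_mult[symmetric])
    ultimately show ?thesis by (simp add: power_mult_distrib power_divide)
  qed
  also have "(real n / s) powr (real d / 2) * exp (real d / 2) * (s ^ d * real n ^ (k - d)) * (exp 1 / real a) =
      exp (real d / 2 + 1) * (real d / 2) powr (real d / 2) * real n ^ k / real n * (real a / real n) powr (real d / 2 - 1)"
  proof -
    \<comment> \<open>Half of s^d cancels the denominator of (n/s)^(d/2). The powers of n are split
      in the same way below, leaving n^(k-1) (a/n)^(d/2-1) up to constants.\<close>
    have sd: "s ^ d = s powr (real d / 2) * s powr (real d / 2)"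
      using s by (simp add: powr_realpow[symmetric] powr_add[symmetric])
    have 1: "(real n / s) powr (real d / 2) * s ^ d = real n powr (real d / 2) * s powr (real d / 2)"
      unfolding sd using s n by (simp add: powr_divide)
    have 2: "s powr (real d / 2) = (real d / 2) powr (real d / 2) * (real a powr (real d / 2 - 1) * real a)"
      using d a by (simp add: s_def powr_mult[symmetric] powr_diff mult.commute)
    have 3: "real n powr (real d / 2) * real n ^ (k - d) = real n ^ k / real n * (1 / real n powr (real d / 2 - 1))"
    proof -
      have "real n ^ k = real n ^ (k - d) * (real n powr (real d / 2) * real n powr (real d / 2))"
        using d n by (simp add: powr_add[symmetric] powr_realpow power_add[symmetric])
      then show ?thesis using n by (simp add: powr_diff)
    qed
    have "(real n / s) powr (real d / 2) * exp (real d / 2) * (s ^ d * real n ^ (k - d)) * (exp 1 / real a) =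
        ((real n / s) powr (real d / 2) * s ^ d) * (exp (real d / 2) * exp 1) * real n ^ (k - d) / real a"
      by simp
    also have "\<dots> = (real n powr (real d / 2) * real n ^ (k - d)) * (s powr (real d / 2) / real a) * exp (real d / 2 + 1)"
      unfolding 1 exp_add by simp
    also have "\<dots> = real n ^ k / real n * (1 / real n powr (real d / 2 - 1)) *
        ((real d / 2) powr (real d / 2) * real a powr (real d / 2 - 1)) * exp (real d / 2 + 1)"
      unfolding 2 3 using a by simp
    also have "\<dots> = exp (real d / 2 + 1) * (real d / 2) powr (real d / 2) * real n ^ k / real n *
        (real a / real n) powr (real d / 2 - 1)"
      using n by (simp add: powr_divide mult_ac)
    finally show ?thesis .
  qed
  \<comment> \<open>The exponent d/2 - 1 is nonnegative, so a may be replaced by D, and the base no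
    longer depends on a.\<close>
  also have "\<dots> ^ a \<le> (exp (real d / 2 + 1) * (real d / 2) powr (real d / 2) * real n ^ k / real n *
       (real D / real n) powr (real d / 2 - 1)) ^ a"
    using n d a by (intro power_mono mult_left_mono powr_mono2 divide_right_mono) auto
  finally show ?thesis .
qed

section \<open>The null and the planted model\<close>

lemma bij_betw_of_card_eq:
  assumes "finite B" "inj_on g A" "g ` A \<subseteq> B" "card A = card B"
  shows "bij_betw g A B"
  using assms card_subset_eq[of B "g ` A"] by (simp add: bij_betw_def card_image)

lemma ordering_bij_betw:
  assumes "\<nu> \<in> permutations_of_set S"
  shows "bij_betw (\<lambda>i. \<nu> ! (i - 1)) {1..card S} S"
proof -
  have "bij_betw (\<lambda>i. i - 1) {1..card S} {..<card S}"
    by (rule bij_betw_byWitness[of _ "\<lambda>i. i + 1"]) auto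
  moreover have "bij_betw ((!) \<nu>) {..<card S} S"
    using assms permutations_of_set_length[OF assms]
    by (intro bij_betw_nth) (auto dest: permutations_of_setD)
  ultimately show ?thesis by (auto dest: bij_betw_trans simp: o_def)
qed

lemma bij_betw_ordering_inv:
  assumes "\<nu> \<in> permutations_of_set S"
  shows "bij_betw (ordering_inv \<nu>) S {1..card S}"
  unfolding ordering_inv_def permutations_of_set_length[OF assms]
  by (rule bij_betw_inv_into[OF ordering_bij_betw[OF assms]])

lemma nth_ordering_inv:
  assumes "\<nu> \<in> permutations_of_set S" "s \<in> S"
  shows "\<nu> ! (ordering_inv \<nu> s - 1) = s"
  unfolding ordering_inv_def permutations_of_set_length[OF assms(1)]
  using bij_betw_inv_into_right[OF ordering_bij_betw[OF assms(1)] assms(2)] .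

lemma ordering_inv_nth:
  assumes "\<nu> \<in> permutations_of_set S" "i \<in> {1..card S}"
  shows "ordering_inv \<nu> (\<nu> ! (i - 1)) = i"
  unfolding ordering_inv_def permutations_of_set_length[OF assms(1)]
  using bij_betw_inv_into_left[OF ordering_bij_betw[OF assms(1)] assms(2)] .

text \<open>Equal positions of all elements force equal orderings, and both sets have the same
  finite size. Hence a uniformly random clause is satisfied by any fixed ordering with probability
  avg(P).\<close>

lemma bij_betw_inverse_orderings:
  assumes S: "finite S" and \<pi>: "\<pi> \<in> permutations_of_set S"
  shows "bij_betw (\<lambda>\<nu>. map (ordering_inv \<nu>) \<pi>) (permutations_of_set S) (permutations_of_set {1..card S})"
proof (rule bij_betw_of_card_eq)
  show "inj_on (\<lambda>\<nu>. map (ordering_inv \<nu>) \<pi>) (permutations_of_set S)"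
  proof (rule inj_onI)
    fix \<nu> \<nu>' assume \<nu>: "\<nu> \<in> permutations_of_set S" "\<nu>' \<in> permutations_of_set S"
      and eq: "map (ordering_inv \<nu>) \<pi> = map (ordering_inv \<nu>') \<pi>"
    have inv: "ordering_inv \<nu> s = ordering_inv \<nu>' s" if "s \<in> S" for s
      using eq that \<pi> by (auto dest: permutations_of_setD)
    show "\<nu> = \<nu>'"
    proof (rule nth_equalityI)
      fix i assume "i < length \<nu>"
      then have i: "i < card S" using permutations_of_set_length[OF \<nu>(1)] by simp
      then have s: "\<nu> ! i \<in> S" using \<nu>(1) by (metis \<open>i < length \<nu>\<close> nth_mem permutations_of_setD(1))
      have "ordering_inv \<nu>' (\<nu> ! i) = i + 1"
        using ordering_inv_nth[OF \<nu>(1), of "i + 1"] inv[OF s] i by simp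
      then show "\<nu> ! i = \<nu>' ! i" using nth_ordering_inv[OF \<nu>(2) s] by simp
    qed (simp add: permutations_of_set_length[OF \<nu>(1)] permutations_of_set_length[OF \<nu>(2)])
  qed
  show "(\<lambda>\<nu>. map (ordering_inv \<nu>) \<pi>) ` permutations_of_set S \<subseteq> permutations_of_set {1..card S}"
  proof (clarify, rule permutations_of_setI)
    fix \<nu> assume "\<nu> \<in> permutations_of_set S"
    from bij_betw_ordering_inv[OF this] permutations_of_setD[OF \<pi>]
    show "set (map (ordering_inv \<nu>) \<pi>) = {1..card S}" "distinct (map (ordering_inv \<nu>) \<pi>)"
      by (auto simp: bij_betw_def distinct_map)
  qed
qed (use S in auto)

context ordering_predicate
begin

text \<open>The point x_\<nu> of the planted model; restricting to {1..k} places it in the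
  k-cube.\<close>

definition pull :: "nat list \<Rightarrow> (nat \<Rightarrow> real) \<Rightarrow> nat \<Rightarrow> real" where
  "pull \<nu> x = (\<lambda>i\<in>{1..k}. x (\<nu> ! (i - 1)))"

lemma ordering_of_scope:
  assumes "S \<in> scopes k n" "\<nu> \<in> permutations_of_set S"
  shows "inj_on (\<lambda>i. \<nu> ! (i - 1)) {1..k}" "(\<lambda>i. \<nu> ! (i - 1)) ` {1..k} = S" "S \<subseteq> {1..n}"
  using ordering_bij_betw[OF assms(2)] assms(1) by (simp_all add: scopes_iff bij_betw_def)

lemma bounded_fun_pull [intro]:
  assumes "S \<in> scopes k n" "\<nu> \<in> permutations_of_set S" "bounded_fun k g"
  shows "bounded_fun n (\<lambda>x. g (pull \<nu> x))"
  unfolding pull_def using ordering_of_scope[OF assms(1,2)] assms(3) by (intro bounded_fun_reindex) auto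

lemma integral_pull:
  assumes "S \<in> scopes k n" "\<nu> \<in> permutations_of_set S" "bounded_fun k g"
  shows "(\<integral>x. g (pull \<nu> x) \<partial>unit_cube n) = (\<integral>x. g x \<partial>unit_cube k)"
  unfolding pull_def using ordering_of_scope[OF assms(1,2)] assms(3) by (intro integral_reindex) auto

lemma depends_on_pull:
  assumes "S \<in> scopes k n" "\<nu> \<in> permutations_of_set S"
  shows "depends_on S (\<lambda>x. g (pull \<nu> x))"
  unfolding depends_on_def
proof (intro allI impI arg_cong[of _ _ g])
  fix x x' :: "nat \<Rightarrow> real" assume *: "\<forall>i\<in>S. x i = x' i"
  have "\<nu> ! (i - 1) \<in> S" if "i \<in> {1..k}" for i using ordering_of_scope(2)[OF assms] that by blast
  then show "pull \<nu> x = pull \<nu> x'" using * by (auto simp: pull_def fun_eq_iff)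
qed

lemma inj_on_pull:
  assumes "inj_on x {1..n}" "S \<in> scopes k n" "\<nu> \<in> permutations_of_set S"
  shows "inj_on (pull \<nu> x) {1..k}"
proof -
  have "inj_on x ((\<lambda>i. \<nu> ! (i - 1)) ` {1..k})"
    unfolding ordering_of_scope(2)[OF assms(2,3)]
    using ordering_of_scope(3)[OF assms(2,3)] by (rule inj_on_subset[OF assms(1)])
  from comp_inj_on[OF ordering_of_scope(1)[OF assms(2,3)] this]
  show ?thesis by (rule inj_on_cong[THEN iffD1, rotated]) (simp add: pull_def)
qed

text \<open>Relative to a fixed ordering of S all others are given by permutations of the positions,
  which reduces the sum to \<open>sum_t_permutes\<close>. So, given x, the tilt preserves the
  probability that a scope is included.\<close>

lemma sum_t_orderings:
  assumes x: "inj_on x {1..n}" and S: "S \<in> scopes k n"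
  shows "(\<Sum>\<nu>\<in>permutations_of_set S. t (pull \<nu> x)) = 0"
proof -
  have fS: "finite S" "card S = k" using S finite_scope by (auto simp: scopes_iff)
  then obtain \<nu>0 where \<nu>0: "\<nu>0 \<in> permutations_of_set S" by (meson ex_in_conv permutations_of_set_empty_iff)
  define y where "y i = x (\<nu>0 ! (i - 1))" for i
  have y: "inj_on y {1..k}"
    using inj_on_pull[OF x S \<nu>0] by (rule inj_on_cong[THEN iffD1, rotated]) (simp add: pull_def y_def)
  define g where "g s = map (\<lambda>i. \<nu>0 ! (s i - 1)) [1..<Suc k]" for s :: "nat \<Rightarrow> nat"
  note bij = ordering_bij_betw[OF \<nu>0, unfolded fS]
  have nth: "g s ! (i - 1) = \<nu>0 ! (s i - 1)" if "i \<in> {1..k}" for s i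
  proof -
    have i: "i - 1 < length [1..<Suc k]" "1 + (i - 1) = i" "1 + (i - 1) < Suc k" using that by auto
    show ?thesis unfolding g_def nth_map[OF i(1)] nth_upt[OF i(3)] i(2) ..
  qed
  have "bij_betw g {s. s permutes {1..k}} (permutations_of_set S)"
  proof (rule bij_betw_of_card_eq)
    show "inj_on g {s. s permutes {1..k}}"
    proof (rule inj_onI, clarify)
      fix s s' assume s: "s permutes {1..k}" "s' permutes {1..k}" "g s = g s'"
      show "s = s'"
      proof
        fix i show "s i = s' i"
        proof (cases "i \<in> {1..k}")
          case True
          then have "\<nu>0 ! (s i - 1) = \<nu>0 ! (s' i - 1)" using nth[of i s] nth[of i s'] s(3) by simp
          moreover have "s i \<in> {1..k}" "s' i \<in> {1..k}" using True s by (simp_all only: permutes_in_image)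
          ultimately show ?thesis
            using inj_on_eq_iff[OF bij_betw_imp_inj_on[OF bij], of "s i" "s' i"] by simp
        qed (use s in \<open>simp add: permutes_not_in\<close>)
      qed
    qed
    show "g ` {s. s permutes {1..k}} \<subseteq> permutations_of_set S"
    proof (clarify, rule permutations_of_setI)
      fix s assume s: "s permutes {1..k}"
      then have "bij_betw (\<lambda>i. \<nu>0 ! (s i - 1)) {1..k} S"
        using bij_betw_trans[OF permutes_imp_bij[OF s] bij] by (simp add: o_def)
      moreover have "set [1..<Suc k] = {1..k}" by auto
      ultimately show "set (g s) = S" "distinct (g s)"
        unfolding g_def distinct_map set_map bij_betw_def by (simp_all del: upt_Suc)
    qed
    show "card {s. s permutes {1..k}} = card (permutations_of_set S)"
      using fS by (simp add: card_permutations[of "{1..k}" k])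
  qed simp
  then have "(\<Sum>\<nu>\<in>permutations_of_set S. t (pull \<nu> x)) = (\<Sum>s | s permutes {1..k}. t (pull (g s) x))"
    by (rule sum.reindex_bij_betw[symmetric])
  also have "\<dots> = (\<Sum>s | s permutes {1..k}. t (\<lambda>i\<in>{1..k}. y (s i)))"
    using nth by (intro sum.cong arg_cong[of _ _ t]) (auto simp: pull_def y_def fun_eq_iff)
  finally show ?thesis using sum_t_permutes[OF y] by simp
qed

lemma induced_ordering_ord_of:
  assumes "S \<in> scopes k n"
  shows "induced_ordering (ord_of n x) S \<in> permutations_of_set S" "sorted (map x (induced_ordering (ord_of n x) S))"
proof -
  have o: "set (ord_of n x) = {1..n}" "distinct (ord_of n x)" "sorted (map x (ord_of n x))"
    by (auto simp: ord_of_def)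
  then show "induced_ordering (ord_of n x) S \<in> permutations_of_set S"
    using assms unfolding induced_ordering_def scopes_iff by (intro permutations_of_setI) auto
  show "sorted (map x (induced_ordering (ord_of n x) S))"
    unfolding induced_ordering_def using o(3) by (rule sorted_filter)
qed

text \<open>Both lists arrange the positions of the clause by increasing values of x, and without
  ties there is only one such list. Hence the ordering of x satisfies the clause exactly when
  f(x_\<nu>) = 1.\<close>

lemma eval_clause:
  assumes x: "inj_on x {1..n}" and S: "S \<in> scopes k n" and \<nu>: "\<nu> \<in> permutations_of_set S"
  shows "map (ordering_inv \<nu>) (induced_ordering (ord_of n x) S) = ord_of k (pull \<nu> x)"
proof (rule ord_of_eqI[symmetric])
  let ?\<pi> = "induced_ordering (ord_of n x) S"
  have k: "card S = k" using S by (simp add: scopes_iff)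
  have \<pi>: "set ?\<pi> = S" "distinct ?\<pi>" using induced_ordering_ord_of(1)[OF S] by (auto dest: permutations_of_setD)
  show "inj_on (pull \<nu> x) {1..k}" by (rule inj_on_pull[OF x S \<nu>])
  show "set (map (ordering_inv \<nu>) ?\<pi>) = {1..k}" "distinct (map (ordering_inv \<nu>) ?\<pi>)"
    using bij_betw_ordering_inv[OF \<nu>] \<pi> k by (auto simp: bij_betw_def distinct_map)
  have "map (pull \<nu> x) (map (ordering_inv \<nu>) ?\<pi>) = map x ?\<pi>"
    unfolding map_map
  proof (rule map_cong[OF refl])
    fix s assume "s \<in> set ?\<pi>"
    then have s: "s \<in> S" using \<pi> by simp
    then have "ordering_inv \<nu> s \<in> {1..k}" using bij_betw_ordering_inv[OF \<nu>] k by (auto simp only: bij_betw_def)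
    then show "(pull \<nu> x \<circ> ordering_inv \<nu>) s = x s"
      using nth_ordering_inv[OF \<nu> s] by (simp add: pull_def)
  qed
  then show "sorted (map (pull \<nu> x) (map (ordering_inv \<nu>) ?\<pi>))"
    using induced_ordering_ord_of(2)[OF S, of x] by (simp only:)
qed

lemma sum_f_orderings:
  assumes x: "inj_on x {1..n}" and S: "S \<in> scopes k n"
  shows "(\<Sum>\<nu>\<in>permutations_of_set S. f (pull \<nu> x)) = fact k * avg k P"
proof -
  let ?\<pi> = "induced_ordering (ord_of n x) S"
  have k: "card S = k" "finite S" using S finite_scope by (auto simp: scopes_iff)
  have "(\<Sum>\<nu>\<in>permutations_of_set S. f (pull \<nu> x)) =
      (\<Sum>\<nu>\<in>permutations_of_set S. of_bool (P (map (ordering_inv \<nu>) ?\<pi>)))"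
    using eval_clause[OF x S] by (intro sum.cong) (auto simp: predicate_fun_def)
  also have "\<dots> = (\<Sum>\<tau>\<in>permutations_of_set {1..k}. of_bool (P \<tau>))"
    using sum.reindex_bij_betw[OF bij_betw_inverse_orderings[OF k(2) induced_ordering_ord_of(1)[OF S, of x]],
        of "\<lambda>\<tau>. of_bool (P \<tau>)"] k(1) by (simp only:)
  also have "\<dots> = real (card {\<tau> \<in> permutations_of_set {1..k}. P \<tau>})"
    by (subst sum_of_bool_eq) (auto simp: Collect_conj_eq Int_commute)
  finally show ?thesis by (simp add: avg_def)
qed

text \<open>The null probability of one value. The planted weight is this times a factor near one,
  so that given x the likelihood ratio is a product over the scopes.\<close>

definition base :: "real \<Rightarrow> nat list option \<Rightarrow> real" where
  "base p v = (case v of None \<Rightarrow> 1 - p | Some \<nu> \<Rightarrow> p / fact k)"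

text \<open>Omitted scopes carry no tilt, which later forces every scope of a nonzero term to be
  included.\<close>

definition tilt :: "(nat \<Rightarrow> real) \<Rightarrow> nat list option \<Rightarrow> real" where
  "tilt x v = (case v of None \<Rightarrow> 0 | Some \<nu> \<Rightarrow> t (pull \<nu> x))"

lemma planted_weight_eq: "planted_weight k P p \<epsilon> x v = base p v * (1 + 2 * \<epsilon> / N * tilt x v)"
  by (cases v) (simp_all add: planted_weight_def base_def tilt_def pull_def)

lemma finite_ocsp_alphabet [simp]: "finite (ocsp_alphabet S)"
  by (simp add: ocsp_alphabet_def)

lemma sum_ocsp_alphabet:
  "(\<Sum>v\<in>ocsp_alphabet S. F v) = F None + (\<Sum>\<nu>\<in>permutations_of_set S. F (Some \<nu>))"
  unfolding ocsp_alphabet_def by (subst sum.insert) (auto simp: sum.reindex)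

lemma sum_base:
  assumes "S \<in> scopes k n" shows "(\<Sum>v\<in>ocsp_alphabet S. base p v) = 1"
  using assms finite_scope[OF assms] by (simp add: sum_ocsp_alphabet base_def scopes_iff)

lemma sum_base_tilt:
  assumes "S \<in> scopes k n" "inj_on x {1..n}" shows "(\<Sum>v\<in>ocsp_alphabet S. base p v * tilt x v) = 0"
  using sum_t_orderings[OF assms(2,1)]
  by (simp add: sum_ocsp_alphabet base_def tilt_def sum_divide_distrib[symmetric] sum_distrib_left[symmetric])

lemma sum_planted_weight:
  assumes "S \<in> scopes k n" "inj_on x {1..n}"
  shows "(\<Sum>v\<in>ocsp_alphabet S. planted_weight k P p \<epsilon> x v) = 1"
proof -
  have "(\<Sum>v\<in>ocsp_alphabet S. planted_weight k P p \<epsilon> x v) =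
      (\<Sum>v\<in>ocsp_alphabet S. base p v) + 2 * \<epsilon> / N * (\<Sum>v\<in>ocsp_alphabet S. base p v * tilt x v)"
    by (simp add: planted_weight_eq sum_distrib_left sum.distrib[symmetric] algebra_simps)
  then show ?thesis using sum_base[OF assms(1)] sum_base_tilt[OF assms] by simp
qed

lemma bounded_fun_tilt:
  assumes "S \<in> scopes k n" "v \<in> ocsp_alphabet S" shows "bounded_fun n (\<lambda>x. tilt x v)"
  using assms by (cases v) (auto simp: tilt_def ocsp_alphabet_def)

lemma bounded_fun_planted_weight:
  assumes "S \<in> scopes k n" "v \<in> ocsp_alphabet S" shows "bounded_fun n (\<lambda>x. planted_weight k P p \<epsilon> x v)"
  unfolding planted_weight_eq
  by (intro bounded_fun_mult bounded_fun_add bounded_fun_const bounded_fun_tilt[OF assms])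

lemma tilt_abs_le: "\<bar>tilt x v\<bar> \<le> 4 ^ k"
  using t_abs_le by (cases v) (simp_all add: tilt_def)

text \<open>The origin of the bound on \<epsilon>: as 2^(2k+1) = 2 * 4^k, it reads 2 \<epsilon> 4^k
  \<le> 1/(2k)!. The right side is at most \<open>N\<close>, and the tilt is at most 4^k in absolute
  value.\<close>

lemma tilt_small:
  assumes "0 < \<epsilon>" "\<epsilon> \<le> 1 / (2 ^ (2 * k + 1) * fact (2 * k))"
  shows "\<bar>2 * \<epsilon> / N * tilt x v\<bar> \<le> 1"
proof -
  have pow: "(2::real) ^ (2 * k + 1) = 2 * 4 ^ k" using power_mult[of "2::real" 2 k] by (simp add: power_add)
  have "2 * \<epsilon> * 4 ^ k \<le> 1 / fact (2 * k)"
    using assms(2) unfolding pow by (simp add: field_simps)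
  also have "\<dots> \<le> N" by (rule N_ge)
  finally have "2 * \<epsilon> * 4 ^ k \<le> N" .
  moreover have "2 * \<epsilon> * \<bar>tilt x v\<bar> \<le> 2 * \<epsilon> * 4 ^ k"
    using tilt_abs_le assms(1) by (intro mult_left_mono) auto
  ultimately have "2 * \<epsilon> * \<bar>tilt x v\<bar> \<le> N" by linarith
  then show ?thesis using assms(1) N_pos by (simp add: abs_mult)
qed

lemma planted_weight_nonneg:
  assumes "0 \<le> p" "p \<le> 1" "0 < \<epsilon>" "\<epsilon> \<le> 1 / (2 ^ (2 * k + 1) * fact (2 * k))"
  shows "0 \<le> planted_weight k P p \<epsilon> x v"
proof -
  have "0 \<le> 1 + 2 * \<epsilon> / N * tilt x v" using tilt_small[OF assms(3,4), of x v] by linarith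
  moreover have "0 \<le> base p v" using assms(1,2) by (simp add: base_def split: option.splits)
  ultimately show ?thesis unfolding planted_weight_eq by (rule mult_nonneg_nonneg[rotated])
qed

definition planted_mass :: "real \<Rightarrow> real \<Rightarrow> nat \<Rightarrow> (nat set \<Rightarrow> nat list option) \<Rightarrow> real" where
  "planted_mass p \<epsilon> n \<sigma> = (\<integral>x. (\<Prod>S\<in>scopes k n. planted_weight k P p \<epsilon> x (\<sigma> S)) \<partial>unit_cube n)"

abbreviation "samples n \<equiv> PiE (scopes k n) ocsp_alphabet"

lemma finite_samples [simp]: "finite (samples n)"
  by (intro finite_PiE) auto

lemma samplesD: "\<sigma> \<in> samples n \<Longrightarrow> S \<in> scopes k n \<Longrightarrow> \<sigma> S \<in> ocsp_alphabet S"
  by (rule PiE_mem)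

lemma bounded_fun_planted_prod:
  assumes "\<sigma> \<in> samples n"
  shows "bounded_fun n (\<lambda>x. \<Prod>S\<in>scopes k n. planted_weight k P p \<epsilon> x (\<sigma> S))"
  using samplesD[OF assms] by (intro bounded_fun_prod bounded_fun_planted_weight)

text \<open>For x without ties the sum over samples is a product of sums over single scopes, each
  equal to one.\<close>

lemma sum_planted_mass: "(\<Sum>\<sigma>\<in>samples n. planted_mass p \<epsilon> n \<sigma>) = 1"
proof -
  interpret prob_space "unit_cube n" by (rule prob_space_unit_cube)
  have "(\<Sum>\<sigma>\<in>samples n. planted_mass p \<epsilon> n \<sigma>) =
      (\<integral>x. (\<Sum>\<sigma>\<in>samples n. \<Prod>S\<in>scopes k n. planted_weight k P p \<epsilon> x (\<sigma> S)) \<partial>unit_cube n)"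
    unfolding planted_mass_def
    by (intro Bochner_Integration.integral_sum[symmetric] bounded_fun_integrable bounded_fun_planted_prod)
  also have "\<dots> = (\<integral>x. 1 \<partial>unit_cube n)"
  proof (rule integral_cong_AE)
    show "AE x in unit_cube n. (\<Sum>\<sigma>\<in>samples n. \<Prod>S\<in>scopes k n. planted_weight k P p \<epsilon> x (\<sigma> S)) = 1"
      using AE_unit_cube_inj
    proof eventually_elim
      case (elim x)
      have "(\<Sum>\<sigma>\<in>samples n. \<Prod>S\<in>scopes k n. planted_weight k P p \<epsilon> x (\<sigma> S)) =
          (\<Prod>S\<in>scopes k n. \<Sum>v\<in>ocsp_alphabet S. planted_weight k P p \<epsilon> x v)"
        by (rule prod_sum_PiE[symmetric]) auto
      also have "\<dots> = 1" using sum_planted_weight[OF _ elim] by simp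
      finally show ?case .
    qed
  qed (auto intro!: borel_measurable_sum bounded_fun_measurable bounded_fun_planted_prod)
  finally show ?thesis by (simp add: prob_space)
qed

text \<open>For n < k there are no scopes, so no assumption on the parameters is needed.\<close>

lemma pmf_planted:
  assumes "k \<le> n \<Longrightarrow> 0 < p \<and> p \<le> 1 \<and> 0 < \<epsilon> \<and> \<epsilon> \<le> 1 / (2 ^ (2 * k + 1) * fact (2 * k))"
  shows "pmf (planted_ocsp k P p \<epsilon> n) \<sigma> = (if \<sigma> \<in> samples n then planted_mass p \<epsilon> n \<sigma> else 0)"
proof -
  have nonneg: "0 \<le> planted_mass p \<epsilon> n \<sigma>" for \<sigma>
  proof -
    have "0 \<le> planted_weight k P p \<epsilon> x (\<sigma> S)" if "S \<in> scopes k n" for x S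
    proof -
      have "k \<le> n" using that card_mono[of "{1..n}" S] by (auto simp: scopes_iff)
      then show ?thesis using assms planted_weight_nonneg[of p \<epsilon>] by auto
    qed
    then show ?thesis unfolding planted_mass_def by (intro integral_nonneg_AE AE_I2 prod_nonneg) auto
  qed
  have "(\<integral>\<^sup>+ \<sigma>. ennreal (if \<sigma> \<in> samples n then planted_mass p \<epsilon> n \<sigma> else 0) \<partial>count_space UNIV) = 1"
  proof -
    have "(\<integral>\<^sup>+ \<sigma>. ennreal (if \<sigma> \<in> samples n then planted_mass p \<epsilon> n \<sigma> else 0) \<partial>count_space UNIV) =
        (\<Sum>\<sigma>\<in>samples n. ennreal (planted_mass p \<epsilon> n \<sigma>))"
      by (subst nn_integral_count_space'[of "samples n"]) auto
    also have "\<dots> = ennreal (\<Sum>\<sigma>\<in>samples n. planted_mass p \<epsilon> n \<sigma>)"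
      by (rule sum_ennreal) (rule nonneg)
    finally show ?thesis by (simp add: sum_planted_mass)
  qed
  then show ?thesis
    unfolding planted_ocsp_def planted_mass_def[symmetric] by (intro pmf_embed_pmf) (auto simp: nonneg)
qed

lemma pmf_null:
  assumes p: "k \<le> n \<Longrightarrow> 0 < p \<and> p \<le> 1"
  shows "pmf (null_ocsp k p n) \<sigma> = (if \<sigma> \<in> samples n then \<Prod>S\<in>scopes k n. base p (\<sigma> S) else 0)"
proof -
  define q where "q S = bind_pmf (bernoulli_pmf p) (\<lambda>b.
    if b then map_pmf Some (pmf_of_set (permutations_of_set S)) else return_pmf None)" for S :: "nat set"
  have q: "pmf (q S) v = (if v \<in> ocsp_alphabet S then base p v else 0)" if S: "S \<in> scopes k n" for S v
  proof -
    have "k \<le> n" using S card_mono[of "{1..n}" S] by (auto simp: scopes_iff)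
    then have p01: "0 \<le> p" "p \<le> 1" using p by auto
    have fS: "finite S" "card S = k" using S finite_scope by (auto simp: scopes_iff)
    then have ne: "permutations_of_set S \<noteq> {}" by simp
    have "pmf (q S) v = p * pmf (map_pmf Some (pmf_of_set (permutations_of_set S))) v + (1 - p) * pmf (return_pmf None) v"
      using p01 by (simp add: q_def pmf_bind)
    also have "\<dots> = (if v \<in> ocsp_alphabet S then base p v else 0)"
    proof (cases v)
      case None
      have "pmf (map_pmf Some (pmf_of_set (permutations_of_set S))) None = 0"
        by (rule pmf_map_outside) auto
      then show ?thesis using None by (simp add: base_def ocsp_alphabet_def)
    next
      case (Some \<nu>)
      have "pmf (map_pmf Some (pmf_of_set (permutations_of_set S))) (Some \<nu>) = pmf (pmf_of_set (permutations_of_set S)) \<nu>"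
        by (rule pmf_map_inj') simp
      then show ?thesis using Some ne fS by (auto simp: base_def ocsp_alphabet_def indicator_def)
    qed
    finally show ?thesis .
  qed
  have "pmf (null_ocsp k p n) \<sigma> =
      (if \<forall>S. S \<notin> scopes k n \<longrightarrow> \<sigma> S = undefined then \<Prod>S\<in>scopes k n. pmf (q S) (\<sigma> S) else 0)"
    unfolding null_ocsp_def q_def[symmetric] by (rule pmf_Pi) simp
  also have "\<dots> = (if \<sigma> \<in> samples n then \<Prod>S\<in>scopes k n. base p (\<sigma> S) else 0)"
  proof (cases "\<sigma> \<in> samples n")
    case True
    then show ?thesis using samplesD[OF True] by (auto simp: q PiE_def extensional_def intro!: prod.cong)
  next
    case False
    then have "\<not> (\<forall>S. S \<notin> scopes k n \<longrightarrow> \<sigma> S = undefined) \<or> (\<exists>S\<in>scopes k n. \<sigma> S \<notin> ocsp_alphabet S)"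
      by (auto simp: PiE_def extensional_def Pi_def)
    then show ?thesis using False by (auto simp: q intro!: prod_zero)
  qed
  finally show ?thesis .
qed

end

section \<open>The low degree advantage\<close>

lemma expectation_finite_pmf:
  assumes "finite A" "\<And>\<sigma>. \<sigma> \<notin> A \<Longrightarrow> pmf M \<sigma> = 0"
  shows "measure_pmf.expectation M g = (\<Sum>\<sigma>\<in>A. pmf M \<sigma> * g \<sigma>)"
  using assms by (subst integral_measure_pmf[of A]) (auto simp: set_pmf_iff)

context ordering_predicate
begin

definition null_mean :: "real \<Rightarrow> nat \<Rightarrow> ((nat set \<Rightarrow> nat list option) \<Rightarrow> real) \<Rightarrow> real" where
  "null_mean p n g = (\<Sum>\<sigma>\<in>samples n. (\<Prod>S\<in>scopes k n. base p (\<sigma> S)) * g \<sigma>)"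

text \<open>Times (2 \<epsilon> / N)^(card A), this is the term R(A) of the likelihood ratio: the
  hidden point x is averaged out after the tilts have been multiplied.\<close>

definition tilt_mean :: "nat \<Rightarrow> nat set set \<Rightarrow> (nat set \<Rightarrow> nat list option) \<Rightarrow> real" where
  "tilt_mean n A \<sigma> = (\<integral>x. (\<Prod>S\<in>A. tilt x (\<sigma> S)) \<partial>unit_cube n)"

lemma null_mean_sum: "null_mean p n (\<lambda>\<sigma>. \<Sum>i\<in>I. c i * g i \<sigma>) = (\<Sum>i\<in>I. c i * null_mean p n (g i))"
proof -
  have "null_mean p n (\<lambda>\<sigma>. \<Sum>i\<in>I. c i * g i \<sigma>) =
      (\<Sum>\<sigma>\<in>samples n. \<Sum>i\<in>I. c i * ((\<Prod>S\<in>scopes k n. base p (\<sigma> S)) * g i \<sigma>))"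
    unfolding null_mean_def sum_distrib_left by (simp only: mult.left_commute)
  also have "\<dots> = (\<Sum>i\<in>I. \<Sum>\<sigma>\<in>samples n. c i * ((\<Prod>S\<in>scopes k n. base p (\<sigma> S)) * g i \<sigma>))"
    by (rule sum.swap)
  finally show ?thesis by (simp add: null_mean_def sum_distrib_left)
qed

lemma bounded_fun_tilt_prod:
  assumes "A \<subseteq> scopes k n" "\<And>S. S \<in> A \<Longrightarrow> \<sigma> S \<in> ocsp_alphabet S"
  shows "bounded_fun n (\<lambda>x. \<Prod>S\<in>A. tilt x (\<sigma> S))"
  using assms by (intro bounded_fun_prod bounded_fun_tilt) auto

text \<open>The average over the values at S can be taken inside the integral over x, where it kills
  the tilt of S at almost every x.\<close>

lemma sum_base_tilt_mean:
  assumes A: "A \<subseteq> scopes k n" "S \<in> A" and \<sigma>: "\<And>T. T \<in> A - {S} \<Longrightarrow> \<sigma> T \<in> ocsp_alphabet T"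
  shows "(\<Sum>v\<in>ocsp_alphabet S. base p v * tilt_mean n A (\<sigma>(S := v))) = 0"
proof -
  have fA: "finite A" using A(1) by (rule finite_subset) simp
  have S: "S \<in> scopes k n" using A by blast
  have bf: "bounded_fun n (\<lambda>x. \<Prod>T\<in>A - {S}. tilt x (\<sigma> T))"
    using A \<sigma> by (intro bounded_fun_tilt_prod) auto
  have split: "(\<Prod>T\<in>A. tilt x ((\<sigma>(S := v)) T)) = tilt x v * (\<Prod>T\<in>A - {S}. tilt x (\<sigma> T))" for x v
    using A(2) fA by (subst prod.remove[of A S]) (auto intro!: prod.cong)
  have "(\<Sum>v\<in>ocsp_alphabet S. base p v * tilt_mean n A (\<sigma>(S := v))) =
      (\<integral>x. (\<Sum>v\<in>ocsp_alphabet S. base p v * (tilt x v * (\<Prod>T\<in>A - {S}. tilt x (\<sigma> T)))) \<partial>unit_cube n)"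
    unfolding tilt_mean_def split
    by (subst Bochner_Integration.integral_sum)
       (auto intro!: bounded_fun_integrable bounded_fun_mult bf bounded_fun_tilt[OF S])
  also have "\<dots> = (\<integral>x. (\<Sum>v\<in>ocsp_alphabet S. base p v * tilt x v) * (\<Prod>T\<in>A - {S}. tilt x (\<sigma> T)) \<partial>unit_cube n)"
    unfolding sum_distrib_right by (simp only: mult.assoc)
  also have "\<dots> = 0"
    by (rule integral_eq_zero_AE) (use AE_unit_cube_inj[of n] in eventually_elim, simp add: sum_base_tilt[OF S])
  finally show ?thesis .
qed

text \<open>The mean over the value at S alone already vanishes, \<open>h\<close> being constant in
  it. This yields the orthogonality of distinct terms and also makes terms with more than D scopes
  invisible to functions of degree at most D.\<close>

lemma null_mean_tilt_mean_eq_0: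
  assumes A: "A \<subseteq> scopes k n" "S \<in> A" and h: "depends_on (scopes k n - {S}) h"
  shows "null_mean p n (\<lambda>\<sigma>. tilt_mean n A \<sigma> * h \<sigma>) = 0"
proof -
  let ?I = "scopes k n"
  have S: "S \<in> ?I" using A by blast
  have "(\<Sum>v\<in>ocsp_alphabet S. (\<Prod>T\<in>?I. base p ((\<sigma>(S := v)) T)) * (tilt_mean n A (\<sigma>(S := v)) * h (\<sigma>(S := v)))) = 0"
    if \<sigma>: "\<sigma> \<in> PiE (?I - {S}) ocsp_alphabet" for \<sigma>
  proof -
    have "(\<Prod>T\<in>?I. base p ((\<sigma>(S := v)) T)) = base p v * (\<Prod>T\<in>?I - {S}. base p (\<sigma> T))" for v
      using S by (subst prod.remove[of ?I S]) (auto intro!: prod.cong)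
    moreover have "h (\<sigma>(S := v)) = h \<sigma>" for v using h unfolding depends_on_def by simp
    ultimately have "(\<Sum>v\<in>ocsp_alphabet S. (\<Prod>T\<in>?I. base p ((\<sigma>(S := v)) T)) * (tilt_mean n A (\<sigma>(S := v)) * h (\<sigma>(S := v))))
        = (\<Sum>v\<in>ocsp_alphabet S. (base p v * tilt_mean n A (\<sigma>(S := v))) * ((\<Prod>T\<in>?I - {S}. base p (\<sigma> T)) * h \<sigma>))"
      by (simp add: mult_ac)
    also have "\<dots> = 0"
      unfolding sum_distrib_right[symmetric]
      using sum_base_tilt_mean[OF A, of \<sigma> p] PiE_mem[OF \<sigma>] A(1) by auto
    finally show ?thesis .
  qed
  then show ?thesis
    unfolding null_mean_def sum_PiE_fun_upd[OF finite_scopes S, of _ ocsp_alphabet]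
    by (rule sum.neutral[OF ballI])
qed

lemma planted_mass_expand:
  assumes "\<sigma> \<in> samples n"
  shows "planted_mass p \<epsilon> n \<sigma> =
    (\<Prod>S\<in>scopes k n. base p (\<sigma> S)) * (\<Sum>A\<in>Pow (scopes k n). (2 * \<epsilon> / N) ^ card A * tilt_mean n A \<sigma>)"
proof -
  let ?I = "scopes k n" and ?c = "2 * \<epsilon> / N"
  have "(\<Prod>S\<in>?I. planted_weight k P p \<epsilon> x (\<sigma> S)) =
      (\<Prod>S\<in>?I. base p (\<sigma> S)) * (\<Sum>A\<in>Pow ?I. ?c ^ card A * (\<Prod>S\<in>A. tilt x (\<sigma> S)))" for x
  proof -
    have "(\<Prod>S\<in>?I. planted_weight k P p \<epsilon> x (\<sigma> S)) = (\<Prod>S\<in>?I. base p (\<sigma> S)) * (\<Prod>S\<in>?I. ?c * tilt x (\<sigma> S) + 1)"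
      by (simp add: planted_weight_eq prod.distrib add.commute)
    also have "(\<Prod>S\<in>?I. ?c * tilt x (\<sigma> S) + 1) = (\<Sum>A\<in>Pow ?I. (\<Prod>S\<in>A. ?c * tilt x (\<sigma> S)) * (\<Prod>S\<in>?I - A. 1))"
      by (rule prod_add) simp
    finally show ?thesis by (simp only: prod.distrib prod_constant power_one mult_1_right)
  qed
  then have "planted_mass p \<epsilon> n \<sigma> = (\<Prod>S\<in>?I. base p (\<sigma> S)) *
      (\<integral>x. (\<Sum>A\<in>Pow ?I. ?c ^ card A * (\<Prod>S\<in>A. tilt x (\<sigma> S))) \<partial>unit_cube n)"
    by (simp add: planted_mass_def)
  also have "(\<integral>x. (\<Sum>A\<in>Pow ?I. ?c ^ card A * (\<Prod>S\<in>A. tilt x (\<sigma> S))) \<partial>unit_cube n) =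
      (\<Sum>A\<in>Pow ?I. \<integral>x. ?c ^ card A * (\<Prod>S\<in>A. tilt x (\<sigma> S)) \<partial>unit_cube n)"
    using samplesD[OF assms]
    by (intro Bochner_Integration.integral_sum bounded_fun_integrable bounded_fun_mult bounded_fun_const bounded_fun_tilt_prod) auto
  finally show ?thesis by (simp add: tilt_mean_def)
qed

lemma depends_on_tilt_mean: "depends_on A (tilt_mean n A)"
  unfolding depends_on_def tilt_mean_def by (auto intro!: Bochner_Integration.integral_cong prod.cong)

text \<open>If some v lies in exactly one of the sets V S, then coordinate v occurs in a single factor,
  which integrates to zero. Hence all points of the union are covered at least twice.\<close>

lemma concentrated_of_integral_nonzero:
  assumes A: "A \<subseteq> scopes k n"
    and \<nu>: "\<And>S. S \<in> A \<Longrightarrow> \<nu> S \<in> permutations_of_set S"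
    and u: "\<And>S. S \<in> A \<Longrightarrow> u S \<in> scopes d k"
    and nz: "(\<integral>x. (\<Prod>S\<in>A. efron_stein k f (u S) (pull (\<nu> S) x)) \<partial>unit_cube n) \<noteq> 0"
  shows "concentrated n d A"
proof -
  have fA: "finite A" using A by (rule finite_subset) simp
  \<comment> \<open>The variables on which the component chosen for the clause on S depends.\<close>
  define V where "V S = (\<lambda>i. \<nu> S ! (i - 1)) ` u S" for S
  let ?e = "\<lambda>S x. efron_stein k f (u S) (pull (\<nu> S) x)"
  have uk: "u S \<subseteq> {1..k}" "card (u S) = d" if "S \<in> A" for S using u[OF that] by (auto simp: scopes_def)
  have Sn: "S \<in> scopes k n" if "S \<in> A" for S using A that by blast
  have V: "V S \<subseteq> S" "card (V S) = d" if "S \<in> A" for S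
  proof -
    note o = ordering_of_scope[OF Sn[OF that] \<nu>[OF that]]
    show "V S \<subseteq> S" using image_mono[OF uk(1)[OF that], of "\<lambda>i. \<nu> S ! (i - 1)"] unfolding V_def o(2) .
    show "card (V S) = d" unfolding V_def using uk(2)[OF that] inj_on_subset[OF o(1) uk(1)[OF that]] by (simp add: card_image)
  qed
  have fV: "finite (V S)" if "S \<in> A" for S using V(1)[OF that] finite_scope[OF Sn[OF that]] by (rule finite_subset)
  have dep: "depends_on (V S) (?e S)" if "S \<in> A" for S
    unfolding depends_on_def
  proof (intro allI impI)
    fix x x' :: "nat \<Rightarrow> real" assume *: "\<forall>v\<in>V S. x v = x' v"
    have "\<forall>i\<in>u S. pull (\<nu> S) x i = pull (\<nu> S) x' i"
      using * uk(1)[OF that] by (auto simp: pull_def V_def)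
    then show "?e S x = ?e S x'" using depends_on_efron_stein[of "u S" k f] by (simp add: depends_on_def)
  qed
  have bf: "bounded_fun n (?e S)" if "S \<in> A" for S
    by (rule bounded_fun_pull[OF Sn[OF that] \<nu>[OF that]]) auto
  have twice: "2 \<le> card {S \<in> A. v \<in> V S}" if v: "v \<in> (\<Union>S\<in>A. V S)" for v
  proof (rule ccontr)
    obtain S where S: "S \<in> A" "v \<in> V S" using v by blast
    assume "\<not> 2 \<le> card {S \<in> A. v \<in> V S}"
    then have "card {S \<in> A. v \<in> V S} \<le> Suc 0" by simp
    then have only: "v \<notin> V T" if "T \<in> A" "T \<noteq> S" for T
      using S that fA by (auto simp: card_le_Suc0_iff_eq)
    note o = ordering_of_scope[OF Sn[OF S(1)] \<nu>[OF S(1)]]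
    obtain i where i: "i \<in> u S" "v = \<nu> S ! (i - 1)" using S(2) by (auto simp: V_def)
    have ik: "i \<in> {1..k}" using i(1) uk(1)[OF S(1)] by blast
    have "(\<integral>x. ?e S x * (\<Prod>T\<in>A - {S}. ?e T x) \<partial>unit_cube n) = 0"
    proof (rule integral_mult_eq_0[of _ _ _ v])
      show "bounded_fun n (?e S)" by (rule bf[OF S(1)])
      show "bounded_fun n (\<lambda>x. \<Prod>T\<in>A - {S}. ?e T x)" using bf by (intro bounded_fun_prod) auto
      show "depends_on ({1..n} - {v}) (\<lambda>x. \<Prod>T\<in>A - {S}. ?e T x)"
        unfolding depends_on_def
      proof (intro allI impI prod.cong refl)
        fix x x' :: "nat \<Rightarrow> real" and T assume *: "\<forall>i\<in>{1..n} - {v}. x i = x' i" and T: "T \<in> A - {S}"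
        then have "V T \<subseteq> {1..n} - {v}" using V(1)[of T] only[of T] Sn[of T] unfolding scopes_iff by blast
        then show "?e T x = ?e T x'" using * dep[of T] T unfolding depends_on_def by blast
      qed
      fix x
      \<comment> \<open>As a clause lists distinct variables, averaging out the variable v averages
        out exactly the position i of the component.\<close>
      have "{j \<in> {1..k}. \<nu> S ! (j - 1) \<in> {1..n} - {v}} = {1..k} - {i}"
      proof -
        have "\<nu> S ! (j - 1) \<in> {1..n}" if "j \<in> {1..k}" for j using o(2,3) that by blast
        moreover have "\<nu> S ! (j - 1) = v \<longleftrightarrow> j = i" if "j \<in> {1..k}" for j
          using inj_on_eq_iff[OF o(1) that ik] i(2) by simp
        ultimately show ?thesis by blast
      qed
      then show "cond_mean n (?e S) ({1..n} - {v}) x = 0"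
        unfolding pull_def
        by (subst cond_mean_reindex)
           (use o ik i(1) uk(1)[OF S(1)] cond_mean_efron_stein in auto)
    qed
    moreover have "(\<Prod>T\<in>A. ?e T x) = ?e S x * (\<Prod>T\<in>A - {S}. ?e T x)" for x
      using fA S(1) by (rule prod.remove)
    ultimately show False using nz by simp
  qed
  let ?V = "\<Union>S\<in>A. V S"
  have "?V \<subseteq> {1..n}" using V(1) Sn unfolding scopes_iff by blast
  moreover have "2 * card ?V \<le> d * card A"
  proof -
    have "2 * card ?V = (\<Sum>v\<in>?V. 2)" by simp
    also have "\<dots> \<le> (\<Sum>v\<in>?V. card {S \<in> A. v \<in> V S})" using twice by (rule sum_mono)
    \<comment> \<open>Incidences between variables and scopes, counted by scopes.\<close>
    also have "\<dots> = d * card A"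
    proof (rule sum_multicount[of ?V A "\<lambda>v S. v \<in> V S"])
      show "\<forall>S\<in>A. card {v \<in> ?V. v \<in> V S} = d"
      proof
        fix S assume S: "S \<in> A"
        then have "{v \<in> ?V. v \<in> V S} = V S" by blast
        then show "card {v \<in> ?V. v \<in> V S} = d" using V(2)[OF S] by simp
      qed
    qed (use fA fV in auto)
    finally show ?thesis .
  qed
  moreover have "d \<le> card (S \<inter> ?V)" if "S \<in> A" for S
  proof -
    have "V S \<subseteq> S \<inter> ?V" using V(1)[OF that] that by blast
    then have "card (V S) \<le> card (S \<inter> ?V)" using finite_scope[OF Sn[OF that]] by (intro card_mono) auto
    then show ?thesis using V(2)[OF that] by simp
  qed
  ultimately show ?thesis unfolding concentrated_def by blast
qed

text \<open>A missing scope makes a factor zero. Otherwise each tilt is a sum of components on d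
  positions; multiplying out, some choice of components has a nonzero integral, and its variables
  form a double cover.\<close>

lemma tilt_mean_nonzero:
  assumes A: "A \<subseteq> scopes k n" and \<sigma>: "\<sigma> \<in> samples n" and nz: "tilt_mean n A \<sigma> \<noteq> 0"
  shows "\<forall>S\<in>A. \<sigma> S \<noteq> None" "concentrated n d A"
proof -
  have fA: "finite A" using A by (rule finite_subset) simp
  show *: "\<forall>S\<in>A. \<sigma> S \<noteq> None"
  proof (rule ccontr)
    assume "\<not> ?thesis"
    then obtain S where "S \<in> A" "\<sigma> S = None" by blast
    then have "(\<Prod>S\<in>A. tilt x (\<sigma> S)) = 0" for x
      using fA by (intro prod_zero) (auto simp: tilt_def intro!: bexI[of _ S])
    then show False using nz by (simp add: tilt_mean_def)
  qed
  define \<nu> where "\<nu> S = the (\<sigma> S)" for S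
  have \<nu>: "\<nu> S \<in> permutations_of_set S" "\<sigma> S = Some (\<nu> S)" if "S \<in> A" for S
  proof -
    have "\<sigma> S \<in> ocsp_alphabet S" using samplesD[OF \<sigma>] A that by blast
    then show "\<nu> S \<in> permutations_of_set S" "\<sigma> S = Some (\<nu> S)"
      using * that by (auto simp: \<nu>_def ocsp_alphabet_def)
  qed
  let ?E = "\<lambda>u x. \<Prod>S\<in>A. efron_stein k f (u S) (pull (\<nu> S) x)"
  have "(\<Prod>S\<in>A. tilt x (\<sigma> S)) = (\<Sum>u\<in>PiE A (\<lambda>_. scopes d k). ?E u x)" for x
  proof -
    have "(\<Prod>S\<in>A. tilt x (\<sigma> S)) = (\<Prod>S\<in>A. \<Sum>U\<in>scopes d k. efron_stein k f U (pull (\<nu> S) x))"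
      using \<nu>(2) by (intro prod.cong) (auto simp: tilt_def top_part_def degree_part_def)
    also have "\<dots> = (\<Sum>u\<in>PiE A (\<lambda>_. scopes d k). ?E u x)" using fA by (rule prod_sum_PiE) simp
    finally show ?thesis .
  qed
  then have "tilt_mean n A \<sigma> = (\<Sum>u\<in>PiE A (\<lambda>_. scopes d k). \<integral>x. ?E u x \<partial>unit_cube n)"
    unfolding tilt_mean_def using A \<nu>(1)
    by (simp only:) (intro Bochner_Integration.integral_sum bounded_fun_integrable bounded_fun_prod bounded_fun_pull; auto)
  then obtain u where u: "u \<in> PiE A (\<lambda>_. scopes d k)" "(\<integral>x. ?E u x \<partial>unit_cube n) \<noteq> 0"
    using nz by (metis (no_types, lifting) sum.neutral)
  show "concentrated n d A"
    by (rule concentrated_of_integral_nonzero[OF A \<nu>(1) _ u(2)]) (use PiE_mem[OF u(1)] in auto)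
qed

lemma tilt_mean_abs_le:
  assumes "A \<subseteq> scopes k n" "\<sigma> \<in> samples n"
  shows "\<bar>tilt_mean n A \<sigma>\<bar> \<le> (4 ^ k) ^ card A"
proof -
  interpret prob_space "unit_cube n" by (rule prob_space_unit_cube)
  have i: "integrable (unit_cube n) (\<lambda>x. \<Prod>S\<in>A. tilt x (\<sigma> S))"
  proof (intro bounded_fun_integrable bounded_fun_tilt_prod assms(1))
    show "\<sigma> S \<in> ocsp_alphabet S" if "S \<in> A" for S using samplesD[OF assms(2)] assms(1) that by blast
  qed
  have le: "\<bar>\<Prod>S\<in>A. tilt x (\<sigma> S)\<bar> \<le> (4 ^ k) ^ card A" for x
  proof -
    have "(\<Prod>S\<in>A. \<bar>tilt x (\<sigma> S)\<bar>) \<le> (\<Prod>S\<in>A. 4 ^ k)"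
      using tilt_abs_le by (intro prod_mono) auto
    then show ?thesis by (simp add: abs_prod)
  qed
  have "\<bar>tilt_mean n A \<sigma>\<bar> \<le> (\<integral>x. \<bar>\<Prod>S\<in>A. tilt x (\<sigma> S)\<bar> \<partial>unit_cube n)"
    unfolding tilt_mean_def by (rule integral_abs_bound)
  also have "\<dots> \<le> (4 ^ k) ^ card A"
    using i le by (intro integral_le_const integrable_abs AE_I2)
  finally show ?thesis .
qed

text \<open>Where the term is nonzero all scopes of A are included, an event of null probability
  p^(card A), and its square is at most 16^(k card A). The supremum bound alone would lose the
  powers of p.\<close>

lemma null_mean_square_tilt_mean_le:
  assumes A: "A \<subseteq> scopes k n" and p: "0 \<le> p" "p \<le> 1"
  shows "null_mean p n (\<lambda>\<sigma>. (tilt_mean n A \<sigma>)\<^sup>2) \<le> (if concentrated n d A then (p * 16 ^ k) ^ card A else 0)"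
proof -
  let ?I = "scopes k n"
  define inc :: "nat list option \<Rightarrow> real" where "inc v = of_bool (v \<noteq> None)" for v
  have fA: "finite A" using A by (rule finite_subset) simp
  have base_nonneg: "0 \<le> base p v" for v using p by (simp add: base_def split: option.splits)
  have le: "(tilt_mean n A \<sigma>)\<^sup>2 \<le> of_bool (concentrated n d A) * (16 ^ k) ^ card A * (\<Prod>S\<in>A. inc (\<sigma> S))"
    if \<sigma>: "\<sigma> \<in> samples n" for \<sigma>
  proof (cases "tilt_mean n A \<sigma> = 0")
    case True
    then show ?thesis by (simp add: inc_def prod_nonneg)
  next
    case False
    note nz = tilt_mean_nonzero[OF A \<sigma> False]
    have "(tilt_mean n A \<sigma>)\<^sup>2 \<le> ((4 ^ k) ^ card A)\<^sup>2"
      using tilt_mean_abs_le[OF A \<sigma>] by (rule power2_le_iff_abs_le[THEN iffD2, rotated]) simp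
    also have "\<dots> = (16 ^ k) ^ card A" by (simp add: power_mult[symmetric] mult.commute power_mult[of _ 2, symmetric] flip: power_mult_distrib) (simp add: power_mult power2_eq_square)
    finally show ?thesis using nz by (simp add: inc_def)
  qed
  have "null_mean p n (\<lambda>\<sigma>. (tilt_mean n A \<sigma>)\<^sup>2) \<le>
      (\<Sum>\<sigma>\<in>samples n. (\<Prod>S\<in>?I. base p (\<sigma> S)) * (of_bool (concentrated n d A) * (16 ^ k) ^ card A * (\<Prod>S\<in>A. inc (\<sigma> S))))"
    unfolding null_mean_def using le base_nonneg by (intro sum_mono mult_left_mono prod_nonneg) auto
  also have "\<dots> = of_bool (concentrated n d A) * (16 ^ k) ^ card A *
      (\<Sum>\<sigma>\<in>samples n. (\<Prod>S\<in>?I. base p (\<sigma> S)) * (\<Prod>S\<in>A. inc (\<sigma> S)))"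
    by (simp add: sum_distrib_left mult_ac)
  also have "(\<Sum>\<sigma>\<in>samples n. (\<Prod>S\<in>?I. base p (\<sigma> S)) * (\<Prod>S\<in>A. inc (\<sigma> S))) =
      (\<Prod>S\<in>A. \<Sum>v\<in>ocsp_alphabet S. base p v * inc v)"
    using sum_base A by (intro sum_PiE_prod_subset) auto
  also have "\<dots> = (\<Prod>S\<in>A. p)"
  proof (intro prod.cong refl)
    fix S assume "S \<in> A"
    then have "S \<in> ?I" using A by blast
    then have "finite S" "card S = k" using finite_scope by (auto simp: scopes_iff)
    then show "(\<Sum>v\<in>ocsp_alphabet S. base p v * inc v) = p"
      by (simp add: sum_ocsp_alphabet base_def inc_def)
  qed
  finally show ?thesis by (auto simp: power_mult_distrib mult_ac)
qed

lemma expectation_null: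
  assumes "k \<le> n \<Longrightarrow> 0 < p \<and> p \<le> 1"
  shows "measure_pmf.expectation (null_ocsp k p n) g = null_mean p n g"
  by (subst expectation_finite_pmf[of "samples n"]) (simp_all add: pmf_null[OF assms] null_mean_def)

lemma expectation_planted:
  assumes "k \<le> n \<Longrightarrow> 0 < p \<and> p \<le> 1 \<and> 0 < \<epsilon> \<and> \<epsilon> \<le> 1 / (2 ^ (2 * k + 1) * fact (2 * k))"
  shows "measure_pmf.expectation (planted_ocsp k P p \<epsilon> n) g = (\<Sum>\<sigma>\<in>samples n. planted_mass p \<epsilon> n \<sigma> * g \<sigma>)"
  by (subst expectation_finite_pmf[of "samples n"]) (simp_all add: pmf_planted[OF assms])

text \<open>The planted mean of \<open>g\<close> is the null mean of \<open>g\<close> times the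
  likelihood ratio, of which \<open>g\<close> sees only the truncation \<open>\<Lambda>\<close>. The
  inequality u v \<le> (u^2 + v^2)/2 replaces Cauchy-Schwarz and avoids square roots; orthogonality
  evaluates the mean square of \<open>\<Lambda>\<close>.\<close>

lemma expectation_planted_le:
  assumes params: "0 < p" "p \<le> 1" "0 < \<epsilon>" "\<epsilon> \<le> 1 / (2 ^ (2 * k + 1) * fact (2 * k))"
    and g: "g \<in> low_coordinate_degree (scopes k n) D" and g2: "null_mean p n (\<lambda>\<sigma>. (g \<sigma>)\<^sup>2) \<le> 1"
  shows "measure_pmf.expectation (planted_ocsp k P p \<epsilon> n) g \<le>
    (1 + (\<Sum>A | A \<subseteq> scopes k n \<and> card A \<le> D \<and> concentrated n d A. ((2 * \<epsilon> / N)\<^sup>2 * p * 16 ^ k) ^ card A)) / 2"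
proof -
  let ?I = "scopes k n" and ?c = "2 * \<epsilon> / N"
  let ?\<A> = "{A. A \<subseteq> ?I \<and> card A \<le> D}"
  have fin: "finite ?\<A>" by (rule finite_subset[of _ "Pow ?I"]) auto
  define \<Lambda> where "\<Lambda> \<sigma> = (\<Sum>A\<in>?\<A>. ?c ^ card A * tilt_mean n A \<sigma>)" for \<sigma>
  obtain F c where F: "finite F" "\<forall>h\<in>F. \<exists>J\<subseteq>?I. finite J \<and> card J \<le> D \<and> depends_on J h"
    and g_eq: "g = (\<lambda>\<sigma>. \<Sum>h\<in>F. c h * h \<sigma>)"
    using g unfolding low_coordinate_degree_def by auto
  have high: "null_mean p n (\<lambda>\<sigma>. tilt_mean n A \<sigma> * g \<sigma>) = 0" if A: "A \<subseteq> ?I" "\<not> card A \<le> D" for A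
  proof -
    have "null_mean p n (\<lambda>\<sigma>. tilt_mean n A \<sigma> * h \<sigma>) = 0" if "h \<in> F" for h
    proof -
      from bspec[OF F(2) that] obtain J where J: "J \<subseteq> ?I" "finite J" "card J \<le> D" "depends_on J h"
        by (elim exE conjE)
      \<comment> \<open>More than D scopes do not fit into the at most D coordinates read by
        \<open>h\<close>.\<close>
      have "\<not> A \<subseteq> J" using card_mono[OF J(2), of A] J(3) A(2) by linarith
      then obtain S where "S \<in> A" "S \<notin> J" by blast
      then show ?thesis
        using J by (intro null_mean_tilt_mean_eq_0[OF A(1)] depends_on_mono[OF J(4)]) auto
    qed
    moreover have "(\<lambda>\<sigma>. tilt_mean n A \<sigma> * g \<sigma>) = (\<lambda>\<sigma>. \<Sum>h\<in>F. c h * (tilt_mean n A \<sigma> * h \<sigma>))"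
      by (simp add: g_eq sum_distrib_left mult_ac)
    ultimately show ?thesis by (simp only: null_mean_sum) simp
  qed
  have "measure_pmf.expectation (planted_ocsp k P p \<epsilon> n) g = (\<Sum>\<sigma>\<in>samples n. planted_mass p \<epsilon> n \<sigma> * g \<sigma>)"
    by (rule expectation_planted) (use params in auto)
  also have "\<dots> = null_mean p n (\<lambda>\<sigma>. \<Sum>A\<in>Pow ?I. ?c ^ card A * (tilt_mean n A \<sigma> * g \<sigma>))"
    unfolding null_mean_def
    by (intro sum.cong refl, subst planted_mass_expand) (simp_all add: sum_distrib_right sum_distrib_left mult_ac)
  also have "\<dots> = (\<Sum>A\<in>Pow ?I. ?c ^ card A * null_mean p n (\<lambda>\<sigma>. tilt_mean n A \<sigma> * g \<sigma>))"
    by (rule null_mean_sum)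
  also have "\<dots> = (\<Sum>A\<in>?\<A>. ?c ^ card A * null_mean p n (\<lambda>\<sigma>. tilt_mean n A \<sigma> * g \<sigma>))"
    using high by (intro sum.mono_neutral_right) auto
  also have "\<dots> = null_mean p n (\<lambda>\<sigma>. \<Lambda> \<sigma> * g \<sigma>)"
    unfolding null_mean_sum[symmetric] \<Lambda>_def sum_distrib_right by (simp only: mult.assoc)
  also have "\<dots> \<le> null_mean p n (\<lambda>\<sigma>. ((g \<sigma>)\<^sup>2 + (\<Lambda> \<sigma>)\<^sup>2) / 2)"
    unfolding null_mean_def
  proof (intro sum_mono mult_left_mono prod_nonneg)
    fix \<sigma>
    show "\<Lambda> \<sigma> * g \<sigma> \<le> ((g \<sigma>)\<^sup>2 + (\<Lambda> \<sigma>)\<^sup>2) / 2"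
      using zero_le_power2[of "g \<sigma> - \<Lambda> \<sigma>"] by (simp add: power2_diff algebra_simps)
    show "0 \<le> base p (\<sigma> S)" for S using params by (simp add: base_def split: option.splits)
  qed
  also have "\<dots> = (null_mean p n (\<lambda>\<sigma>. (g \<sigma>)\<^sup>2) + null_mean p n (\<lambda>\<sigma>. (\<Lambda> \<sigma>)\<^sup>2)) / 2"
    by (simp add: null_mean_def sum_divide_distrib sum.distrib[symmetric] algebra_simps add_divide_distrib)
  also have "null_mean p n (\<lambda>\<sigma>. (\<Lambda> \<sigma>)\<^sup>2) \<le>
      (\<Sum>A | A \<subseteq> scopes k n \<and> card A \<le> D \<and> concentrated n d A. (?c\<^sup>2 * p * 16 ^ k) ^ card A)"
  proof -
    have orth: "null_mean p n (\<lambda>\<sigma>. tilt_mean n A \<sigma> * tilt_mean n B \<sigma>) =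
        (if A = B then null_mean p n (\<lambda>\<sigma>. (tilt_mean n A \<sigma>)\<^sup>2) else 0)" if "A \<subseteq> ?I" "B \<subseteq> ?I" for A B
    proof (cases "A = B")
      case False
      then consider S where "S \<in> A" "S \<notin> B" | S where "S \<in> B" "S \<notin> A" by blast
      then have "null_mean p n (\<lambda>\<sigma>. tilt_mean n A \<sigma> * tilt_mean n B \<sigma>) = 0"
      proof cases
        case 1
        then show ?thesis using that
          by (intro null_mean_tilt_mean_eq_0 depends_on_mono[OF depends_on_tilt_mean]) auto
      next
        case 2
        then have "null_mean p n (\<lambda>\<sigma>. tilt_mean n B \<sigma> * tilt_mean n A \<sigma>) = 0" using that
          by (intro null_mean_tilt_mean_eq_0 depends_on_mono[OF depends_on_tilt_mean]) auto
        then show ?thesis by (simp add: mult.commute)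
      qed
      then show ?thesis using False by simp
    qed (simp add: power2_eq_square)
    have "(\<lambda>\<sigma>. (\<Lambda> \<sigma>)\<^sup>2) = (\<lambda>\<sigma>. \<Sum>A\<in>?\<A>. ?c ^ card A * (\<Sum>B\<in>?\<A>. ?c ^ card B * (tilt_mean n A \<sigma> * tilt_mean n B \<sigma>)))"
      by (simp add: \<Lambda>_def power2_eq_square sum_product sum_distrib_left mult_ac)
    then have "null_mean p n (\<lambda>\<sigma>. (\<Lambda> \<sigma>)\<^sup>2) =
        (\<Sum>A\<in>?\<A>. ?c ^ card A * (\<Sum>B\<in>?\<A>. ?c ^ card B * null_mean p n (\<lambda>\<sigma>. tilt_mean n A \<sigma> * tilt_mean n B \<sigma>)))"
      by (simp only: null_mean_sum)
    also have "\<dots> = (\<Sum>A\<in>?\<A>. ?c ^ card A * (?c ^ card A * null_mean p n (\<lambda>\<sigma>. (tilt_mean n A \<sigma>)\<^sup>2)))"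
    proof (intro sum.cong refl arg_cong2[of _ _ _ _ "(*)"])
      fix A assume A: "A \<in> ?\<A>"
      then have "(\<Sum>B\<in>?\<A>. ?c ^ card B * null_mean p n (\<lambda>\<sigma>. tilt_mean n A \<sigma> * tilt_mean n B \<sigma>)) =
          (\<Sum>B\<in>?\<A>. if B = A then ?c ^ card A * null_mean p n (\<lambda>\<sigma>. (tilt_mean n A \<sigma>)\<^sup>2) else 0)"
        by (intro sum.cong refl) (auto simp: orth)
      then show "(\<Sum>B\<in>?\<A>. ?c ^ card B * null_mean p n (\<lambda>\<sigma>. tilt_mean n A \<sigma> * tilt_mean n B \<sigma>)) =
          ?c ^ card A * null_mean p n (\<lambda>\<sigma>. (tilt_mean n A \<sigma>)\<^sup>2)"
        using fin A by (simp add: sum.delta)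
    qed
    also have "\<dots> \<le> (\<Sum>A\<in>?\<A>. if concentrated n d A then (?c\<^sup>2 * p * 16 ^ k) ^ card A else 0)"
    proof (intro sum_mono)
      fix A assume "A \<in> ?\<A>"
      then have "null_mean p n (\<lambda>\<sigma>. (tilt_mean n A \<sigma>)\<^sup>2) \<le> (if concentrated n d A then (p * 16 ^ k) ^ card A else 0)"
        using params by (intro null_mean_square_tilt_mean_le) auto
      then have "(?c\<^sup>2) ^ card A * null_mean p n (\<lambda>\<sigma>. (tilt_mean n A \<sigma>)\<^sup>2) \<le>
          (?c\<^sup>2) ^ card A * (if concentrated n d A then (p * 16 ^ k) ^ card A else 0)"
        by (intro mult_left_mono) auto
      also have "\<dots> = (if concentrated n d A then (?c\<^sup>2 * p * 16 ^ k) ^ card A else 0)"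
        by (simp add: power_mult_distrib mult_ac)
      also have "(?c\<^sup>2) ^ card A * null_mean p n (\<lambda>\<sigma>. (tilt_mean n A \<sigma>)\<^sup>2) =
          ?c ^ card A * (?c ^ card A * null_mean p n (\<lambda>\<sigma>. (tilt_mean n A \<sigma>)\<^sup>2))"
        by (simp only: power2_eq_square power_mult_distrib mult.assoc)
      finally show "?c ^ card A * (?c ^ card A * null_mean p n (\<lambda>\<sigma>. (tilt_mean n A \<sigma>)\<^sup>2)) \<le>
          (if concentrated n d A then (?c\<^sup>2 * p * 16 ^ k) ^ card A else 0)" .
    qed
    also have "\<dots> = (\<Sum>A | A \<subseteq> ?I \<and> card A \<le> D \<and> concentrated n d A. (?c\<^sup>2 * p * 16 ^ k) ^ card A)"
      using fin by (intro sum.mono_neutral_cong_right) auto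
    finally show ?thesis .
  qed
  finally show ?thesis using g2 by simp
qed

text \<open>Grouping by size, level a contributes at most (y \<open>?B\<close>)^a \<le> 2^(-a),
  because the base of the count does not depend on a; the empty set accounts for level zero.\<close>

lemma sum_concentrated_le:
  assumes y: "0 \<le> y" and D: "k * D \<le> n"
    and small: "y * (exp (real d / 2 + 1) * (real d / 2) powr (real d / 2) * real n ^ k / real n *
      (real D / real n) powr (real d / 2 - 1)) \<le> 1 / 2" (is "y * ?B \<le> _")
  shows "(\<Sum>A | A \<subseteq> scopes k n \<and> card A \<le> D \<and> concentrated n d A. y ^ card A) \<le> 2"
proof -
  let ?\<A> = "{A. A \<subseteq> scopes k n \<and> card A \<le> D \<and> concentrated n d A}"
  let ?\<B> = "\<lambda>a. {A. A \<subseteq> scopes k n \<and> card A = a \<and> concentrated n d A}"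
  have fin: "finite ?\<A>" by (rule finite_subset[of _ "Pow (scopes k n)"]) auto
  have "(\<Sum>A\<in>?\<A>. y ^ card A) = (\<Sum>a\<in>{..D}. \<Sum>A\<in>{A \<in> ?\<A>. card A = a}. y ^ card A)"
    using fin by (intro sum.group[symmetric]) auto
  also have "\<dots> = (\<Sum>a\<in>{..D}. real (card (?\<B> a)) * y ^ a)"
  proof (intro sum.cong refl)
    fix a assume "a \<in> {..D}"
    then have "{A \<in> ?\<A>. card A = a} = ?\<B> a" by auto
    then have "(\<Sum>A\<in>{A \<in> ?\<A>. card A = a}. y ^ card A) = (\<Sum>A\<in>?\<B> a. y ^ a)" by (intro sum.cong) auto
    then show "(\<Sum>A\<in>{A \<in> ?\<A>. card A = a}. y ^ card A) = real (card (?\<B> a)) * y ^ a" by simp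
  qed
  also have "\<dots> \<le> (\<Sum>a\<in>{..D}. (1 / 2) ^ a)"
  proof (intro sum_mono)
    fix a assume a: "a \<in> {..D}"
    have "real (card (?\<B> a)) \<le> ?B ^ a"
    proof (cases "a = 0")
      case True
      have "?\<B> a \<subseteq> {{}}" using True finite_subset[OF _ finite_scopes[of k n]] by auto
      then have "card (?\<B> a) \<le> card {{} :: nat set set}" by (rule card_mono[rotated]) simp
      then show ?thesis using True by simp
    next
      case False
      then show ?thesis using d_bounds a D by (intro card_concentrated_le) auto
    qed
    then have "real (card (?\<B> a)) * y ^ a \<le> ?B ^ a * y ^ a" using y by (intro mult_right_mono) auto
    also have "\<dots> = (y * ?B) ^ a" by (simp only: power_mult_distrib mult.commute)
    also have "\<dots> \<le> (1 / 2) ^ a" using small y by (intro power_mono) auto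
    finally show "real (card (?\<B> a)) * y ^ a \<le> (1 / 2) ^ a" .
  qed
  also have "\<dots> \<le> (\<Sum>a. (1 / 2 :: real) ^ a)" by (intro sum_le_suminf) (auto intro: summable_geometric)
  also have "\<dots> = 2" by (subst suminf_geometric) auto
  finally show ?thesis .
qed

end

section \<open>The value of planted instances\<close>

lemma sum_list_map_filter:
  "sum_list (map g (List.map_filter h L)) = (\<Sum>xs\<leftarrow>L. case h xs of None \<Rightarrow> 0 | Some v \<Rightarrow> g v)"
  by (induction L) (auto simp: map_filter_simps split: option.splits)

lemma distinct_map_filter_image:
  assumes "distinct (map F L)" "\<And>xs v. xs \<in> set L \<Longrightarrow> h xs = Some v \<Longrightarrow> G v = F xs"
  shows "distinct (map G (List.map_filter h L)) \<and> set (map G (List.map_filter h L)) \<subseteq> F ` set L"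
  using assms
proof (induction L)
  case (Cons a L)
  then have "distinct (map G (List.map_filter h L)) \<and> set (map G (List.map_filter h L)) \<subseteq> F ` set L" by simp
  then show ?case using Cons.prems(1) Cons.prems(2)[of a] by (auto simp: map_filter_simps split: option.splits)
qed (simp add: map_filter_simps)

lemma set_map_filter_iff: "v \<in> set (List.map_filter h L) \<longleftrightarrow> (\<exists>xs\<in>set L. h xs = Some v)"
  by (induction L) (auto simp: map_filter_simps split: option.splits)

section \<open>Counting intersecting scopes\<close>

lemma card_scopes_containing:
  assumes "i \<in> {1..n}" "1 \<le> k"
  shows "n * card {T \<in> scopes k n. i \<in> T} = k * (n choose k)"
proof -
  have "bij_betw (insert i) {T. T \<subseteq> {1..n} - {i} \<and> card T = k - 1} {T \<in> scopes k n. i \<in> T}"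
  proof (rule bij_betw_byWitness[of _ "\<lambda>T. T - {i}"])
    have "card (insert i T) = k" "finite T" if "T \<subseteq> {1..n} - {i}" "card T = k - 1" for T
    proof -
      show "finite T" using that(1) by (rule finite_subset) simp
      then show "card (insert i T) = k" using that assms(2) by (subst card_insert_disjoint) auto
    qed
    then show "insert i ` {T. T \<subseteq> {1..n} - {i} \<and> card T = k - 1} \<subseteq> {T \<in> scopes k n. i \<in> T}"
      using assms(1) by (auto simp: scopes_def)
    show "(\<lambda>T. T - {i}) ` {T \<in> scopes k n. i \<in> T} \<subseteq> {T. T \<subseteq> {1..n} - {i} \<and> card T = k - 1}"
    proof clarify
      fix T assume "T \<in> scopes k n" "i \<in> T"
      then show "T - {i} \<subseteq> {1..n} - {i} \<and> card (T - {i}) = k - 1"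
        by (auto simp: scopes_def card_Diff_singleton)
    qed
  qed auto
  then have "card {T \<in> scopes k n. i \<in> T} = card {T. T \<subseteq> {1..n} - {i} \<and> card T = k - 1}"
    by (rule bij_betw_same_card[symmetric])
  also have "\<dots> = (n - 1) choose (k - 1)" using assms(1) by (subst n_subsets) auto
  finally show ?thesis using times_binomial_minus1_eq[of k n] assms(2) by simp
qed

text \<open>A scope meeting S contains one of its k points, and each point lies in the fraction k/n
  of all scopes.\<close>

lemma card_intersecting_scopes_le:
  assumes "1 \<le> k" "S \<in> scopes k n" "1 \<le> n"
  shows "real (card {T \<in> scopes k n. S \<inter> T \<noteq> {}}) \<le> (real k)\<^sup>2 * real (n choose k) / real n"
proof -
  have fS: "finite S" "card S = k" using assms finite_scope by (auto simp: scopes_iff)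
  have "{T \<in> scopes k n. S \<inter> T \<noteq> {}} = (\<Union>i\<in>S. {T \<in> scopes k n. i \<in> T})" by blast
  then have "card {T \<in> scopes k n. S \<inter> T \<noteq> {}} \<le> (\<Sum>i\<in>S. card {T \<in> scopes k n. i \<in> T})"
    using card_UN_le[OF fS(1)] by simp
  then have "n * card {T \<in> scopes k n. S \<inter> T \<noteq> {}} \<le> (\<Sum>i\<in>S. n * card {T \<in> scopes k n. i \<in> T})"
    unfolding sum_distrib_left[symmetric] by simp
  also have "\<dots> = (\<Sum>i\<in>S. k * (n choose k))"
  proof (intro sum.cong refl card_scopes_containing assms(1))
    show "i \<in> {1..n}" if "i \<in> S" for i using that assms(2) unfolding scopes_iff by blast
  qed
  also have "\<dots> = k * (k * (n choose k))" using fS by simp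
  finally have "real (n * card {T \<in> scopes k n. S \<inter> T \<noteq> {}}) \<le> real (k * (k * (n choose k)))"
    by (simp only: of_nat_le_iff)
  then show ?thesis using assms(3) by (simp add: field_simps power2_eq_square)
qed

context ordering_predicate
begin

abbreviation scope_lists :: "nat \<Rightarrow> nat list list" where
  "scope_lists n \<equiv> filter (\<lambda>xs. length xs = k) (List.subseqs [1..<Suc n])"

lemma scope_lists: "distinct (map set (scope_lists n))" "set ` set (scope_lists n) = scopes k n"
proof -
  show "distinct (map set (scope_lists n))"
    by (rule distinct_map_filter) (rule distinct_set_subseqs, simp)
  have len: "length xs = card (set xs)" if "xs \<in> set (List.subseqs [1..<Suc n])" for xs
    using subseqs_distinctD[OF that] by (simp add: distinct_card)
  have "set ` set (scope_lists n) = {S \<in> set ` set (List.subseqs [1..<Suc n]). card S = k}"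
    using len by auto
  also have "set ` set (List.subseqs [1..<Suc n]) = Pow {1..n}"
    unfolding subseqs_powset by (simp add: atLeastLessThanSuc_atLeastAtMost del: upt_Suc)
  finally show "set ` set (scope_lists n) = scopes k n" by (auto simp: scopes_def)
qed

lemma ocsp_of_sample_clause:
  assumes "\<sigma> \<in> samples n" "\<nu> \<in> set (ocsp_of_sample k n \<sigma>)"
  shows "set \<nu> \<in> scopes k n" "\<nu> \<in> permutations_of_set (set \<nu>)"
proof -
  obtain xs where xs: "xs \<in> set (scope_lists n)" "\<sigma> (set xs) = Some \<nu>"
    using assms(2) unfolding ocsp_of_sample_def set_map_filter_iff by blast
  then have S: "set xs \<in> scopes k n" using scope_lists(2) by blast
  then have "\<nu> \<in> permutations_of_set (set xs)" using samplesD[OF assms(1) S] xs(2) by (auto simp: ocsp_alphabet_def)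
  moreover from this have "set \<nu> = set xs" by (rule permutations_of_setD)
  ultimately show "set \<nu> \<in> scopes k n" "\<nu> \<in> permutations_of_set (set \<nu>)" using S by simp_all
qed

text \<open>Places the samples handed to a detector in the class on which the refuter is sound and
  its running time is measured.\<close>

lemma ocsp_of_sample_instance:
  assumes "\<sigma> \<in> samples n"
  shows "ocsp_of_sample k n \<sigma> \<in> ocsp_instances k n" "distinct (map set (ocsp_of_sample k n \<sigma>))"
proof -
  show "ocsp_of_sample k n \<sigma> \<in> ocsp_instances k n"
    unfolding ocsp_instances_def using ocsp_of_sample_clause[OF assms] by (intro in_listsI) blast
  have *: "set \<nu> = set xs" if "xs \<in> set (scope_lists n)" "\<sigma> (set xs) = Some \<nu>" for xs \<nu>
  proof -
    have "set xs \<in> scopes k n" using that scope_lists(2) by blast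
    from samplesD[OF assms this] show ?thesis using that(2) by (auto simp: ocsp_alphabet_def dest: permutations_of_setD)
  qed
  show "distinct (map set (ocsp_of_sample k n \<sigma>))"
    unfolding ocsp_of_sample_def
    by (rule conjunct1[OF distinct_map_filter_image[OF scope_lists(1)]]) (rule *)
qed

lemma sum_list_ocsp_of_sample:
  "(\<Sum>\<nu>\<leftarrow>ocsp_of_sample k n \<sigma>. g \<nu>) = (\<Sum>S\<in>scopes k n. case \<sigma> S of None \<Rightarrow> 0 | Some \<nu> \<Rightarrow> g \<nu>)"
proof -
  let ?h = "\<lambda>S. case \<sigma> S of None \<Rightarrow> 0 | Some \<nu> \<Rightarrow> g \<nu>"
  have "(\<Sum>\<nu>\<leftarrow>ocsp_of_sample k n \<sigma>. g \<nu>) = sum_list (map ?h (map set (scope_lists n)))"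
    unfolding ocsp_of_sample_def sum_list_map_filter by (simp add: o_def)
  also have "\<dots> = sum ?h (set (map set (scope_lists n)))"
    using scope_lists(1) by (rule sum_list_distinct_conv_sum_set)
  finally show ?thesis using scope_lists(2) by simp
qed

text \<open>For x without ties, the sum over the scopes is the number of clauses satisfied by the
  ordering of x minus (avg(P) + \<epsilon>) times the number of clauses. This avoids the random
  denominator in the value.\<close>

definition surplus :: "real \<Rightarrow> (nat \<Rightarrow> real) \<Rightarrow> nat list option \<Rightarrow> real" where
  "surplus \<epsilon> x v = (case v of None \<Rightarrow> 0 | Some \<nu> \<Rightarrow> f (pull \<nu> x) - avg k P - \<epsilon>)"

lemma surplus_nonpos:
  assumes \<sigma>: "\<sigma> \<in> samples n" and x: "inj_on x {1..n}"
    and val: "val n P (ocsp_of_sample k n \<sigma>) \<le> avg k P + \<epsilon>"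
  shows "(\<Sum>S\<in>scopes k n. surplus \<epsilon> x (\<sigma> S)) \<le> 0"
proof -
  let ?I = "ocsp_of_sample k n \<sigma>"
  have "ord_of n x \<in> permutations_of_set {1..n}"
    by (intro permutations_of_setI) (auto simp: ord_of_def)
  then have "val_at P ?I (ord_of n x) \<le> val n P ?I"
    unfolding val_def by (intro Max_ge) auto
  with val have le: "val_at P ?I (ord_of n x) \<le> avg k P + \<epsilon>" by simp
  have "(\<Sum>\<nu>\<leftarrow>?I. of_bool (P (map (ordering_inv \<nu>) (induced_ordering (ord_of n x) (set \<nu>))))) =
      (\<Sum>\<nu>\<leftarrow>?I. f (pull \<nu> x))"
    using ocsp_of_sample_clause[OF \<sigma>] eval_clause[OF x]
    by (intro arg_cong[of _ _ sum_list] map_cong) (auto simp: predicate_fun_def)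
  then have val_at: "val_at P ?I (ord_of n x) = (\<Sum>\<nu>\<leftarrow>?I. f (pull \<nu> x)) / real (length ?I)"
    by (simp add: val_at_def)
  have "(\<Sum>S\<in>scopes k n. surplus \<epsilon> x (\<sigma> S)) = (\<Sum>\<nu>\<leftarrow>?I. f (pull \<nu> x) - avg k P - \<epsilon>)"
    unfolding sum_list_ocsp_of_sample surplus_def ..
  also have "\<dots> = (\<Sum>\<nu>\<leftarrow>?I. f (pull \<nu> x)) - real (length ?I) * (avg k P + \<epsilon>)"
    by (induction ?I rule: list.induct) (simp_all add: sum_list_subtractf sum_list_triv algebra_simps)
  also have "\<dots> \<le> 0"
    \<comment> \<open>The empty instance is separate, its value being a division by zero; there the
      sum is empty.\<close>
    using le unfolding val_at by (cases "?I = []") (auto simp: divide_le_eq mult.commute)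
  finally show ?thesis .
qed

text \<open>Measures how strongly the tilt favours satisfied clauses on S at the point x. Its mean
  over x is \<open>N\<close>, so the division by \<open>N\<close> in the planted weight makes the
  average gain 2 \<epsilon>.\<close>

definition agreement :: "nat set \<Rightarrow> (nat \<Rightarrow> real) \<Rightarrow> real" where
  "agreement S x = (\<Sum>\<nu>\<in>permutations_of_set S. f (pull \<nu> x) * t (pull \<nu> x)) / fact k"

lemma bounded_fun_agreement [intro]: "S \<in> scopes k n \<Longrightarrow> bounded_fun n (agreement S)"
  unfolding agreement_def [abs_def] divide_inverse
  by (intro bounded_fun_mult bounded_fun_sum bounded_fun_const bounded_fun_pull) auto

lemma depends_on_agreement:
  assumes "S \<in> scopes k n" shows "depends_on S (agreement S)"
  unfolding depends_on_def agreement_def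
proof (intro allI impI arg_cong2[of _ _ _ _ "(/)"] sum.cong refl)
  fix x x' :: "nat \<Rightarrow> real" and \<nu> assume "\<forall>i\<in>S. x i = x' i" "\<nu> \<in> permutations_of_set S"
  then show "f (pull \<nu> x) * t (pull \<nu> x) = f (pull \<nu> x') * t (pull \<nu> x')"
    using depends_on_pull[OF assms, of \<nu> "\<lambda>y. f y * t y"] unfolding depends_on_def by blast
qed

lemma integral_agreement:
  assumes S: "S \<in> scopes k n" shows "(\<integral>x. agreement S x \<partial>unit_cube n) = N"
proof -
  have fS: "finite S" "card S = k" using S finite_scope by (auto simp: scopes_iff)
  have ft: "bounded_fun k (\<lambda>y. f y * t y)" by auto
  have "(\<integral>x. (\<Sum>\<nu>\<in>permutations_of_set S. f (pull \<nu> x) * t (pull \<nu> x)) \<partial>unit_cube n) =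
      (\<Sum>\<nu>\<in>permutations_of_set S. \<integral>x. f (pull \<nu> x) * t (pull \<nu> x) \<partial>unit_cube n)"
    using bounded_fun_pull[OF S _ ft] by (intro Bochner_Integration.integral_sum) auto
  also have "\<dots> = (\<Sum>\<nu>\<in>permutations_of_set S. N)"
    using integral_pull[OF S _ ft] integral_f_t by (intro sum.cong) auto
  finally show ?thesis unfolding agreement_def using fS by simp
qed

lemma agreement_abs_le:
  assumes S: "S \<in> scopes k n" shows "\<bar>agreement S x\<bar> \<le> 4 ^ k"
proof -
  have fS: "finite S" "card S = k" using S finite_scope by (auto simp: scopes_iff)
  have "\<bar>\<Sum>\<nu>\<in>permutations_of_set S. f (pull \<nu> x) * t (pull \<nu> x)\<bar> \<le> (\<Sum>\<nu>\<in>permutations_of_set S. 4 ^ k)"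
  proof (intro order_trans[OF sum_abs] sum_mono)
    fix \<nu>
    show "\<bar>f (pull \<nu> x) * t (pull \<nu> x)\<bar> \<le> 4 ^ k"
      unfolding abs_mult using mult_mono[OF f_abs_le t_abs_le, of "pull \<nu> x" "pull \<nu> x"] by simp
  qed
  then show ?thesis unfolding agreement_def using fS by (simp add: divide_le_eq mult.commute)
qed

text \<open>An untilted clause loses \<epsilon> against the benchmark, and the tilt returns 2
  \<epsilon> / N times the agreement, on average 2 \<epsilon>. The constant part of the surplus does
  not feel the tilt, which sums to zero.\<close>

lemma mean_surplus:
  assumes S: "S \<in> scopes k n" and x: "inj_on x {1..n}"
  shows "(\<Sum>v\<in>ocsp_alphabet S. planted_weight k P p \<epsilon> x v * surplus \<epsilon> x v) =
    p * \<epsilon> + 2 * p * \<epsilon> / N * (agreement S x - N)"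
proof -
  have fS: "finite S" "card S = k" using S finite_scope by (auto simp: scopes_iff)
  let ?c = "2 * \<epsilon> / N" and ?\<Pi> = "permutations_of_set S"
  have "(\<Sum>v\<in>ocsp_alphabet S. planted_weight k P p \<epsilon> x v * surplus \<epsilon> x v) =
      (\<Sum>\<nu>\<in>?\<Pi>. p / fact k * (1 + ?c * t (pull \<nu> x)) * (f (pull \<nu> x) - avg k P - \<epsilon>))"
    by (simp add: sum_ocsp_alphabet planted_weight_eq base_def tilt_def surplus_def)
  also have "\<dots> = (\<Sum>\<nu>\<in>?\<Pi>. p / fact k * f (pull \<nu> x) - p / fact k * (avg k P + \<epsilon>)
      + p / fact k * ?c * (f (pull \<nu> x) * t (pull \<nu> x)) - p / fact k * ?c * (avg k P + \<epsilon>) * t (pull \<nu> x))"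
  proof -
    have *: "a * (1 + c * u) * (y - b - e) = a * y - a * (b + e) + a * c * (y * u) - a * c * (b + e) * u"
      for a b c e u y :: real by (simp add: algebra_simps)
    show ?thesis by (rule sum.cong[OF refl]) (rule *)
  qed
  also have "\<dots> = p / fact k * (\<Sum>\<nu>\<in>?\<Pi>. f (pull \<nu> x)) - (\<Sum>\<nu>\<in>?\<Pi>. p / fact k * (avg k P + \<epsilon>))
      + p / fact k * ?c * (\<Sum>\<nu>\<in>?\<Pi>. f (pull \<nu> x) * t (pull \<nu> x))
      - p / fact k * ?c * (avg k P + \<epsilon>) * (\<Sum>\<nu>\<in>?\<Pi>. t (pull \<nu> x))"
    by (simp only: sum.distrib sum_subtractf sum_distrib_left)
  also have "\<dots> = p * avg k P - p * (avg k P + \<epsilon>) + p * ?c * agreement S x"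
    using fS by (simp add: sum_f_orderings[OF x S] sum_t_orderings[OF x S] agreement_def)
  also have "\<dots> = p * \<epsilon> + 2 * p * \<epsilon> / N * (agreement S x - N)"
    using N_pos by (simp add: field_simps)
  finally show ?thesis .
qed

text \<open>Centred agreements on disjoint scopes are independent, so only intersecting pairs
  contribute, a fraction of at most k^2/n of all pairs.\<close>

lemma integral_square_agreement_le:
  assumes "1 \<le> n"
  shows "(\<integral>x. (\<Sum>S\<in>scopes k n. agreement S x - N)\<^sup>2 \<partial>unit_cube n) \<le>
    (4 ^ k + N)\<^sup>2 * (real k * real (n choose k))\<^sup>2 / real n"
proof -
  interpret prob_space "unit_cube n" by (rule prob_space_unit_cube)
  let ?I = "scopes k n" and ?g = "\<lambda>S x. agreement S x - N"
  have bf: "bounded_fun n (?g S)" if "S \<in> ?I" for S using that by auto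
  have mean: "(\<integral>x. ?g S x \<partial>unit_cube n) = 0" if "S \<in> ?I" for S
  proof -
    have "integrable (unit_cube n) (agreement S)" using that by auto
    then show ?thesis using integral_agreement[OF that] by (simp add: prob_space)
  qed
  have abs: "\<bar>?g S x\<bar> \<le> 4 ^ k + N" if "S \<in> ?I" for S x
    using agreement_abs_le[OF that, of x] N_pos by (auto simp: abs_le_iff)
  have cov: "(\<integral>x. ?g S x * ?g T x \<partial>unit_cube n) \<le> (if S \<inter> T \<noteq> {} then (4 ^ k + N)\<^sup>2 else 0)"
    if ST: "S \<in> ?I" "T \<in> ?I" for S T
  proof (cases "S \<inter> T = {}")
    case True
    have dep: "depends_on R (?g R)" if "R \<in> ?I" for R
      using depends_on_agreement[OF that] by (auto simp: depends_on_def)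
    have "(\<integral>x. ?g S x * ?g T x \<partial>unit_cube n) = (\<integral>x. ?g S x \<partial>unit_cube n) * (\<integral>x. ?g T x \<partial>unit_cube n)"
      using ST True by (intro integral_mult_indep[of _ _ _ S T] bf dep) (auto simp: scopes_def)
    then show ?thesis using True mean ST by simp
  next
    case False
    have "?g S x * ?g T x \<le> (4 ^ k + N)\<^sup>2" for x
    proof -
      have "?g S x * ?g T x \<le> \<bar>?g S x\<bar> * \<bar>?g T x\<bar>" by (metis abs_ge_self abs_mult)
      also have "\<dots> \<le> (4 ^ k + N) * (4 ^ k + N)" using abs ST N_pos by (intro mult_mono) auto
      finally show ?thesis by (simp add: power2_eq_square)
    qed
    moreover have "integrable (unit_cube n) (\<lambda>x. ?g S x * ?g T x)"
      using bf ST by (intro bounded_fun_integrable bounded_fun_mult)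
    ultimately have "(\<integral>x. ?g S x * ?g T x \<partial>unit_cube n) \<le> (4 ^ k + N)\<^sup>2"
      by (intro integral_le_const) auto
    then show ?thesis using False by simp
  qed
  have "(\<integral>x. (\<Sum>S\<in>?I. ?g S x)\<^sup>2 \<partial>unit_cube n) = (\<Sum>S\<in>?I. \<Sum>T\<in>?I. \<integral>x. ?g S x * ?g T x \<partial>unit_cube n)"
    unfolding power2_eq_square sum_product using bf
    by (subst Bochner_Integration.integral_sum, force intro!: bounded_fun_integrable bounded_fun_sum bounded_fun_mult,
        intro sum.cong refl Bochner_Integration.integral_sum bounded_fun_integrable bounded_fun_mult)
  also have "\<dots> \<le> (\<Sum>S\<in>?I. \<Sum>T\<in>?I. if S \<inter> T \<noteq> {} then (4 ^ k + N)\<^sup>2 else 0)"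
    using cov by (intro sum_mono)
  also have "\<dots> = (\<Sum>S\<in>?I. real (card {T \<in> ?I. S \<inter> T \<noteq> {}}) * (4 ^ k + N)\<^sup>2)"
    by (intro sum.cong refl) (simp add: sum.If_cases Int_def)
  also have "\<dots> \<le> (\<Sum>S\<in>?I. ((real k)\<^sup>2 * real (n choose k) / real n) * (4 ^ k + N)\<^sup>2)"
    using k_ge_2 assms by (intro sum_mono mult_right_mono card_intersecting_scopes_le) auto
  also have "\<dots> = (4 ^ k + N)\<^sup>2 * (real k * real (n choose k))\<^sup>2 / real n"
    by (simp add: card_scopes power2_eq_square mult_ac)
  finally show ?thesis .
qed

text \<open>Chebyshev's inequality for the number of satisfied clauses minus its benchmark value,
  evaluated at the ordering by which the planted model is tilted.\<close>

lemma prob_planted_val_le: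
  assumes n: "k \<le> n" and params: "0 < p" "p \<le> 1" "0 < \<epsilon>" "\<epsilon> \<le> 1 / (2 ^ (2 * k + 1) * fact (2 * k))"
  shows "measure_pmf.prob (planted_ocsp k P p \<epsilon> n) {\<sigma>. val n P (ocsp_of_sample k n \<sigma>) \<le> avg k P + \<epsilon>} \<le>
    4 / (p * real (n choose k) * \<epsilon>\<^sup>2) + (2 * real k * (4 ^ k + N) / N)\<^sup>2 / real n"
proof -
  let ?I = "scopes k n" and ?bad = "{\<sigma>. val n P (ocsp_of_sample k n \<sigma>) \<le> avg k P + \<epsilon>}"
  let ?W = "\<lambda>x \<sigma>. \<Prod>S\<in>?I. planted_weight k P p \<epsilon> x (\<sigma> S)"
  let ?C = "real (n choose k)"
  interpret prob_space "unit_cube n" by (rule prob_space_unit_cube)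
  have n1: "1 \<le> n" using n k_ge_2 by simp
  have C: "0 < ?C" using n by simp
  \<comment> \<open>The mean of the total surplus over both x and the clauses. A sample of value at
    most avg(P) + \<epsilon> has surplus at most 0, hence deviates by at least \<mu>.\<close>
  define \<mu> where "\<mu> = p * ?C * \<epsilon>"
  have \<mu>: "0 < \<mu>" using params C by (simp add: \<mu>_def)
  \<comment> \<open>The Chebyshev bound at fixed x. The second part is the squared bias: the mean
    surplus given x differs from \<mu> by the fluctuation of the agreements.\<close>
  define B where "B x = (4 * p * ?C + (2 * p * \<epsilon> / N)\<^sup>2 * (\<Sum>S\<in>?I. agreement S x - N)\<^sup>2) / \<mu>\<^sup>2" for x
  have \<epsilon>1: "\<epsilon> \<le> 1"
  proof -
    have "(1::real) \<le> 2 ^ (2 * k + 1) * fact (2 * k)"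
      using mult_mono[of 1 "2 ^ (2 * k + 1)" 1 "fact (2 * k) :: real"] by (simp add: fact_ge_1)
    then have "1 / (2 ^ (2 * k + 1) * fact (2 * k)) \<le> (1::real)" by (simp add: divide_le_eq)
    then show ?thesis using params by linarith
  qed
  have avg01: "0 < avg k P" "avg k P < 1" using nontrivial_P by (auto simp: nontrivial_def)
  have W_nonneg: "0 \<le> ?W x \<sigma>" for x \<sigma>
    using planted_weight_nonneg params by (intro prod_nonneg) auto
  have main: "(\<Sum>\<sigma>\<in>samples n \<inter> ?bad. ?W x \<sigma>) \<le> B x" if x: "inj_on x {1..n}" for x
  proof -
    let ?Z = "\<lambda>\<sigma>. \<Sum>S\<in>?I. surplus \<epsilon> x (\<sigma> S)"
    let ?y = "\<lambda>S. \<Sum>v\<in>ocsp_alphabet S. planted_weight k P p \<epsilon> x v * surplus \<epsilon> x v"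
    have "\<mu>\<^sup>2 * (\<Sum>\<sigma>\<in>samples n \<inter> ?bad. ?W x \<sigma>) \<le> (\<Sum>\<sigma>\<in>samples n \<inter> ?bad. ?W x \<sigma> * (?Z \<sigma> - \<mu>)\<^sup>2)"
      unfolding sum_distrib_left
    proof (intro sum_mono)
      fix \<sigma> assume "\<sigma> \<in> samples n \<inter> ?bad"
      then have "?Z \<sigma> \<le> 0" using surplus_nonpos[OF _ x] by blast
      then have "\<mu> \<le> \<bar>?Z \<sigma> - \<mu>\<bar>" by simp
      then have "\<mu>\<^sup>2 \<le> (?Z \<sigma> - \<mu>)\<^sup>2" using \<mu> by (metis abs_le_square_iff abs_of_pos)
      then show "\<mu>\<^sup>2 * ?W x \<sigma> \<le> ?W x \<sigma> * (?Z \<sigma> - \<mu>)\<^sup>2"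
        using W_nonneg[of x \<sigma>] by (subst mult.commute) (rule mult_left_mono)
    qed
    also have "\<dots> \<le> (\<Sum>\<sigma>\<in>samples n. ?W x \<sigma> * (?Z \<sigma> - \<mu>)\<^sup>2)"
      using W_nonneg by (intro sum_mono2) auto
    also have "\<dots> = (\<Sum>S\<in>?I. (\<Sum>v\<in>ocsp_alphabet S. planted_weight k P p \<epsilon> x v * (surplus \<epsilon> x v)\<^sup>2) - (?y S)\<^sup>2)
        + ((\<Sum>S\<in>?I. ?y S) - \<mu>)\<^sup>2"
      using sum_planted_weight[OF _ x] by (intro sum_PiE_square_deviation) auto
    also have "\<dots> \<le> (\<Sum>S\<in>?I. 4 * p) + ((2 * p * \<epsilon> / N) * (\<Sum>S\<in>?I. agreement S x - N))\<^sup>2"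
    proof (intro add_mono sum_mono)
      fix S assume S: "S \<in> ?I"
      \<comment> \<open>The surplus is at most 2 in absolute value and zero on omitted scopes, which
        leaves 4 times the inclusion probability.\<close>
      have "(\<Sum>v\<in>ocsp_alphabet S. planted_weight k P p \<epsilon> x v * (surplus \<epsilon> x v)\<^sup>2) \<le>
          (\<Sum>\<nu>\<in>permutations_of_set S. planted_weight k P p \<epsilon> x (Some \<nu>) * 4)"
        unfolding sum_ocsp_alphabet
      proof -
        have "planted_weight k P p \<epsilon> x (Some \<nu>) * (surplus \<epsilon> x (Some \<nu>))\<^sup>2 \<le> planted_weight k P p \<epsilon> x (Some \<nu>) * 4" for \<nu>
        proof (intro mult_left_mono)
          have "0 \<le> f (pull \<nu> x)" "f (pull \<nu> x) \<le> 1" by (auto simp: predicate_fun_def)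
          then have "\<bar>surplus \<epsilon> x (Some \<nu>)\<bar> \<le> 2" using avg01 \<epsilon>1 params by (auto simp: surplus_def abs_le_iff)
          then have "(surplus \<epsilon> x (Some \<nu>))\<^sup>2 \<le> 2\<^sup>2" by (subst abs_le_square_iff[symmetric]) simp
          then show "(surplus \<epsilon> x (Some \<nu>))\<^sup>2 \<le> 4" by simp
        qed (use planted_weight_nonneg params in auto)
        then show "planted_weight k P p \<epsilon> x None * (surplus \<epsilon> x None)\<^sup>2 +
            (\<Sum>\<nu>\<in>permutations_of_set S. planted_weight k P p \<epsilon> x (Some \<nu>) * (surplus \<epsilon> x (Some \<nu>))\<^sup>2) \<le>
            (\<Sum>\<nu>\<in>permutations_of_set S. planted_weight k P p \<epsilon> x (Some \<nu>) * 4)"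
          by (simp add: surplus_def sum_mono)
      qed
      also have "\<dots> = (1 - planted_weight k P p \<epsilon> x None) * 4"
        using sum_planted_weight[OF S x, of p \<epsilon>] by (simp add: sum_ocsp_alphabet sum_distrib_right[symmetric])
      also have "\<dots> = 4 * p" by (simp add: planted_weight_def)
      finally show "(\<Sum>v\<in>ocsp_alphabet S. planted_weight k P p \<epsilon> x v * (surplus \<epsilon> x v)\<^sup>2) - (?y S)\<^sup>2 \<le> 4 * p"
        by (smt (verit) zero_le_power2)
    next
      have "(\<Sum>S\<in>?I. ?y S) - \<mu> = (2 * p * \<epsilon> / N) * (\<Sum>S\<in>?I. agreement S x - N)"
        by (simp add: mean_surplus[OF _ x] sum.distrib card_scopes \<mu>_def sum_distrib_left)
      then show "((\<Sum>S\<in>?I. ?y S) - \<mu>)\<^sup>2 \<le> ((2 * p * \<epsilon> / N) * (\<Sum>S\<in>?I. agreement S x - N))\<^sup>2" by simp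
    qed
    also have "\<dots> = \<mu>\<^sup>2 * B x"
      using \<mu> by (simp only: B_def power_mult_distrib) (simp add: card_scopes)
    finally show ?thesis using \<mu> by simp
  qed
  have bfB: "bounded_fun n B"
    unfolding B_def [abs_def] divide_inverse
    by (intro bounded_fun_mult bounded_fun_add bounded_fun_const bounded_fun_power bounded_fun_sum bounded_fun_diff
        bounded_fun_agreement)
  have bfS: "bounded_fun n (\<lambda>x. (\<Sum>S\<in>?I. agreement S x - N)\<^sup>2)"
    by (intro bounded_fun_power bounded_fun_sum bounded_fun_diff bounded_fun_const bounded_fun_agreement)
  have "measure_pmf.prob (planted_ocsp k P p \<epsilon> n) ?bad =
      measure_pmf.expectation (planted_ocsp k P p \<epsilon> n) (indicator ?bad)" by simp
  also have "\<dots> = (\<Sum>\<sigma>\<in>samples n. planted_mass p \<epsilon> n \<sigma> * indicator ?bad \<sigma>)"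
    by (rule expectation_planted) (use params in auto)
  also have "\<dots> = (\<Sum>\<sigma>\<in>samples n \<inter> ?bad. planted_mass p \<epsilon> n \<sigma>)"
    by (simp add: indicator_def sum.If_cases)
  also have "\<dots> = (\<integral>x. (\<Sum>\<sigma>\<in>samples n \<inter> ?bad. ?W x \<sigma>) \<partial>unit_cube n)"
    unfolding planted_mass_def
    by (intro Bochner_Integration.integral_sum[symmetric] bounded_fun_integrable bounded_fun_planted_prod) auto
  also have "\<dots> \<le> (\<integral>x. B x \<partial>unit_cube n)"
  proof (rule integral_mono_AE)
    show "integrable (unit_cube n) (\<lambda>x. \<Sum>\<sigma>\<in>samples n \<inter> ?bad. ?W x \<sigma>)"
      by (intro bounded_fun_integrable bounded_fun_sum bounded_fun_planted_prod) auto
    show "integrable (unit_cube n) B" using bfB by (rule bounded_fun_integrable)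
    show "AE x in unit_cube n. (\<Sum>\<sigma>\<in>samples n \<inter> ?bad. ?W x \<sigma>) \<le> B x"
      using AE_unit_cube_inj by eventually_elim (rule main)
  qed
  also have "\<dots> = (4 * p * ?C + (2 * p * \<epsilon> / N)\<^sup>2 * (\<integral>x. (\<Sum>S\<in>?I. agreement S x - N)\<^sup>2 \<partial>unit_cube n)) / \<mu>\<^sup>2"
    unfolding B_def using bounded_fun_integrable[OF bfS] by (simp add: prob_space)
  also have "\<dots> \<le> (4 * p * ?C + (2 * p * \<epsilon> / N)\<^sup>2 * ((4 ^ k + N)\<^sup>2 * (real k * ?C)\<^sup>2 / real n)) / \<mu>\<^sup>2"
    using params
    by (intro divide_right_mono add_mono mult_left_mono integral_square_agreement_le n1) auto
  also have "\<dots> = 4 / (p * ?C * \<epsilon>\<^sup>2) + (2 * real k * (4 ^ k + N) / N)\<^sup>2 / real n"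
  proof -
    \<comment> \<open>In the second summand p, the number of scopes and \<epsilon> all cancel: drift
      and fluctuation scale alike.\<close>
    have "(4 * p * c + (2 * p * \<epsilon> / N)\<^sup>2 * (b\<^sup>2 * (a * c)\<^sup>2 / m)) / (p * c * \<epsilon>)\<^sup>2 =
        4 / (p * c * \<epsilon>\<^sup>2) + (2 * a * b / N)\<^sup>2 / m" if "0 < c" "0 < m" for a b c m :: real
      using that params N_pos by (simp add: field_simps power2_eq_square)
    then show ?thesis using C n1 by (simp add: \<mu>_def)
  qed
  finally show ?thesis .
qed

end

section \<open>From refutation to detection\<close>

text \<open>A refuter accepts in order to certify, which speaks for the null distribution, whereas a
  detector accepts to announce the planted one.\<close>

definition swap_answers :: "tm \<Rightarrow> tm" where
  "swap_answers M = M\<lparr>tm_accept := tm_reject M, tm_reject := tm_accept M\<rparr>"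

lemma turing_machine_swap: "turing_machine M \<Longrightarrow> turing_machine (swap_answers M)"
  unfolding turing_machine_def swap_answers_def by auto

text \<open>The step function asks only whether the state is one of the two halting ones, which is
  symmetric under the exchange.\<close>

lemma tm_state_after_swap [simp]: "tm_state_after (swap_answers M) = tm_state_after M"
proof -
  have "tm_step (swap_answers M) = tm_step M"
    unfolding tm_step_def swap_answers_def by (auto simp: fun_eq_iff)
  moreover have "tm_init (swap_answers M) = tm_init M"
    by (simp add: fun_eq_iff tm_init_def swap_answers_def)
  ultimately show ?thesis by (intro ext) (simp add: tm_state_after_def)
qed

lemma tm_halts_within_swap [simp]: "tm_halts_within (swap_answers M) = tm_halts_within M"
  by (auto simp: fun_eq_iff tm_halts_within_def) (auto simp: swap_answers_def)

lemma tm_halts_swap [simp]: "tm_halts (swap_answers M) = tm_halts M"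
  by (simp add: fun_eq_iff tm_halts_def)

lemma tm_state_after_halted:
  assumes "tm_state_after M w s \<in> {tm_accept M, tm_reject M}" "s \<le> s'"
  shows "tm_state_after M w s' = tm_state_after M w s"
proof -
  let ?c = "(tm_step M ^^ s) (tm_init M w)"
  have "tm_step M ?c = ?c"
    using assms(1) by (cases ?c) (auto simp: tm_step_def tm_state_after_def)
  then have "(tm_step M ^^ j) ?c = ?c" for j by (induction j) auto
  then have "(tm_step M ^^ (s' - s + s)) (tm_init M w) = ?c" by (simp only: funpow_add o_apply)
  then show ?thesis using assms(2) by (simp add: tm_state_after_def)
qed

text \<open>Halting configurations are fixed points, so a halting run ends in exactly one of the two
  states. On a run that never halts neither machine would accept.\<close>

lemma tm_accepts_swap:
  assumes "turing_machine M" "tm_halts M w"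
  shows "tm_accepts (swap_answers M) w \<longleftrightarrow> \<not> tm_accepts M w"
proof -
  have ne: "tm_accept M \<noteq> tm_reject M" using assms(1) by (simp add: turing_machine_def)
  obtain s where s: "tm_state_after M w s \<in> {tm_accept M, tm_reject M}"
    using assms(2) by (auto simp: tm_halts_def tm_halts_within_def)
  have final: "tm_state_after M w s' = tm_state_after M w s" if "tm_state_after M w s' \<in> {tm_accept M, tm_reject M}" for s'
    using tm_state_after_halted[OF s, of s'] tm_state_after_halted[OF that, of s] by (cases "s \<le> s'") auto
  have "tm_accepts M w \<longleftrightarrow> tm_state_after M w s = tm_accept M"
    unfolding tm_accepts_def using final by (metis insertI1)
  moreover have "tm_accepts (swap_answers M) w \<longleftrightarrow> tm_state_after M w s = tm_reject M"
    unfolding tm_accepts_def tm_state_after_swap using final by (simp add: swap_answers_def) metis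
  ultimately show ?thesis using s ne by auto
qed

lemma runs_in_time_swap:
  assumes "runs_in_time M X T" "\<And>n. Y n \<subseteq> X n"
  shows "runs_in_time (swap_answers M) Y T"
proof -
  have "eventually (\<lambda>n. \<forall>w\<in>X n. tm_halts_within M w (T n)) sequentially"
    using assms(1) unfolding runs_in_time_def by blast
  then have "eventually (\<lambda>n. \<forall>w\<in>Y n. tm_halts_within M w (T n)) sequentially"
    by eventually_elim (use assms(2) in blast)
  then show ?thesis using assms unfolding runs_in_time_def by simp blast
qed

section \<open>The pair of null and planted models as a detection problem\<close>

lemma ocsp_detection_simps [simp]:
  "coords (ocsp_detection k P p \<epsilon>) = scopes k"
  "alphabet (ocsp_detection k P p \<epsilon>) n = ocsp_alphabet"
  "planted (ocsp_detection k P p \<epsilon>) n = planted_ocsp k P (p n) (\<epsilon> n) n"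
  "null (ocsp_detection k P p \<epsilon>) n = null_ocsp k (p n) n"
  "sample_word (ocsp_detection k P p \<epsilon>) n \<sigma> = encode_instance n (ocsp_of_sample k n \<sigma>)"
  "sample_space (ocsp_detection k P p \<epsilon>) n = PiE (scopes k n) ocsp_alphabet"
  by (simp_all add: ocsp_detection_def sample_space_def)

lemma polynomially_many_ocsp_coords: "polynomially_many_coords (ocsp_detection k P p \<epsilon>)"
  unfolding polynomially_many_coords_def
proof (intro conjI allI exI)
  have "eventually (\<lambda>n. norm (real (card (scopes k n))) \<le> 1 * norm (real n ^ k)) at_top"
    using eventually_ge_at_top[of k]
  proof eventually_elim
    case (elim n)
    then have "real (n choose k) \<le> real (n ^ k)" using binomial_le_pow[of k n] by (simp only: of_nat_le_iff)
    then show ?case by (simp add: card_scopes)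
  qed
  then show "(\<lambda>n. real (card (coords (ocsp_detection k P p \<epsilon>) n))) \<in> O(\<lambda>n. real n ^ k)"
    by (intro bigoI[of _ 1]) simp
qed simp

text \<open>The parameters are constrained only from n = k on; below that there are no scopes, and
  both models consist of a single sample.\<close>

locale ocsp_sequence = ordering_predicate +
  fixes p \<epsilon> :: "nat \<Rightarrow> real"
  assumes p: "k \<le> n \<Longrightarrow> 0 < p n \<and> p n \<le> 1"
    and \<epsilon>: "k \<le> n \<Longrightarrow> 0 < \<epsilon> n \<and> \<epsilon> n \<le> 1 / (2 ^ (2 * k + 1) * fact (2 * k))"
begin

abbreviation "X \<equiv> ocsp_detection k P p \<epsilon>"

lemma set_pmf_planted: "set_pmf (planted_ocsp k P (p n) (\<epsilon> n) n) \<subseteq> samples n"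
  using pmf_planted[of n "p n" "\<epsilon> n"] p[of n] \<epsilon>[of n] by (auto simp: set_pmf_iff split: if_splits)

lemma set_pmf_null: "set_pmf (null_ocsp k (p n) n) \<subseteq> samples n"
  using pmf_null[of n "p n"] p[of n] by (auto simp: set_pmf_iff split: if_splits)

lemma supported: "supported_on_product X"
  using set_pmf_planted set_pmf_null by (simp add: supported_on_product_def)

lemma product: "product_null X"
  unfolding product_null_def ocsp_detection_simps null_ocsp_def by blast

text \<open>The constant is (1 + 2)/2, from the normalisation of the test function and the geometric
  series over concentrated sets.\<close>

lemma advantage_le:
  assumes n: "k \<le> n" and D: "k * D \<le> n"
    and small: "(2 * \<epsilon> n / N)\<^sup>2 * p n * 16 ^ k * (exp (real d / 2 + 1) * (real d / 2) powr (real d / 2) * real n ^ k / real n *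
      (real D / real n) powr (real d / 2 - 1)) \<le> 1 / 2"
  shows "advantage X n D \<le> ereal (3 / 2)"
  unfolding advantage_def ocsp_detection_simps
proof (intro SUP_least)
  fix g assume g: "g \<in> {g \<in> low_coordinate_degree (scopes k n) D.
      integrable (measure_pmf (planted_ocsp k P (p n) (\<epsilon> n) n)) g \<and>
      integrable (measure_pmf (null_ocsp k (p n) n)) (\<lambda>\<sigma>. (g \<sigma>)\<^sup>2) \<and>
      measure_pmf.expectation (null_ocsp k (p n) n) (\<lambda>\<sigma>. (g \<sigma>)\<^sup>2) \<le> 1}"
  then have "null_mean (p n) n (\<lambda>\<sigma>. (g \<sigma>)\<^sup>2) \<le> 1" using expectation_null[of n "p n"] p by simp
  then have "measure_pmf.expectation (planted_ocsp k P (p n) (\<epsilon> n) n) g \<le>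
    (1 + (\<Sum>A | A \<subseteq> scopes k n \<and> card A \<le> D \<and> concentrated n d A. ((2 * \<epsilon> n / N)\<^sup>2 * p n * 16 ^ k) ^ card A)) / 2"
    using p[OF n] \<epsilon>[OF n] g by (intro expectation_planted_le) auto
  moreover have "(\<Sum>A | A \<subseteq> scopes k n \<and> card A \<le> D \<and> concentrated n d A. ((2 * \<epsilon> n / N)\<^sup>2 * p n * 16 ^ k) ^ card A) \<le> 2"
    using p[OF n] by (intro sum_concentrated_le D small) auto
  ultimately show "ereal (measure_pmf.expectation (planted_ocsp k P (p n) (\<epsilon> n) n) g) \<le> ereal (3 / 2)"
    by simp
qed

text \<open>The count carries p n^k and the hypothesis p (n choose k), which are comparable up to a
  factor k^k. The power of D/n in the count then cancels the power of n/D allowed by the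
  hypothesis.\<close>

lemma bounded_advantage:
  assumes D: "\<forall>n\<ge>k. 1 \<le> D n \<and> real (D n) \<le> real n / real k"
    and sparse: "(\<lambda>n. p n * real (n choose k)) \<in>
      o(\<lambda>n. real n / (\<epsilon> n)\<^sup>2 * (real n / real (D n)) powr (real d / 2 - 1))"
  shows "bounded_advantage X D"
proof -
  define Y where "Y = 4 / N\<^sup>2 * 16 ^ k"
  define K where "K = exp (real d / 2 + 1) * (real d / 2) powr (real d / 2)"
  \<comment> \<open>The constant extracted from the little-o hypothesis, chosen so that all factors
    multiply to exactly 1/2 at the end.\<close>
  define \<delta> where "\<delta> = 1 / (2 * Y * K * real k ^ k)"
  have pos: "0 < Y" "0 < K" "0 < real k ^ k" using N_pos k_ge_2 d_bounds by (auto simp: Y_def K_def)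
  then have \<delta>: "0 < \<delta>" by (simp add: \<delta>_def)
  have "eventually (\<lambda>n. norm (p n * real (n choose k)) \<le>
      \<delta> * norm (real n / (\<epsilon> n)\<^sup>2 * (real n / real (D n)) powr (real d / 2 - 1))) at_top"
    using sparse \<delta> by (rule landau_o.smallD)
  then have "eventually (\<lambda>n. advantage X n (D n) \<le> ereal (3 / 2)) at_top"
    using eventually_ge_at_top[of k]
  proof eventually_elim
    case (elim n)
    let ?e = "real d / 2 - 1"
    have n: "0 < real n" using elim k_ge_2 by simp
    have Dn: "0 < real (D n)" "real (D n) * real k \<le> real n" using D elim k_ge_2 by (auto simp: field_simps)
    have "real (k * D n) \<le> real n" using Dn by (simp add: mult.commute)
    then have kD: "k * D n \<le> n" by (simp only: of_nat_le_iff)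
    note pn = p[OF elim(2)] and en = \<epsilon>[OF elim(2)]
    have pC: "p n * real (n choose k) * (\<epsilon> n)\<^sup>2 \<le> \<delta> * (real n * (real n / real (D n)) powr ?e)"
    proof -
      have "p n * real (n choose k) \<le> \<delta> * (real n / (\<epsilon> n)\<^sup>2 * (real n / real (D n)) powr ?e)"
        using elim(1) pn by simp
      then show ?thesis using en by (simp add: field_simps)
    qed
    have nk: "real n ^ k \<le> real k ^ k * real (n choose k)"
      using binomial_ge_n_over_k_pow_k[OF elim(2), where 'a = real] pos(3) by (simp add: power_divide field_simps)
    have inv: "(real n / real (D n)) powr ?e * (real (D n) / real n) powr ?e = 1"
      using n Dn by (simp add: powr_mult[symmetric])
    have "(2 * \<epsilon> n / N)\<^sup>2 * p n * 16 ^ k * (K * real n ^ k / real n * (real (D n) / real n) powr ?e) =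
        Y * K / real n * (real (D n) / real n) powr ?e * (p n * (\<epsilon> n)\<^sup>2) * real n ^ k"
      by (simp add: Y_def power_divide power_mult_distrib)
    also have "\<dots> \<le> Y * K / real n * (real (D n) / real n) powr ?e * (p n * (\<epsilon> n)\<^sup>2) * (real k ^ k * real (n choose k))"
      using pos pn n by (intro mult_left_mono[OF nk] mult_nonneg_nonneg) auto
    also have "\<dots> = Y * K * real k ^ k / real n * (real (D n) / real n) powr ?e * (p n * real (n choose k) * (\<epsilon> n)\<^sup>2)"
      by simp
    also have "\<dots> \<le> Y * K * real k ^ k / real n * (real (D n) / real n) powr ?e *
        (\<delta> * (real n * (real n / real (D n)) powr ?e))"
      using pos n by (intro mult_left_mono[OF pC] mult_nonneg_nonneg divide_nonneg_nonneg) auto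
    also have "\<dots> = Y * K * real k ^ k * \<delta> * ((real n / real (D n)) powr ?e * (real (D n) / real n) powr ?e)"
      using n by simp
    also have "\<dots> = 1 / 2" unfolding inv using pos by (simp add: \<delta>_def)
    finally show ?case unfolding K_def by (intro advantage_le elim(2) kD)
  qed
  then show ?thesis unfolding bounded_advantage_def by blast
qed

lemma planted_val_tendsto:
  assumes "(\<lambda>n. p n * real (n choose k) * (\<epsilon> n)\<^sup>2) \<in> \<omega>(\<lambda>n. 1)"
  shows "(\<lambda>n. measure_pmf.prob (planted_ocsp k P (p n) (\<epsilon> n) n)
      {\<sigma>. val n P (ocsp_of_sample k n \<sigma>) \<le> avg k P + \<epsilon> n}) \<longlonglongrightarrow> 0"
proof (rule tendsto_sandwich[where f = "\<lambda>_. 0"])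
  let ?m = "\<lambda>n. p n * real (n choose k) * (\<epsilon> n)\<^sup>2" and ?c = "(2 * real k * (4 ^ k + N) / N)\<^sup>2"
  have "(\<lambda>n. 1) \<in> o(?m)" using assms by (simp add: smallomega_iff_smallo)
  then have "(\<lambda>n. 4 * (1 / ?m n)) \<longlonglongrightarrow> 4 * 0" by (intro tendsto_mult tendsto_const smalloD_tendsto)
  then have "(\<lambda>n. 4 / ?m n + ?c / real n) \<longlonglongrightarrow> 0 + 0"
    by (intro tendsto_add lim_const_over_n) simp
  then show "(\<lambda>n. 4 / ?m n + ?c / real n) \<longlonglongrightarrow> 0" by simp
  show "eventually (\<lambda>n. measure_pmf.prob (planted_ocsp k P (p n) (\<epsilon> n) n)
      {\<sigma>. val n P (ocsp_of_sample k n \<sigma>) \<le> avg k P + \<epsilon> n} \<le> 4 / ?m n + ?c / real n) at_top"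
    using eventually_ge_at_top[of k]
    by eventually_elim (use prob_planted_val_le p \<epsilon> in blast)
qed auto

text \<open>The refuter promises no success under the planted law, but soundness on every instance
  turns an accepting run into a small value, which is unlikely there. Under the null law the error
  is the failure probability of the refuter.\<close>

lemma strong_detection_of_refutation:
  assumes M: "achieves_refutation M k P p \<epsilon>"
    and dense: "(\<lambda>n. p n * real (n choose k) * (\<epsilon> n)\<^sup>2) \<in> \<omega>(\<lambda>n. 1)"
  shows "strong_detection X (\<lambda>n \<sigma>. tm_accepts (swap_answers M) (sample_word X n \<sigma>))"
proof -
  let ?acc = "\<lambda>n \<sigma>. tm_accepts M (encode_instance n (ocsp_of_sample k n \<sigma>))"
  let ?acc' = "\<lambda>n \<sigma>. tm_accepts (swap_answers M) (encode_instance n (ocsp_of_sample k n \<sigma>))"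
  have swap: "?acc' n \<sigma> \<longleftrightarrow> \<not> ?acc n \<sigma>" if "\<sigma> \<in> samples n" for n \<sigma>
    using M ocsp_of_sample_instance(1)[OF that] by (intro tm_accepts_swap) (auto simp: achieves_refutation_def)
  have sound: "val n P (ocsp_of_sample k n \<sigma>) \<le> avg k P + \<epsilon> n" if "\<sigma> \<in> samples n" "?acc n \<sigma>" for n \<sigma>
    using M ocsp_of_sample_instance(1)[OF that(1)] that(2) by (auto simp: achieves_refutation_def)
  have "(\<lambda>n. measure_pmf.prob (planted_ocsp k P (p n) (\<epsilon> n) n) {\<sigma>. \<not> ?acc' n \<sigma>}) \<longlonglongrightarrow> 0"
  proof (rule tendsto_sandwich[OF _ _ _ planted_val_tendsto[OF dense]])
    show "eventually (\<lambda>n. measure_pmf.prob (planted_ocsp k P (p n) (\<epsilon> n) n) {\<sigma>. \<not> ?acc' n \<sigma>} \<le>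
        measure_pmf.prob (planted_ocsp k P (p n) (\<epsilon> n) n) {\<sigma>. val n P (ocsp_of_sample k n \<sigma>) \<le> avg k P + \<epsilon> n}) at_top"
    proof (intro always_eventually allI)
      fix n
      let ?Q = "planted_ocsp k P (p n) (\<epsilon> n) n"
      \<comment> \<open>Soundness and the exchange of answers are available only on genuine samples,
        so the event is cut down to the support.\<close>
      have "measure_pmf.prob ?Q {\<sigma>. \<not> ?acc' n \<sigma>} = measure_pmf.prob ?Q ({\<sigma>. \<not> ?acc' n \<sigma>} \<inter> set_pmf ?Q)"
        by (simp add: measure_Int_set_pmf)
      also have "\<dots> \<le> measure_pmf.prob ?Q {\<sigma>. val n P (ocsp_of_sample k n \<sigma>) \<le> avg k P + \<epsilon> n}"
      proof (rule measure_pmf.finite_measure_mono)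
        show "{\<sigma>. \<not> ?acc' n \<sigma>} \<inter> set_pmf ?Q \<subseteq> {\<sigma>. val n P (ocsp_of_sample k n \<sigma>) \<le> avg k P + \<epsilon> n}"
          using set_pmf_planted swap sound by blast
      qed simp
      finally show "measure_pmf.prob ?Q {\<sigma>. \<not> ?acc' n \<sigma>} \<le>
        measure_pmf.prob ?Q {\<sigma>. val n P (ocsp_of_sample k n \<sigma>) \<le> avg k P + \<epsilon> n}" .
    qed
  qed auto
  moreover have "(\<lambda>n. measure_pmf.prob (null_ocsp k (p n) n) {\<sigma>. ?acc' n \<sigma>}) \<longlonglongrightarrow> 0"
  proof -
    have null: "measure_pmf.prob (null_ocsp k (p n) n) {\<sigma>. ?acc' n \<sigma>} =
        1 - measure_pmf.prob (random_ocsp k (p n) n) {I. tm_accepts M (encode_instance n I)}" for n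
    proof -
      let ?Q = "null_ocsp k (p n) n"
      have "{\<sigma>. ?acc' n \<sigma>} \<inter> set_pmf ?Q = (UNIV - {\<sigma>. ?acc n \<sigma>}) \<inter> set_pmf ?Q"
        using set_pmf_null swap by blast
      then have "measure_pmf.prob ?Q {\<sigma>. ?acc' n \<sigma>} = measure_pmf.prob ?Q (UNIV - {\<sigma>. ?acc n \<sigma>})"
        by (metis measure_Int_set_pmf)
      also have "\<dots> = 1 - measure_pmf.prob ?Q {\<sigma>. ?acc n \<sigma>}"
        using measure_pmf.prob_compl[of "{\<sigma>. ?acc n \<sigma>}" ?Q] by simp
      finally show ?thesis by (simp add: random_ocsp_def vimage_def)
    qed
    have "(\<lambda>n. 1 - measure_pmf.prob (random_ocsp k (p n) n) {I. tm_accepts M (encode_instance n I)}) \<longlonglongrightarrow> 1 - 1"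
      using M unfolding achieves_refutation_def by (intro tendsto_diff tendsto_const) blast
    then show ?thesis by (simp add: null)
  qed
  ultimately show ?thesis
    unfolding strong_detection_def ocsp_detection_simps using tendsto_add by fastforce
qed

end

theorem theorem3p5:
  fixes k d :: nat and P :: "nat list \<Rightarrow> bool"
    and p \<epsilon> L :: "nat \<Rightarrow> real" and D :: "nat \<Rightarrow> nat"
    and nice :: "(nat set, nat list option) detection_problem \<Rightarrow> bool"
  assumes "2 \<le> k"
    and "nontrivial k P"
    and "d = predicate_degree k P"
    and "\<forall>n\<ge>k. 0 < p n \<and> p n \<le> 1"
    and "\<forall>n\<ge>k. 0 < \<epsilon> n \<and> \<epsilon> n \<le> 1 / (2 ^ (2 * k + 1) * fact (2 * k))"
    and "\<forall>n\<ge>k. 1 \<le> D n \<and> real (D n) \<le> real n / real k"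
    and "polylogarithmic L"
    and "low_degree_conjecture nice L"
    and "nice (ocsp_detection k P p \<epsilon>)"
    and "(\<lambda>n. p n * real (n choose k)) \<in>
           o(\<lambda>n. real n / (\<epsilon> n)\<^sup>2 * (real n / real (D n)) powr (real d / 2 - 1))"
    and "(\<lambda>n. p n * real (n choose k) * (\<epsilon> n)\<^sup>2) \<in> \<omega>(\<lambda>n. 1)"
  shows "\<not> (\<exists>M C. achieves_refutation M k P p \<epsilon> \<and>
                  runs_in_time M (ocsp_inputs k) (\<lambda>n. exp (C * real (D n) / L n)))"
proof (rule notI, elim exE conjE)
  interpret ocsp_sequence k P p \<epsilon>
    using assms by unfold_locales auto
  fix M C
  assume M: "achieves_refutation M k P p \<epsilon>"
    and time: "runs_in_time M (ocsp_inputs k) (\<lambda>n. exp (C * real (D n) / L n))"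
  have "sample_word X n ` sample_space X n \<subseteq> ocsp_inputs k n" for n
    using ocsp_of_sample_instance by (auto simp: ocsp_inputs_def)
  then have "runs_in_time (swap_answers M) (\<lambda>n. sample_word X n ` sample_space X n) (\<lambda>n. exp (C * real (D n) / L n))"
    by (rule runs_in_time_swap[OF time])
  moreover have "turing_machine (swap_answers M)"
    using M by (intro turing_machine_swap) (simp add: achieves_refutation_def)
  ultimately have "strongly_detectable_in_time X (\<lambda>n. exp (C * real (D n) / L n))"
    using strong_detection_of_refutation[OF M assms(11)] unfolding strongly_detectable_in_time_def by blast
  moreover have "bounded_advantage X D"
    using assms by (intro bounded_advantage) auto
  ultimately show False
    using assms(8,9) polynomially_many_ocsp_coords supported product
    unfolding low_degree_conjecture_def by blast
qed

end
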